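(* Let $G$ be a (connected) non-simple graph and $e\in E(G)$. Then $$\frac13\,\delta(G/e)\le \delta(G)\le \frac{16}{3}\,\delta(G/e)+1 .$$
   Context: Non-simple graphs are graphs in which loops and multiple edges are allowed. Graphs are connected, nonempty, possibly infinite, and every edge has length $1$. $G$ is regarded as a geodesic metric space: each edge is identified with $[0,1]$ (with its two ends identified if the edge is a loop), points of $G$ are the vertices together with all interior points of edges, and $d_G$ is the shortest-path distance. Hyperbolicity constant: a geodesic triangle $T=\{x_1,x_2,x_3\}$ in a geodesic metric space $X$ is the union of three geodesics $[x_1x_2],[x_2x_3],[x_3x_1]$ (the vertices may be arbitrary points of $X$, possibly coinciding). $T$ is $\delta$-thin if each side is contained in the $\delta$-neighborhood of the union of the other two sides; $\delta(T):=\inf\{\delta\ge 0: T \text{ is } \delta\text{-thin}\}$, and $\delta(X):=\sup\{\delta(T): T \text{ a geodesic triangle in } X\}\in[0,\infty]$. Edge contraction (non-simple graphs): for an edge $e$ with endpoints $A,B$, $G/e$ is obtained by removing $e$ and merging $A$ and $B$ into a single vertex $V_e$, keeping all other edges: if there are $n_1\ge 1$ edges joining $v$ and $A$ and $n_2\ge 1$ edges joining $v$ and $B$, then there are $n_1+n_2$ edges joining $v$ and $V_e$ in $G/e$; each edge $e'\ne e$ joining $A$ and $B$ becomes a loop at $V_e$. *)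

theory Defs
  imports "HOL-Analysis.Analysis" "Graph_Theory.Digraph_Component"
begin

section \<open>Hyperbolicity constant of a geodesic metric space\<close>

text \<open>A metric space is given by its carrier \<open>M\<close> and its distance function \<open>d\<close>.\<close>

definition geodesic_segment ::
    "'p set \<Rightarrow> ('p \<Rightarrow> 'p \<Rightarrow> real) \<Rightarrow> 'p \<Rightarrow> 'p \<Rightarrow> 'p set \<Rightarrow> bool" where
  "geodesic_segment M d x y S \<longleftrightarrow>
     (\<exists>\<gamma> :: real \<Rightarrow> 'p. \<gamma> ` {0..d x y} = S \<and> S \<subseteq> M \<and> \<gamma> 0 = x \<and> \<gamma> (d x y) = y \<and>
        (\<forall>s \<in> {0..d x y}. \<forall>t \<in> {0..d x y}. d (\<gamma> s) (\<gamma> t) = \<bar>s - t\<bar>))"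

text \<open>A triangle is recorded by its three sides; its vertices are arbitrary, possibly equal.\<close>

definition geodesic_triangle ::
    "'p set \<Rightarrow> ('p \<Rightarrow> 'p \<Rightarrow> real) \<Rightarrow> 'p set \<Rightarrow> 'p set \<Rightarrow> 'p set \<Rightarrow> bool" where
  "geodesic_triangle M d A B C \<longleftrightarrow>
     (\<exists>x1 \<in> M. \<exists>x2 \<in> M. \<exists>x3 \<in> M.
        geodesic_segment M d x1 x2 A \<and> geodesic_segment M d x2 x3 B \<and> geodesic_segment M d x3 x1 C)"

definition in_nbhd :: "('p \<Rightarrow> 'p \<Rightarrow> real) \<Rightarrow> real \<Rightarrow> 'p set \<Rightarrow> 'p set \<Rightarrow> bool" where
  "in_nbhd d r A U \<longleftrightarrow> (\<forall>x \<in> A. \<exists>y \<in> U. d x y \<le> r)"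

definition thin_triangle ::
    "('p \<Rightarrow> 'p \<Rightarrow> real) \<Rightarrow> real \<Rightarrow> 'p set \<Rightarrow> 'p set \<Rightarrow> 'p set \<Rightarrow> bool" where
  "thin_triangle d r A B C \<longleftrightarrow>
     in_nbhd d r A (B \<union> C) \<and> in_nbhd d r B (C \<union> A) \<and> in_nbhd d r C (A \<union> B)"

definition triangle_delta ::
    "('p \<Rightarrow> 'p \<Rightarrow> real) \<Rightarrow> 'p set \<Rightarrow> 'p set \<Rightarrow> 'p set \<Rightarrow> ennreal" where
  "triangle_delta d A B C = Inf {ennreal r | r. 0 \<le> r \<and> thin_triangle d r A B C}"

definition hyperbolicity_constant :: "'p set \<Rightarrow> ('p \<Rightarrow> 'p \<Rightarrow> real) \<Rightarrow> ennreal" where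
  "hyperbolicity_constant M d =
     Sup {triangle_delta d A B C | A B C. geodesic_triangle M d A B C}"


section \<open>Non-simple graphs as metric spaces\<close>

text \<open>
  A multigraph with loops is a (possibly infinite) \<open>pre_digraph\<close>: each undirected edge is a
  single arc. The direction of an arc serves only to identify the edge with \<open>[0,1]\<close> (tail at \<open>0\<close>,
  head at \<open>1\<close>); paths may traverse edges both ways, and \<open>connected\<close> is connectedness
  of the underlying undirected graph, including nonemptiness.
\<close>

definition nonsimple_graph :: "('v, 'e) pre_digraph \<Rightarrow> bool" where
  "nonsimple_graph G \<longleftrightarrow> wf_digraph G \<and> Digraph_Component.connected G"

datatype ('v, 'e) gpoint = Vertex 'v | Inner 'e real

definition graph_points :: "('v, 'e) pre_digraph \<Rightarrow> ('v, 'e) gpoint set" where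
  "graph_points G = Vertex ` verts G \<union> {Inner e t | e t. e \<in> arcs G \<and> 0 < t \<and> t < 1}"

text \<open>The point with coordinate \<open>t \<in> [0,1]\<close> on the edge \<open>e\<close>.\<close>

definition edge_point :: "('v, 'e) pre_digraph \<Rightarrow> 'e \<Rightarrow> real \<Rightarrow> ('v, 'e) gpoint" where
  "edge_point G e t =
     (if t = 0 then Vertex (tail G e) else if t = 1 then Vertex (head G e) else Inner e t)"

text \<open>
  \<open>path_of_length G p q L\<close>: some path from \<open>p\<close> to \<open>q\<close>, composed of finitely many
  segments each lying in one closed edge, has length \<open>L\<close>.
\<close>

inductive path_of_length ::
    "('v, 'e) pre_digraph \<Rightarrow> ('v, 'e) gpoint \<Rightarrow> ('v, 'e) gpoint \<Rightarrow> real \<Rightarrow> bool"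
  for G :: "('v, 'e) pre_digraph" where
  trivial: "p \<in> graph_points G \<Longrightarrow> path_of_length G p p 0"
| extend: "\<lbrakk>path_of_length G p (edge_point G e s) L; e \<in> arcs G; s \<in> {0..1}; t \<in> {0..1}\<rbrakk>
    \<Longrightarrow> path_of_length G p (edge_point G e t) (L + \<bar>s - t\<bar>)"

definition graph_dist ::
    "('v, 'e) pre_digraph \<Rightarrow> ('v, 'e) gpoint \<Rightarrow> ('v, 'e) gpoint \<Rightarrow> real" where
  "graph_dist G p q = Inf {L. path_of_length G p q L}"

definition graph_delta :: "('v, 'e) pre_digraph \<Rightarrow> ennreal" where
  "graph_delta G = hyperbolicity_constant (graph_points G) (graph_dist G)"


section \<open>Edge contraction\<close>

text \<open>
  The merged vertex is represented by the tail of \<open>e\<close>. If \<open>e\<close> is a loop, contracting it just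
  removes it.
\<close>

definition merge_ends :: "('v, 'e) pre_digraph \<Rightarrow> 'e \<Rightarrow> 'v \<Rightarrow> 'v" where
  "merge_ends G e v = (if v = head G e then tail G e else v)"

definition contract_edge :: "('v, 'e) pre_digraph \<Rightarrow> 'e \<Rightarrow> ('v, 'e) pre_digraph" where
  "contract_edge G e =
     \<lparr> verts = merge_ends G e ` verts G, arcs = arcs G - {e},
       tail = merge_ends G e \<circ> tail G, head = merge_ends G e \<circ> head G \<rparr>"

end

theory Submission
  imports Defs
begin

text \<open>
  Let \<open>h\<close> be the projection of \<open>G\<close> onto \<open>G' = G/e\<close> and \<open>V\<close> the image of \<open>e\<close>. Then
  \<open>d' (h x) (h y) \<le> d x y \<le> d' (h x) (h y) + 1\<close>, and if the first inequality is strict, then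
  some geodesic from \<open>h x\<close> to \<open>h y\<close> passes through \<open>V\<close>.

  Lower bound: a geodesic of \<open>G'\<close> that avoids \<open>V\<close> lifts to a geodesic of \<open>G\<close>, and one that ends in
  \<open>V\<close> lifts to a geodesic that ends in the midpoint of \<open>e\<close>. The sides of a triangle of \<open>G'\<close>
  thus lift to geodesic polygons of \<open>G\<close>; only when exactly one side meets \<open>V\<close> does comparing the
  broken side with a genuine geodesic of \<open>G\<close> cost the full \<open>3 * \<delta>(G)\<close>.

  Upper bound: a side \<open>S\<close> of a triangle of \<open>G\<close> for which \<open>h ` S\<close> is no geodesic lies, up to
  \<open>2 * \<delta>(G') + 1 / 2\<close>, near the geodesic through \<open>V\<close> with the same ends. This gives
  \<open>\<delta>(G) \<le> 3 * \<delta>(G') + 3 / 2\<close>. If the ends of \<open>e\<close> are distinct and joined by a path avoiding \<open>e\<close>,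
  a shortest such path becomes an isometric cycle of length at least \<open>1\<close>, so that
  \<open>\<delta>(G') \<ge> 1 / 4\<close> and the bound follows. Otherwise \<open>e\<close> is a bridge or a loop, \<open>d\<close> is the sum of
  \<open>d'\<close> and a pseudometric bounded by \<open>1\<close>, every \<open>h ` S\<close> is a geodesic, and
  \<open>\<delta>(G) \<le> \<delta>(G') + 1\<close>.
\<close>

section \<open>Geodesics and thin triangles\<close>

text \<open>The midpoint is chosen because geodesics of \<open>G'\<close> that end in
  \<open>V\<close> may reach \<open>e\<close> at different ends when lifted. All of them extend to
  the midpoint, each by exactly \<open>1 / 2\<close>, so lifts of different sides share a vertex.
  The price is paid by a side with \<open>V\<close> in its interior: its two lifted halves meet in
  the midpoint, but together they may be longer than a geodesic of \<open>G\<close> by up to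
  \<open>1\<close>.

  The \<open>3 / 2\<close> in the general upper estimate is \<open>1 / 2\<close> for the part of a
  shortened side that stays around \<open>V\<close>, plus \<open>1\<close> for passing from
  \<open>d'\<close> back to \<open>d\<close>. It exceeds the allowed additive constant
  \<open>1\<close>, and a multiple of \<open>\<delta>(G')\<close> cannot absorb the rest when
  \<open>\<delta>(G') = 0\<close>. This is why bridges and loops, for which
  \<open>\<delta>(G')\<close> may vanish, are treated apart. In the other case
  \<open>3 * x + 3 / 2 \<le> 16 / 3 * x + 1\<close> holds from \<open>x = 3 / 14\<close> on, and the
  cycle provides \<open>1 / 4\<close>.

  Graph distance is an infimum, and the construction of geodesics depends on its being attained even
  if there are infinitely many edges.\<close>

definition rips_hyperbolic :: "'p set \<Rightarrow> ('p \<Rightarrow> 'p \<Rightarrow> real) \<Rightarrow> real \<Rightarrow> bool" where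
  "rips_hyperbolic M d r \<longleftrightarrow>
     (\<forall>x\<in>M. \<forall>y\<in>M. \<forall>z\<in>M. \<forall>A B C. geodesic_segment M d x y A \<longrightarrow> geodesic_segment M d y z B \<longrightarrow>
        geodesic_segment M d z x C \<longrightarrow> in_nbhd d r A (B \<union> C))"

text \<open>All triangles are quantified over, so rotating the vertices turns the condition on one
  side into thinness of all three.\<close>

lemma hyperbolicity_constant_le:
  assumes "rips_hyperbolic M d r" "0 \<le> r"
  shows "hyperbolicity_constant M d \<le> ennreal r"
  unfolding hyperbolicity_constant_def
proof (rule Sup_least, safe)
  fix A B C assume "geodesic_triangle M d A B C"
  then obtain x y z where xyz: "x \<in> M" "y \<in> M" "z \<in> M" "geodesic_segment M d x y A"
      "geodesic_segment M d y z B" "geodesic_segment M d z x C"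
    unfolding geodesic_triangle_def by blast
  with assms(1) have "thin_triangle d r A B C"
    unfolding rips_hyperbolic_def thin_triangle_def by blast
  then show "triangle_delta d A B C \<le> ennreal r"
    unfolding triangle_delta_def using assms(2) by (intro Inf_lower) blast
qed

text \<open>A radius strictly above an infimum is admissible because thinness is monotone in the
  radius. This is the origin of the slack \<open>\<epsilon>\<close> in the final argument.\<close>

lemma rips_hyperbolicI_hyperbolicity_constant:
  assumes "hyperbolicity_constant M d < ennreal r"
  shows "rips_hyperbolic M d r"
  unfolding rips_hyperbolic_def
proof (intro ballI allI impI)
  fix x y z A B C
  assume xyz: "x \<in> M" "y \<in> M" "z \<in> M" "geodesic_segment M d x y A"
      "geodesic_segment M d y z B" "geodesic_segment M d z x C"
  then have "triangle_delta d A B C \<le> hyperbolicity_constant M d"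
    unfolding hyperbolicity_constant_def geodesic_triangle_def by (intro Sup_upper) blast
  with assms have "triangle_delta d A B C < ennreal r" by simp
  then obtain r' where r': "0 \<le> r'" "thin_triangle d r' A B C" "ennreal r' < ennreal r"
    unfolding triangle_delta_def Inf_less_iff by blast
  then have "r' \<le> r" by (metis ennreal_less_iff less_le)
  with r'(2) show "in_nbhd d r A (B \<union> C)"
    unfolding thin_triangle_def in_nbhd_def by (meson order_trans)
qed

locale metric_on =
  fixes M :: "'p set" and d :: "'p \<Rightarrow> 'p \<Rightarrow> real"
  assumes dist_self: "x \<in> M \<Longrightarrow> d x x = 0"
    and dist_sym: "x \<in> M \<Longrightarrow> y \<in> M \<Longrightarrow> d x y = d y x"
    and dist_triangle: "x \<in> M \<Longrightarrow> y \<in> M \<Longrightarrow> z \<in> M \<Longrightarrow> d x z \<le> d x y + d y z"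
    and dist_eq_0: "x \<in> M \<Longrightarrow> y \<in> M \<Longrightarrow> d x y = 0 \<Longrightarrow> x = y"
begin

abbreviation seg :: "'p \<Rightarrow> 'p \<Rightarrow> 'p set \<Rightarrow> bool" where
  "seg \<equiv> geodesic_segment M d"

lemma dist_nonneg: "x \<in> M \<Longrightarrow> y \<in> M \<Longrightarrow> 0 \<le> d x y"
  using dist_self[of x] dist_sym[of x y] dist_triangle[of x y x] by simp

text \<open>The weaker of the two notions passes to subpaths, reversals, concatenations and images
  under contractions; geodesics are then recognised by their length alone, through
  \<open>lipschitz_path_isometric\<close>.\<close>

definition lipschitz_path :: "(real \<Rightarrow> 'p) \<Rightarrow> real \<Rightarrow> bool" where
  "lipschitz_path \<gamma> L \<longleftrightarrow> 0 \<le> L \<and> (\<forall>s\<in>{0..L}. \<gamma> s \<in> M) \<and>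
     (\<forall>s\<in>{0..L}. \<forall>t\<in>{0..L}. s \<le> t \<longrightarrow> d (\<gamma> s) (\<gamma> t) \<le> t - s)"

definition isometric_path :: "(real \<Rightarrow> 'p) \<Rightarrow> real \<Rightarrow> bool" where
  "isometric_path \<gamma> L \<longleftrightarrow> 0 \<le> L \<and> (\<forall>s\<in>{0..L}. \<gamma> s \<in> M) \<and>
     (\<forall>s\<in>{0..L}. \<forall>t\<in>{0..L}. d (\<gamma> s) (\<gamma> t) = \<bar>s - t\<bar>)"

lemma lipschitz_pathD:
  assumes "lipschitz_path \<gamma> L"
  shows "0 \<le> L" "0 \<le> s \<Longrightarrow> s \<le> L \<Longrightarrow> \<gamma> s \<in> M"
    "0 \<le> s \<Longrightarrow> s \<le> t \<Longrightarrow> t \<le> L \<Longrightarrow> d (\<gamma> s) (\<gamma> t) \<le> t - s"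
  using assms unfolding lipschitz_path_def by auto

lemma lipschitz_pathI:
  "0 \<le> L \<Longrightarrow> (\<And>s. 0 \<le> s \<Longrightarrow> s \<le> L \<Longrightarrow> \<gamma> s \<in> M) \<Longrightarrow>
    (\<And>s t. 0 \<le> s \<Longrightarrow> s \<le> t \<Longrightarrow> t \<le> L \<Longrightarrow> d (\<gamma> s) (\<gamma> t) \<le> t - s) \<Longrightarrow> lipschitz_path \<gamma> L"
  unfolding lipschitz_path_def by simp

lemma isometric_pathD:
  assumes "isometric_path \<gamma> L"
  shows "0 \<le> L" "0 \<le> s \<Longrightarrow> s \<le> L \<Longrightarrow> \<gamma> s \<in> M"
    "0 \<le> s \<Longrightarrow> s \<le> L \<Longrightarrow> 0 \<le> t \<Longrightarrow> t \<le> L \<Longrightarrow> d (\<gamma> s) (\<gamma> t) = \<bar>s - t\<bar>"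
  using assms unfolding isometric_path_def by auto

lemma isometric_path_lipschitz: "isometric_path \<gamma> L \<Longrightarrow> lipschitz_path \<gamma> L"
  unfolding isometric_path_def lipschitz_path_def by auto

lemma lipschitz_path_subpath:
  assumes "lipschitz_path \<gamma> L" "0 \<le> a" "a \<le> b" "b \<le> L"
  shows "lipschitz_path (\<lambda>s. \<gamma> (a + s)) (b - a)"
proof (rule lipschitz_pathI)
  show "d (\<gamma> (a + s)) (\<gamma> (a + t)) \<le> t - s" if "0 \<le> s" "s \<le> t" "t \<le> b - a" for s t
    using lipschitz_pathD(3)[OF assms(1), of "a + s" "a + t"] that assms by simp
qed (use assms lipschitz_pathD(2)[OF assms(1)] in simp_all)

lemma lipschitz_path_rev: "lipschitz_path \<gamma> L \<Longrightarrow> lipschitz_path (\<lambda>s. \<gamma> (L - s)) L"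
  unfolding lipschitz_path_def
proof safe
  fix s t assume l: "\<forall>s\<in>{0..L}. \<gamma> s \<in> M" "\<forall>s\<in>{0..L}. \<forall>t\<in>{0..L}. s \<le> t \<longrightarrow> d (\<gamma> s) (\<gamma> t) \<le> t - s"
    and st: "s \<in> {0..L}" "t \<in> {0..L}" "s \<le> t"
  then have "\<gamma> (L - s) \<in> M" "\<gamma> (L - t) \<in> M" "L - s \<in> {0..L}" "L - t \<in> {0..L}" "L - t \<le> L - s"
    by auto
  then show "d (\<gamma> (L - s)) (\<gamma> (L - t)) \<le> t - s"
    using l(2)[rule_format, of "L - t" "L - s"] dist_sym by simp
qed auto

text \<open>The three pieces cut off by \<open>s\<close> and \<open>t\<close> span distances of at
  most \<open>s\<close>, \<open>t - s\<close> and \<open>L - t\<close>. Their sum has to reach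
  \<open>L\<close>, so none of these bounds is strict.\<close>

lemma lipschitz_path_isometric:
  assumes "lipschitz_path \<gamma> L" "L \<le> d (\<gamma> 0) (\<gamma> L)"
  shows "isometric_path \<gamma> L"
proof -
  note l = lipschitz_pathD[OF assms(1)]
  have *: "d (\<gamma> s) (\<gamma> t) = t - s" if "0 \<le> s" "s \<le> t" "t \<le> L" for s t
  proof -
    have "d (\<gamma> 0) (\<gamma> L) \<le> d (\<gamma> 0) (\<gamma> s) + d (\<gamma> s) (\<gamma> L)"
      "d (\<gamma> s) (\<gamma> L) \<le> d (\<gamma> s) (\<gamma> t) + d (\<gamma> t) (\<gamma> L)"
      using that l(1,2) by (auto intro!: dist_triangle)
    moreover have "d (\<gamma> 0) (\<gamma> s) \<le> s - 0" "d (\<gamma> s) (\<gamma> t) \<le> t - s" "d (\<gamma> t) (\<gamma> L) \<le> L - t"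
      using that l(3)[of 0 s] l(3)[of s t] l(3)[of t L] by auto
    ultimately show ?thesis using assms(2) by linarith
  qed
  have "d (\<gamma> s) (\<gamma> t) = \<bar>s - t\<bar>" if "0 \<le> s" "s \<le> L" "0 \<le> t" "t \<le> L" for s t
    using *[of s t] *[of t s] that dist_sym[OF l(2)[of s] l(2)[of t]] by linarith
  then show ?thesis using l unfolding isometric_path_def by auto
qed

lemma segI:
  assumes "lipschitz_path \<gamma> L" "L \<le> d x y" "\<gamma> 0 = x" "\<gamma> L = y" "S = \<gamma> ` {0..L}"
  shows "seg x y S"
proof -
  have iso: "isometric_path \<gamma> L" using lipschitz_path_isometric assms by auto
  then have "d x y = L" using assms isometric_pathD(1)[OF iso] isometric_pathD(3)[OF iso, of 0 L] by auto
  then show ?thesis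
    using assms iso unfolding geodesic_segment_def isometric_path_def by blast
qed

lemma segE:
  assumes "seg x y S" "x \<in> M" "y \<in> M"
  obtains \<gamma> where "isometric_path \<gamma> (d x y)" "\<gamma> 0 = x" "\<gamma> (d x y) = y" "S = \<gamma> ` {0..d x y}"
proof -
  obtain \<gamma> where g: "\<gamma> ` {0..d x y} = S" "S \<subseteq> M" "\<gamma> 0 = x" "\<gamma> (d x y) = y"
      "\<forall>s \<in> {0..d x y}. \<forall>t \<in> {0..d x y}. d (\<gamma> s) (\<gamma> t) = \<bar>s - t\<bar>"
    using assms(1) unfolding geodesic_segment_def by blast
  then have "isometric_path \<gamma> (d x y)"
    using dist_nonneg[OF assms(2,3)] unfolding isometric_path_def by blast
  with that g show thesis by blast
qed

lemma seg_subpath: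
  assumes "isometric_path \<gamma> L" "0 \<le> a" "a \<le> b" "b \<le> L"
  shows "seg (\<gamma> a) (\<gamma> b) (\<gamma> ` {a..b})"
proof -
  have l: "lipschitz_path (\<lambda>s. \<gamma> (a + s)) (b - a)"
    using lipschitz_path_subpath[OF isometric_path_lipschitz[OF assms(1)]] assms by auto
  have le: "b - a \<le> d (\<gamma> a) (\<gamma> b)"
    using isometric_pathD(3)[OF assms(1), of a b] assms by auto
  have "\<gamma> ` {a..b} = \<gamma> ` (+) a ` {0..b - a}" by simp
  then have im: "\<gamma> ` {a..b} = (\<lambda>s. \<gamma> (a + s)) ` {0..b - a}" by (simp only: image_image)
  show ?thesis by (rule segI[OF l le _ _ im]) simp_all
qed

lemma seg_subset: "seg x y S \<Longrightarrow> p \<in> S \<Longrightarrow> p \<in> M"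
  unfolding geodesic_segment_def by (elim exE conjE, erule subsetD, assumption)

lemma seg_ends: "seg x y S \<Longrightarrow> x \<in> M \<Longrightarrow> y \<in> M \<Longrightarrow> x \<in> S \<and> y \<in> S"
  by (elim segE) (auto simp: image_iff intro: bexI[of _ 0] bexI[of _ "d x y"] dest!: isometric_pathD(1))

lemma seg_trivial: "x \<in> M \<Longrightarrow> seg x x {x}"
  by (rule segI[of "\<lambda>_. x" 0]) (auto simp: lipschitz_path_def dist_self)

lemma seg_sym:
  assumes "seg x y S" "x \<in> M" "y \<in> M"
  shows "seg y x S"
proof -
  obtain \<gamma> where g: "isometric_path \<gamma> (d x y)" "\<gamma> 0 = x" "\<gamma> (d x y) = y" "S = \<gamma> ` {0..d x y}"
    using segE[OF assms] .
  show ?thesis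
  proof (rule segI[where \<gamma> = "\<lambda>s. \<gamma> (d x y - s)" and L = "d x y"])
    show "lipschitz_path (\<lambda>s. \<gamma> (d x y - s)) (d x y)"
      using lipschitz_path_rev isometric_path_lipschitz g(1) by auto
    have "S = \<gamma> ` (-) (d x y) ` {0..d x y}" using g(4) by simp
    then show "S = (\<lambda>s. \<gamma> (d x y - s)) ` {0..d x y}" by (simp only: image_image)
  qed (use g dist_sym assms in auto)
qed

lemma lipschitz_path_join:
  assumes "lipschitz_path \<gamma> a" "lipschitz_path \<eta> b" "\<gamma> a = \<eta> 0"
  defines "\<phi> \<equiv> \<lambda>s. if s \<le> a then \<gamma> s else \<eta> (s - a)"
  shows "lipschitz_path \<phi> (a + b)" "\<phi> 0 = \<gamma> 0" "\<phi> (a + b) = \<eta> b"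
    "\<phi> ` {0..a + b} = \<gamma> ` {0..a} \<union> \<eta> ` {0..b}"
proof -
  note g = lipschitz_pathD[OF assms(1)] and h = lipschitz_pathD[OF assms(2)]
  have "d (\<phi> s) (\<phi> t) \<le> t - s" if "0 \<le> s" "s \<le> t" "t \<le> a + b" for s t
  proof (cases "t \<le> a \<or> a < s")
    case True then show ?thesis
      using that g(3)[of s t] h(3)[of "s - a" "t - a"] by (auto simp: \<phi>_def)
  next
    case False
    then have "d (\<gamma> s) (\<eta> (t - a)) \<le> d (\<gamma> s) (\<gamma> a) + d (\<eta> 0) (\<eta> (t - a))"
      using that assms(3) g(1,2) h(1,2) by (metis add.commute diff_ge_0_iff_ge diff_le_eq
          dist_triangle dual_order.order_iff_strict linorder_not_less)
    also have "\<dots> \<le> t - s" using False that g(3)[of s a] h(3)[of 0 "t - a"] by auto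
    finally show ?thesis using False by (simp add: \<phi>_def)
  qed
  moreover have "\<phi> s \<in> M" if "0 \<le> s" "s \<le> a + b" for s
    using that g(2)[of s] h(2)[of "s - a"] by (auto simp: \<phi>_def)
  ultimately show "lipschitz_path \<phi> (a + b)" using g(1) h(1) by (auto simp: lipschitz_path_def)
  show "\<phi> 0 = \<gamma> 0" "\<phi> (a + b) = \<eta> b" using g(1) h(1) assms(3) by (auto simp: \<phi>_def)
  show "\<phi> ` {0..a + b} = \<gamma> ` {0..a} \<union> \<eta> ` {0..b}"
  proof safe
    fix s assume "s \<in> {0..a + b}" "\<phi> s \<notin> \<eta> ` {0..b}"
    then show "\<phi> s \<in> \<gamma> ` {0..a}" by (auto simp: \<phi>_def split: if_splits)
  next
    fix s assume "s \<in> {0..a}" then show "\<gamma> s \<in> \<phi> ` {0..a + b}"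
      using h(1) by (intro image_eqI[of _ _ s]) (auto simp: \<phi>_def)
  next
    fix s assume "s \<in> {0..b}" then show "\<eta> s \<in> \<phi> ` {0..a + b}"
      using g(1) assms(3) by (intro image_eqI[of _ _ "s + a"]) (auto simp: \<phi>_def)
  qed
qed

lemma seg_join:
  assumes "seg x y P" "seg y z Q" "x \<in> M" "y \<in> M" "z \<in> M" "d x y + d y z \<le> d x z"
  shows "seg x z (P \<union> Q)"
proof -
  obtain \<gamma> where g: "isometric_path \<gamma> (d x y)" "\<gamma> 0 = x" "\<gamma> (d x y) = y" "P = \<gamma> ` {0..d x y}"
    using segE assms by metis
  obtain \<eta> where h: "isometric_path \<eta> (d y z)" "\<eta> 0 = y" "\<eta> (d y z) = z" "Q = \<eta> ` {0..d y z}"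
    using segE assms by metis
  have "\<gamma> (d x y) = \<eta> 0" using g h by simp
  note J = lipschitz_path_join[OF isometric_path_lipschitz[OF g(1)] isometric_path_lipschitz[OF h(1)] this]
  show ?thesis
    by (rule segI[OF J(1) assms(6)], rule trans[OF J(2) g(2)], rule trans[OF J(3) h(3)],
        simp only: J(4) g(4) h(4))
qed

lemma seg_split:
  assumes "seg x y S" "x \<in> M" "y \<in> M" "v \<in> S"
  obtains P Q where "seg x v P" "seg v y Q" "S = P \<union> Q"
proof -
  obtain \<gamma> where g: "isometric_path \<gamma> (d x y)" "\<gamma> 0 = x" "\<gamma> (d x y) = y" "S = \<gamma> ` {0..d x y}"
    using segE[OF assms(1-3)] .
  obtain s where s: "0 \<le> s" "s \<le> d x y" "v = \<gamma> s" using assms(4) g(4) by auto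
  have eq: "{0..d x y} = {0..s} \<union> {s..d x y}" using s by auto
  have S: "S = \<gamma> ` {0..s} \<union> \<gamma> ` {s..d x y}" by (subst g(4), subst eq, rule image_Un)
  have "seg x v (\<gamma> ` {0..s})" "seg v y (\<gamma> ` {s..d x y})"
    using seg_subpath[OF g(1), of 0 s] seg_subpath[OF g(1), of s "d x y"] g(2,3) s by simp_all
  from this S show ?thesis by (rule that)
qed

lemma rips_thin:
  assumes "rips_hyperbolic M d r" "seg x y A" "seg y z B" "seg x z C"
    "x \<in> M" "y \<in> M" "z \<in> M" "p \<in> A"
  obtains q where "q \<in> B \<union> C" "d p q \<le> r"
proof -
  have "seg z x C" by (rule seg_sym[OF assms(4,5,7)])
  then have "in_nbhd d r A (B \<union> C)"
    using assms(1)[unfolded rips_hyperbolic_def, rule_format, OF assms(5-7) assms(2,3)] by simp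
  then obtain q where "q \<in> B \<union> C" "d p q \<le> r" using assms(8) unfolding in_nbhd_def by meson
  then show thesis by (rule that)
qed

text \<open>A bigon is the triangle with \<open>z = y\<close> and the side \<open>{y}\<close>, which
  is contained in \<open>B\<close>.\<close>

lemma rips_bigon:
  assumes "rips_hyperbolic M d r" "seg x y A" "seg x y B" "x \<in> M" "y \<in> M" "p \<in> A"
  obtains q where "q \<in> B" "d p q \<le> r"
proof -
  obtain q where "q \<in> {y} \<union> B" "d p q \<le> r"
    using rips_thin[OF assms(1,2) seg_trivial[OF assms(5)] assms(3-5) assms(5,6)] .
  then show thesis using that seg_ends[OF assms(3-5)] by auto
qed

lemma rips_nonneg:
  assumes "rips_hyperbolic M d r" "x \<in> M" shows "0 \<le> r"
proof -
  obtain q where "q \<in> {x}" "d x q \<le> r"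
    using rips_bigon[OF assms(1) seg_trivial seg_trivial] assms by blast
  then show ?thesis using dist_self assms by auto
qed

end

locale geodesic_metric = metric_on +
  assumes geodesic_exists: "x \<in> M \<Longrightarrow> y \<in> M \<Longrightarrow> \<exists>S. geodesic_segment M d x y S"

section \<open>Contractions of geodesic spaces\<close>

text \<open>The two sets need not be closed, so a common point need not exist. A point of
  \<open>P\<close> less than \<open>\<theta> / 2\<close> below the supremum and a point of
  \<open>R\<close> at most \<open>\<theta> / 2\<close> beyond the supremum serve instead.\<close>

lemma real_interval_cover_switch:
  fixes L \<theta> :: real
  assumes "0 \<le> L" "0 < \<theta>" "P 0" "R L" "\<And>s. 0 \<le> s \<Longrightarrow> s \<le> L \<Longrightarrow> P s \<or> R s"
  obtains s t where "0 \<le> s" "s \<le> L" "0 \<le> t" "t \<le> L" "P s" "R t" "\<bar>s - t\<bar> \<le> \<theta>"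
proof -
  define U where "U = {s. 0 \<le> s \<and> s \<le> L \<and> P s}"
  have U: "U \<noteq> {}" "bdd_above U" using assms(1,3) by (auto simp: U_def bdd_above_def)
  then obtain s where s: "s \<in> U" "Sup U - \<theta> / 2 < s"
    using less_cSup_iff[OF U, of "Sup U - \<theta> / 2"] assms(2) by auto
  have le: "s \<le> Sup U" by (rule cSup_upper[OF s(1) U(2)])
  show thesis
  proof (cases "Sup U + \<theta> / 2 \<le> L")
    case True
    have "Sup U + \<theta> / 2 \<notin> U" using cSup_upper[OF _ U(2)] assms(2) by fastforce
    moreover have "0 \<le> Sup U + \<theta> / 2" using s le assms(2) by (auto simp: U_def)
    ultimately have "R (Sup U + \<theta> / 2)" using True assms(5) unfolding U_def by blast
    then show thesis using that[of s "Sup U + \<theta> / 2"] s le True assms(2) by (auto simp: U_def)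
  next
    case False
    then show thesis using that[of s L] s le assms(1,2,4) by (auto simp: U_def)
  qed
qed

locale contraction = G: geodesic_metric M d + Q: geodesic_metric M' d'
  for M :: "'p set" and d and M' :: "'q set" and d' +
  fixes h :: "'p \<Rightarrow> 'q" and V :: 'q
  assumes h_in: "x \<in> M \<Longrightarrow> h x \<in> M'"
    and V_in: "V \<in> M'"
    and contr_le: "x \<in> M \<Longrightarrow> y \<in> M \<Longrightarrow> d' (h x) (h y) \<le> d x y"
    and contr_ge: "x \<in> M \<Longrightarrow> y \<in> M \<Longrightarrow> d x y \<le> d' (h x) (h y) + 1"
    and contr_through: "x \<in> M \<Longrightarrow> y \<in> M \<Longrightarrow> d' (h x) (h y) < d x y \<Longrightarrow>
      d' (h x) (h y) = d' (h x) V + d' V (h y)"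
begin

section \<open>Geodesics shortened by the contraction, and the general upper bound\<close>

lemma lipschitz_path_image:
  assumes "G.lipschitz_path \<gamma> L"
  shows "Q.lipschitz_path (\<lambda>s. h (\<gamma> s)) L"
proof (rule Q.lipschitz_pathI)
  note l = G.lipschitz_pathD[OF assms]
  fix s t assume "0 \<le> s" "s \<le> t" "t \<le> L"
  then show "d' (h (\<gamma> s)) (h (\<gamma> t)) \<le> t - s"
    using contr_le[OF l(2) l(2), of s t] l(3)[of s t] by simp
qed (use G.lipschitz_pathD[OF assms] h_in in simp_all)

lemma seg_image:
  assumes "G.seg x y S" "x \<in> M" "y \<in> M" "d x y \<le> d' (h x) (h y)"
  shows "Q.seg (h x) (h y) (h ` S)"
proof -
  obtain \<gamma> where g: "G.isometric_path \<gamma> (d x y)" "\<gamma> 0 = x" "\<gamma> (d x y) = y" "S = \<gamma> ` {0..d x y}"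
    using G.segE[OF assms(1-3)] .
  have "h ` S = (\<lambda>s. h (\<gamma> s)) ` {0..d x y}" by (simp only: g(4) image_image)
  then show ?thesis
    using Q.segI[OF lipschitz_path_image[OF G.isometric_path_lipschitz[OF g(1)]] assms(4)] g(2,3)
    by simp
qed

text \<open>The curve \<open>h \<circ> \<gamma>\<close> stays geodesic up to the first parameter \<open>a\<close> at which a detour
  through \<open>V\<close> is equally long; up to there it forms a bigon with that detour.\<close>

lemma shortened_side_initial_part:
  assumes rips: "rips_hyperbolic M' d' r" and g: "G.isometric_path \<gamma> L"
    and short: "d' (h (\<gamma> 0)) (h (\<gamma> L)) < L" and P: "Q.seg (h (\<gamma> 0)) V P"
  obtains a where "0 \<le> a" "a \<le> L" "Q.isometric_path (\<lambda>s. h (\<gamma> s)) a"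
    "\<And>w. w \<in> P \<Longrightarrow> \<exists>s\<in>{0..a}. d' w (h (\<gamma> s)) \<le> r"
proof -
  note gD = G.isometric_pathD[OF g]
  have L: "0 \<le> L" by (rule gD(1))
  have hM: "h (\<gamma> s) \<in> M'" if "0 \<le> s" "s \<le> L" for s using h_in gD(2) that by blast
  define f where "f = (\<lambda>s. d' (h (\<gamma> s)) V)"
  have lip: "Q.lipschitz_path (\<lambda>s. h (\<gamma> s)) L"
    by (rule lipschitz_path_image[OF G.isometric_path_lipschitz[OF g]])
  have f_lip: "f s \<le> f t + \<bar>s - t\<bar>" if "0 \<le> s" "s \<le> L" "0 \<le> t" "t \<le> L" for s t
  proof -
    have "f s \<le> d' (h (\<gamma> s)) (h (\<gamma> t)) + f t"
      unfolding f_def by (intro Q.dist_triangle hM V_in that)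
    moreover have "d' (h (\<gamma> s)) (h (\<gamma> t)) \<le> \<bar>s - t\<bar>"
      using contr_le[of "\<gamma> s" "\<gamma> t"] gD(2,3) that by simp
    ultimately show ?thesis by simp
  qed
  have "1-lipschitz_on {0..L} f"
  proof (rule lipschitz_onI)
    fix s t assume "s \<in> {0..L}" "t \<in> {0..L}"
    then show "dist (f s) (f t) \<le> 1 * dist s t"
      using f_lip[of s t] f_lip[of t s] by (auto simp: dist_real_def)
  qed simp
  then have cont: "continuous_on {0..L} (\<lambda>s. s - f s)"
    by (intro continuous_intros lipschitz_on_continuous_on)
  have D0: "0 \<le> f 0" unfolding f_def using Q.dist_nonneg hM[of 0] L V_in by simp
  have thr: "d' (h (\<gamma> 0)) (h (\<gamma> L)) = f 0 + f L"
    using contr_through[of "\<gamma> 0" "\<gamma> L"] short gD(2)[of 0] gD(2)[of L] gD(3)[of 0 L] L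
      Q.dist_sym[OF V_in hM[of L]] unfolding f_def by simp
  \<comment> \<open>The detour from \<open>h (\<gamma> 0)\<close> to \<open>h (\<gamma> s)\<close>
    through \<open>V\<close> has length \<open>f 0 + f s\<close>. This is at least \<open>s\<close>
    for \<open>s = 0\<close> and, by \<open>thr\<close> and \<open>short\<close>, less than
    \<open>s\<close> for \<open>s = L\<close>.\<close>
  have "\<exists>a\<ge>0. a \<le> L \<and> a - f a = f 0"
    using IVT'[of "\<lambda>s. s - f s" 0 "f 0" L] D0 thr short L cont by auto
  then obtain a where a: "0 \<le> a" "a \<le> L" "a = f 0 + f a" by force
  \<comment> \<open>If \<open>h\<close> shortened this piece, \<open>contr_through\<close> would
    make the distance equal to the length \<open>f 0 + f a\<close> of the detour, which is
    \<open>a\<close> by the choice of \<open>a\<close>.\<close>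
  have da: "a \<le> d' (h (\<gamma> 0)) (h (\<gamma> a))"
  proof (rule ccontr)
    assume *: "\<not> ?thesis"
    then have "d' (h (\<gamma> 0)) (h (\<gamma> a)) < d (\<gamma> 0) (\<gamma> a)"
      using gD(3)[of 0 a] a by simp
    from contr_through[OF _ _ this] have "d' (h (\<gamma> 0)) (h (\<gamma> a)) = f 0 + f a"
      using gD(2)[of 0] gD(2)[of a] a L Q.dist_sym[OF V_in hM[of a]] unfolding f_def by simp
    with * a show False by simp
  qed
  have lipa: "Q.lipschitz_path (\<lambda>s. h (\<gamma> s)) a"
    using Q.lipschitz_path_subpath[OF lip, of 0 a] a by simp
  have iso: "Q.isometric_path (\<lambda>s. h (\<gamma> s)) a"
    by (rule Q.lipschitz_path_isometric[OF lipa da])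
  have dist_a: "d' (h (\<gamma> 0)) (h (\<gamma> a)) = a"
    using Q.isometric_pathD(3)[OF iso, of 0 a] a by simp
  obtain E where E: "Q.seg V (h (\<gamma> a)) E" using Q.geodesic_exists V_in hM a by blast
  have "Q.seg (h (\<gamma> 0)) (h (\<gamma> a)) (P \<union> E)"
  proof (rule Q.seg_join[OF P E])
    show "d' (h (\<gamma> 0)) V + d' V (h (\<gamma> a)) \<le> d' (h (\<gamma> 0)) (h (\<gamma> a))"
      using a dist_a Q.dist_sym[OF V_in hM[of a]] unfolding f_def by simp
  qed (use hM V_in a L in simp_all)
  note detour = this
  have initial: "Q.seg (h (\<gamma> 0)) (h (\<gamma> a)) ((\<lambda>s. h (\<gamma> s)) ` {0..a})"
    using Q.seg_subpath[OF iso, of 0 a] a by simp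
  have near: "\<exists>s\<in>{0..a}. d' w (h (\<gamma> s)) \<le> r" if w: "w \<in> P" for w
  proof -
    obtain q where "q \<in> (\<lambda>s. h (\<gamma> s)) ` {0..a}" "d' w q \<le> r"
      using Q.rips_bigon[OF rips detour initial hM[OF order_refl L] hM[OF a(1,2)] UnI1[OF w]] .
    then show ?thesis by (elim imageE) (simp only: bexI)
  qed
  show thesis by (rule that[OF a(1,2) iso near])
qed

text \<open>In the triangle \<open>\<eta> 0\<close>, \<open>\<eta> p\<close>, \<open>V\<close> the
  side \<open>E\<close> has length at most \<open>r\<close>, so a point that is near
  \<open>E\<close> and not near \<open>P\<close> is within \<open>r + r\<close> of
  \<open>V\<close>.\<close>

lemma initial_part_close:
  assumes rips: "rips_hyperbolic M' d' r" and g: "Q.isometric_path \<eta> a"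
    and P: "Q.seg (\<eta> 0) V P" and p: "0 \<le> p" "p \<le> a" "d' V (\<eta> p) \<le> r" and s: "0 \<le> s" "s \<le> p"
  shows "(\<exists>w\<in>P. d' (\<eta> s) w \<le> r) \<or> d' (\<eta> s) V \<le> 2 * r"
proof -
  note gD = Q.isometric_pathD[OF g]
  have M: "\<eta> 0 \<in> M'" "\<eta> p \<in> M'" "\<eta> s \<in> M'" using gD(2) p s by simp_all
  obtain E where E: "Q.seg (\<eta> p) V E" using Q.geodesic_exists V_in M by blast
  have "Q.seg (\<eta> 0) (\<eta> p) (\<eta> ` {0..p})" using Q.seg_subpath[OF g, of 0 p] p by simp
  then obtain q where q: "q \<in> E \<union> P" "d' (\<eta> s) q \<le> r"
    using Q.rips_thin[OF rips _ E P M(1,2) V_in, of "\<eta> ` {0..p}" "\<eta> s"] s by auto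
  show ?thesis
  proof (cases "q \<in> P")
    case False
    then have qE: "q \<in> E" using q by simp
    obtain \<zeta> where z: "Q.isometric_path \<zeta> (d' (\<eta> p) V)" "\<zeta> 0 = \<eta> p" "\<zeta> (d' (\<eta> p) V) = V"
        "E = \<zeta> ` {0..d' (\<eta> p) V}"
      using Q.segE[OF E M(2) V_in] .
    then obtain t where t: "0 \<le> t" "t \<le> d' (\<eta> p) V" "q = \<zeta> t" using qE by auto
    then have "d' q V \<le> d' (\<eta> p) V"
      using Q.isometric_pathD(3)[OF z(1), of t "d' (\<eta> p) V"] z(3) by simp
    moreover have "q \<in> M'" by (rule Q.seg_subset[OF E qE])
    then have "d' (\<eta> s) V \<le> d' (\<eta> s) q + d' q V" by (intro Q.dist_triangle M V_in)
    ultimately show ?thesis using q(2) p(3) Q.dist_sym[OF V_in M(2)] by simp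
  qed (use q in blast)
qed

lemma seg_to_V_join:
  assumes "Q.seg x V P" "Q.seg y V P'" "x \<in> M'" "y \<in> M'" "d' x y = d' x V + d' V y"
  shows "Q.seg x y (P \<union> P')"
  by (rule Q.seg_join[OF assms(1) Q.seg_sym[OF assms(2)]]) (use assms V_in in simp_all)

text \<open>\<open>P \<union> P'\<close> is the geodesic through \<open>V\<close> that replaces the
  shortened side. Applying \<open>shortened_side_initial_part\<close> from both ends of
  \<open>S\<close> gives two bigons. They control all of \<open>P \<union> P'\<close> but only two
  end stretches of \<open>S\<close>; the stretch in between is controlled because it is
  short.\<close>

lemma shortened_side_near:
  assumes rips: "rips_hyperbolic M' d' r" and S: "G.seg x y S" "x \<in> M" "y \<in> M"
    and short: "d' (h x) (h y) < d x y" and P: "Q.seg (h x) V P" "Q.seg (h y) V P'"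
  shows "w \<in> P \<union> P' \<Longrightarrow> \<exists>q\<in>S. d' w (h q) \<le> r"
    and "p \<in> S \<Longrightarrow> (\<exists>w\<in>P \<union> P'. d' (h p) w \<le> r) \<or> d' (h p) V \<le> 2 * r + 1 / 2"
proof -
  define L where "L = d x y"
  obtain \<gamma> where g: "G.isometric_path \<gamma> L" "\<gamma> 0 = x" "\<gamma> L = y" "S = \<gamma> ` {0..L}"
    using G.segE[OF S] unfolding L_def .
  define \<eta> where "\<eta> = (\<lambda>s. \<gamma> (L - s))"
  note gD = G.isometric_pathD[OF g(1)]
  have L: "0 \<le> L" by (rule gD(1))
  have hM: "h (\<gamma> s) \<in> M'" if "0 \<le> s" "s \<le> L" for s using h_in gD(2) that by blast
  have e: "G.isometric_path \<eta> L" "\<eta> 0 = y" "\<eta> L = x"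
    using G.lipschitz_path_isometric[OF G.lipschitz_path_rev[OF G.isometric_path_lipschitz[OF g(1)]]]
      g(2,3) gD(3)[of L 0] L by (simp_all add: \<eta>_def)
  have short': "d' (h (\<gamma> 0)) (h (\<gamma> L)) < L" "d' (h (\<eta> 0)) (h (\<eta> L)) < L"
    using short g e L_def Q.dist_sym h_in S by simp_all
  obtain a where a: "0 \<le> a" "a \<le> L" "Q.isometric_path (\<lambda>s. h (\<gamma> s)) a"
      "\<And>w. w \<in> P \<Longrightarrow> \<exists>s\<in>{0..a}. d' w (h (\<gamma> s)) \<le> r"
    using shortened_side_initial_part[OF rips g(1) short'(1)] P(1) g(2) by metis
  obtain b where b: "0 \<le> b" "b \<le> L" "Q.isometric_path (\<lambda>s. h (\<eta> s)) b"
      "\<And>w. w \<in> P' \<Longrightarrow> \<exists>s\<in>{0..b}. d' w (h (\<eta> s)) \<le> r"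
    using shortened_side_initial_part[OF rips e(1) short'(2)] P(2) e(2) by metis
  show "\<exists>q\<in>S. d' w (h q) \<le> r" if w: "w \<in> P \<union> P'"
  proof (cases "w \<in> P")
    case True
    then obtain s where "s \<in> {0..a}" "d' w (h (\<gamma> s)) \<le> r" using a(4) by blast
    then show ?thesis using a(2) unfolding g(4) by (intro bexI[of _ "\<gamma> s"]) auto
  next
    case False
    then obtain s where "s \<in> {0..b}" "d' w (h (\<eta> s)) \<le> r" using b(4) w by blast
    then show ?thesis using b(2) unfolding g(4) \<eta>_def by (intro bexI[of _ "\<gamma> (L - s)"]) auto
  qed
  have VP: "V \<in> P" "V \<in> P'" using Q.seg_ends P h_in S V_in by blast+
  \<comment> \<open>Since \<open>V\<close> lies on \<open>P\<close> and on \<open>P'\<close>, each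
    bigon supplies a parameter at which the image of \<open>S\<close> is within \<open>r\<close> of
    \<open>V\<close>. These two parameters cut \<open>S\<close> into the stretches distinguished
    below.\<close>
  obtain p1 where p1: "0 \<le> p1" "p1 \<le> a" "d' V (h (\<gamma> p1)) \<le> r" using a(4)[OF VP(1)] by auto
  obtain p2 where p2: "0 \<le> p2" "p2 \<le> b" "d' V (h (\<eta> p2)) \<le> r" using b(4)[OF VP(2)] by auto
  show "(\<exists>w\<in>P \<union> P'. d' (h p) w \<le> r) \<or> d' (h p) V \<le> 2 * r + 1 / 2" if pS: "p \<in> S"
  proof -
    obtain s where s: "0 \<le> s" "s \<le> L" "p = \<gamma> s" using pS g(4) by auto
    have r0: "0 \<le> r" by (rule Q.rips_nonneg[OF rips V_in])
    consider "s \<le> p1" | "L - s \<le> p2" | "p1 < s" "s < L - p2" by linarith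
    then show ?thesis
    proof cases
      case 1
      have "(\<exists>w\<in>P. d' (h (\<gamma> s)) w \<le> r) \<or> d' (h (\<gamma> s)) V \<le> 2 * r"
        using initial_part_close[OF rips a(3), of P p1 s] P(1) g(2) p1 s(1) 1 by simp
      then show ?thesis using s(3) by auto
    next
      case 2
      have "(\<exists>w\<in>P'. d' (h (\<eta> (L - s))) w \<le> r) \<or> d' (h (\<eta> (L - s))) V \<le> 2 * r"
        using initial_part_close[OF rips b(3), of P' p2 "L - s"] P(2) e(2) p2 s(2) 2 by simp
      then show ?thesis using s(3) by (auto simp: \<eta>_def)
    next
      case 3
      define u where "u = L - p2"
      have u: "0 \<le> u" "u \<le> L" "p1 \<le> L" "s < u" "d' V (h (\<gamma> u)) \<le> r"
        using p1 p2 a b 3 s unfolding u_def \<eta>_def by auto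
      \<comment> \<open>Both ends of the middle stretch map to within \<open>r\<close> of
        \<open>V\<close>, so its length is at most \<open>2 * r + 1\<close>. The closer end is at
        most \<open>r + 1 / 2\<close> away along the stretch, and \<open>r\<close> more leads to
        \<open>V\<close>.\<close>
      have "u - p1 = d (\<gamma> p1) (\<gamma> u)" using gD(3)[of p1 u] u p1 3 by simp
      also have "\<dots> \<le> d' (h (\<gamma> p1)) (h (\<gamma> u)) + 1" using contr_ge gD(2) u p1 by simp
      also have "d' (h (\<gamma> p1)) (h (\<gamma> u)) \<le> d' (h (\<gamma> p1)) V + d' V (h (\<gamma> u))"
        using Q.dist_triangle hM V_in u p1 by simp
      also have "\<dots> \<le> 2 * r" using p1(3) u(5) Q.dist_sym[OF V_in hM[of p1]] u(3) p1(1) by simp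
      finally have "u - p1 \<le> 2 * r + 1" by simp
      moreover have "d' (h (\<gamma> s)) V \<le> (s - p1) + r"
      proof -
        have "d' (h (\<gamma> s)) V \<le> d' (h (\<gamma> s)) (h (\<gamma> p1)) + d' (h (\<gamma> p1)) V"
          using Q.dist_triangle hM V_in u p1 s by simp
        moreover have "d' (h (\<gamma> s)) (h (\<gamma> p1)) \<le> d (\<gamma> s) (\<gamma> p1)"
          using contr_le gD(2) u p1 s by simp
        ultimately show ?thesis
          using gD(3)[of s p1] u p1 s 3 Q.dist_sym[OF V_in hM[of p1]] by simp
      qed
      moreover have "d' (h (\<gamma> s)) V \<le> (u - s) + r"
      proof -
        have "d' (h (\<gamma> s)) V \<le> d' (h (\<gamma> s)) (h (\<gamma> u)) + d' (h (\<gamma> u)) V"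
          using Q.dist_triangle hM V_in u s by simp
        moreover have "d' (h (\<gamma> s)) (h (\<gamma> u)) \<le> d (\<gamma> s) (\<gamma> u)"
          using contr_le gD(2) u s by simp
        ultimately show ?thesis
          using gD(3)[of s u] u s 3 Q.dist_sym[OF V_in hM[of u]] by simp
      qed
      ultimately have "d' (h (\<gamma> s)) V \<le> 2 * r + 1 / 2" by linarith
      then show ?thesis using s(3) by blast
    qed
  qed
qed

lemma dist_triangle_le:
  assumes "d' x y \<le> a" "d' y z \<le> b" "x \<in> M'" "y \<in> M'" "z \<in> M'" "a + b \<le> c"
  shows "d' x z \<le> c"
  using Q.dist_triangle[OF assms(3-5)] assms(1,2,6) by linarith

lemma dist_triangle_ex:
  assumes "d' x y \<le> a" "\<exists>q\<in>S. d' y (h q) \<le> b" "x \<in> M'" "y \<in> M'" "S \<subseteq> M" "a + b \<le> c"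
  shows "\<exists>q\<in>S. d' x (h q) \<le> c"
proof -
  obtain q where q: "q \<in> S" "d' y (h q) \<le> b" using assms(2) by blast
  then have "d' x (h q) \<le> c" using dist_triangle_le[OF assms(1) q(2)] assms h_in by blast
  with q show ?thesis by blast
qed

text \<open>If neither \<open>S\<close> nor \<open>T\<close> is shortened, their images and
  \<open>X \<union> Y\<close> form a triangle; if one is, its detour contains \<open>V\<close>. So
  \<open>V\<close> costs only \<open>r\<close>. A second \<open>r\<close> is due when
  \<open>w\<close> lies on the half of \<open>X \<union> Y\<close> that the detour of the only
  shortened side among \<open>S\<close>, \<open>T\<close> does not contain.\<close>

lemma shortened_triangle_near:
  assumes rips: "rips_hyperbolic M' d' r" and xyz: "x \<in> M" "y \<in> M" "z \<in> M"
    and S: "G.seg x z S" "G.seg y z T" and short: "d' (h x) (h y) < d x y"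
    and P: "Q.seg (h x) V X" "Q.seg (h y) V Y" "Q.seg (h z) V Z"
  shows "\<exists>q\<in>S \<union> T. d' V (h q) \<le> r"
    and "w \<in> X \<union> Y \<Longrightarrow> \<exists>q\<in>S \<union> T. d' w (h q) \<le> 2 * r"
proof -
  have r0: "0 \<le> r" by (rule Q.rips_nonneg[OF rips V_in])
  have M': "h x \<in> M'" "h y \<in> M'" "h z \<in> M'" using xyz h_in by blast+
  have V: "V \<in> X" "V \<in> Y" "V \<in> Z" using Q.seg_ends P M' V_in by blast+
  have ST: "S \<subseteq> M" "T \<subseteq> M" "S \<union> T \<subseteq> M" using G.seg_subset S by blast+
  have XYM: "X \<subseteq> M'" "Y \<subseteq> M'" "Z \<subseteq> M'" using Q.seg_subset P by blast+
  have XY: "Q.seg (h x) (h y) (X \<union> Y)"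
    using seg_to_V_join[OF P(1,2) M'(1,2)] contr_through[OF xyz(1,2) short] by blast
  have good: "\<exists>q\<in>S \<union> T. d' w (h q) \<le> r"
    if le: "d x z \<le> d' (h x) (h z)" "d y z \<le> d' (h y) (h z)" and w: "w \<in> X \<union> Y" for w
  proof -
    have "Q.seg (h x) (h z) (h ` S)" "Q.seg (h y) (h z) (h ` T)"
      using seg_image S xyz le by blast+
    then obtain q where "q \<in> h ` T \<union> h ` S" "d' w q \<le> r"
      using Q.rips_thin[OF rips XY _ _ M' w] by blast
    then show ?thesis by blast
  qed
  have S_short: "\<exists>q\<in>S \<union> T. d' w (h q) \<le> r" if "d' (h x) (h z) < d x z" "w \<in> X \<union> Z" for w
    using shortened_side_near(1)[OF rips S(1) xyz(1,3) that(1) P(1,3) that(2)] by blast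
  have T_short: "\<exists>q\<in>S \<union> T. d' w (h q) \<le> r" if "d' (h y) (h z) < d y z" "w \<in> Y \<union> Z" for w
    using shortened_side_near(1)[OF rips S(2) xyz(2,3) that(1) P(2,3) that(2)] by blast
  show "\<exists>q\<in>S \<union> T. d' V (h q) \<le> r"
    using good S_short T_short V by (meson UnI1 not_less)
  assume w: "w \<in> X \<union> Y"
  then have wM: "w \<in> M'" using XYM by blast
  have double: "\<exists>q\<in>S \<union> T. d' w (h q) \<le> 2 * r" if near: "\<exists>q\<in>S \<union> T. d' w (h q) \<le> r"
  proof -
    obtain q where q: "q \<in> S \<union> T" "d' w (h q) \<le> r" using near by blast
    then have "d' w (h q) \<le> 2 * r" using r0 by linarith
    with q(1) show ?thesis by blast
  qed
  \<comment> \<open>The triangle \<open>h x\<close>, \<open>V\<close>, \<open>h z\<close> with sides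
    \<open>X\<close>, \<open>Z\<close>, \<open>h\<close>
    S\<open>leads from\<close>w\<open>either to\<close>h \<open>S\<close> or to \<open>Z\<close>,
    and \<open>Z\<close> belongs to the detour that replaces \<open>T\<close>.\<close>
  have "\<exists>q\<in>S \<union> T. d' w (h q) \<le> 2 * r"
    if "w \<in> X" "d' (h y) (h z) < d y z" "d x z \<le> d' (h x) (h z)"
  proof -
    have "Q.seg (h x) (h z) (h ` S)" using seg_image S xyz that by blast
    then have "Q.seg (h z) (h x) (h ` S)" using Q.seg_sym M' by blast
    from Q.rips_thin[OF rips P(1) Q.seg_sym[OF P(3) M'(3) V_in] Q.seg_sym[OF this M'(3,1)]
        M'(1) V_in M'(3) that(1)]
    obtain q where q: "q \<in> Z \<union> h ` S" "d' w q \<le> r" .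
    show ?thesis
    proof (cases "q \<in> Z")
      case True
      then show ?thesis
        using dist_triangle_ex[OF q(2) T_short[OF that(2)] wM _ ST(3)] XYM(3) by auto
    next
      case False then show ?thesis using q by (intro double) blast
    qed
  qed
  moreover have "\<exists>q\<in>S \<union> T. d' w (h q) \<le> 2 * r"
    if "w \<in> Y" "d' (h x) (h z) < d x z" "d y z \<le> d' (h y) (h z)"
  proof -
    have "Q.seg (h y) (h z) (h ` T)" using seg_image S xyz that by blast
    from Q.rips_thin[OF rips P(2) Q.seg_sym[OF P(3) M'(3) V_in] this
        M'(2) V_in M'(3) that(1)]
    obtain q where q: "q \<in> Z \<union> h ` T" "d' w q \<le> r" .
    show ?thesis
    proof (cases "q \<in> Z")
      case True
      then show ?thesis
        using dist_triangle_ex[OF q(2) S_short[OF that(2)] wM _ ST(3)] XYM(3) by auto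
    next
      case False then show ?thesis using q by (intro double) blast
    qed
  qed
  ultimately show "\<exists>q\<in>S \<union> T. d' w (h q) \<le> 2 * r"
    using w good S_short T_short double by (metis UnE UnI1 not_less)
qed

text \<open>If \<open>A\<close> is shortened, the way leads from \<open>p\<close> to the detour and
  on to the other sides, at cost \<open>r + 2 * r\<close>, or to \<open>V\<close> and on, at cost
  \<open>(2 * r + 1 / 2) + r\<close>. If \<open>A\<close> is not shortened, \<open>2 * r\<close>
  suffices. Returning from \<open>d'\<close> to \<open>d\<close> adds \<open>1\<close>.\<close>

lemma rips_hyperbolic_expand:
  assumes rips: "rips_hyperbolic M' d' r"
  shows "rips_hyperbolic M d (3 * r + 3 / 2)"
  unfolding rips_hyperbolic_def in_nbhd_def
proof (intro ballI allI impI)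
  fix x y z A B C p
  assume xyz: "x \<in> M" "y \<in> M" "z \<in> M" and A: "G.seg x y A" and B: "G.seg y z B"
    and C': "G.seg z x C" and p: "p \<in> A"
  have C: "G.seg x z C" by (rule G.seg_sym[OF C' xyz(3,1)])
  have r0: "0 \<le> r" by (rule Q.rips_nonneg[OF rips V_in])
  have M': "h x \<in> M'" "h y \<in> M'" "h z \<in> M'" using xyz h_in by blast+
  obtain X Y Z where P: "Q.seg (h x) V X" "Q.seg (h y) V Y" "Q.seg (h z) V Z"
    using Q.geodesic_exists V_in M' by metis
  have XYM: "X \<subseteq> M'" "Y \<subseteq> M'" "Z \<subseteq> M'" using Q.seg_subset P by blast+
  have BC: "C \<union> B \<subseteq> M" using G.seg_subset B C by blast
  have pM: "p \<in> M" "h p \<in> M'" using G.seg_subset[OF A p] h_in by blast+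
  have "\<exists>q\<in>C \<union> B. d' (h p) (h q) \<le> 3 * r + 1 / 2"
  proof (cases "d' (h x) (h y) < d x y")
    case short: True
    consider w where "w \<in> X \<union> Y" "d' (h p) w \<le> r" | "d' (h p) V \<le> 2 * r + 1 / 2"
      using shortened_side_near(2)[OF rips A xyz(1,2) short P(1,2) p] by blast
    then show ?thesis
    proof cases
      case 1
      then show ?thesis
        using dist_triangle_ex[OF 1(2) shortened_triangle_near(2)[OF rips xyz C B short P 1(1)] pM(2) _ BC]
          XYM by auto
    next
      case 2
      then show ?thesis
        using dist_triangle_ex[OF 2 shortened_triangle_near(1)[OF rips xyz C B short P] pM(2) V_in BC]
        by auto
    qed
  next
    case False
    then have sA: "Q.seg (h x) (h y) (h ` A)" using seg_image[OF A xyz(1,2)] by simp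
    have near_C: "\<exists>q\<in>C \<union> B. d' w (h q) \<le> r" if "d' (h x) (h z) < d x z" "w \<in> X \<union> Z" for w
      using shortened_side_near(1)[OF rips C xyz(1,3) that(1) P(1,3) that(2)] by blast
    have near_B: "\<exists>q\<in>C \<union> B. d' w (h q) \<le> r" if "d' (h y) (h z) < d y z" "w \<in> Y \<union> Z" for w
      using shortened_side_near(1)[OF rips B xyz(2,3) that(1) P(2,3) that(2)] by blast
    have hp: "h p \<in> h ` A" using p by blast
    have two_step: ?thesis if "d' (h p) w \<le> r" "\<exists>q\<in>C \<union> B. d' w (h q) \<le> r" "w \<in> M'" for w
      using dist_triangle_ex[OF that(1,2) pM(2) that(3) BC] r0 by auto
    have one_step: ?thesis if "d' (h p) (h q) \<le> r" "q \<in> C \<union> B" for q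
      using that r0 by (intro bexI[of _ q]) auto
    show ?thesis
    \<comment> \<open>A shortened side is replaced by its detour through \<open>V\<close>. If both
      other sides are shortened, \<open>V\<close> takes the place of the vertex \<open>h z\<close>,
      so that the sides are \<open>X\<close> and \<open>Y\<close>.\<close>
    proof (cases "d' (h x) (h z) < d x z"; cases "d' (h y) (h z) < d y z")
      assume *: "d' (h x) (h z) < d x z" "d' (h y) (h z) < d y z"
      obtain q where "q \<in> Y \<union> X" "d' (h p) q \<le> r"
        using Q.rips_thin[OF rips sA P(2,1) M'(1,2) V_in hp] .
      then show ?thesis using two_step near_C[OF *(1)] near_B[OF *(2)] XYM by blast
    next
      assume *: "d' (h x) (h z) < d x z" "\<not> d' (h y) (h z) < d y z"
      have XZ: "Q.seg (h x) (h z) (X \<union> Z)"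
        using seg_to_V_join[OF P(1,3) M'(1,3)] contr_through[OF xyz(1,3) *(1)] by blast
      have "Q.seg (h y) (h z) (h ` B)" using seg_image[OF B xyz(2,3)] * by simp
      then obtain q where "q \<in> h ` B \<union> (X \<union> Z)" "d' (h p) q \<le> r"
        using Q.rips_thin[OF rips sA _ XZ M' hp] by blast
      then show ?thesis using two_step near_C[OF *(1)] one_step XYM by blast
    next
      assume *: "\<not> d' (h x) (h z) < d x z" "d' (h y) (h z) < d y z"
      have YZ: "Q.seg (h y) (h z) (Y \<union> Z)"
        using seg_to_V_join[OF P(2,3) M'(2,3)] contr_through[OF xyz(2,3) *(2)] by blast
      have "Q.seg (h x) (h z) (h ` C)" using seg_image[OF C xyz(1,3)] * by simp
      then obtain q where "q \<in> (Y \<union> Z) \<union> h ` C" "d' (h p) q \<le> r"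
        using Q.rips_thin[OF rips sA YZ _ M' hp] by blast
      then show ?thesis using two_step near_B[OF *(2)] one_step XYM by blast
    next
      assume *: "\<not> d' (h x) (h z) < d x z" "\<not> d' (h y) (h z) < d y z"
      have "Q.seg (h x) (h z) (h ` C)" "Q.seg (h y) (h z) (h ` B)"
        using seg_image[OF C xyz(1,3)] seg_image[OF B xyz(2,3)] * by simp_all
      then obtain q where "q \<in> h ` B \<union> h ` C" "d' (h p) q \<le> r"
        using Q.rips_thin[OF rips sA _ _ M' hp] by blast
      then show ?thesis using one_step by blast
    qed
  qed
  then obtain q where q: "q \<in> C \<union> B" "d' (h p) (h q) \<le> 3 * r + 1 / 2" by blast
  then have "d p q \<le> 3 * r + 3 / 2" using contr_ge[of p q] pM BC by force
  with q(1) show "\<exists>q\<in>B \<union> C. d p q \<le> 3 * r + 3 / 2" by blast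
qed

text \<open>Along a geodesic the sum of \<open>d'\<close> and \<open>\<rho>\<close> is additive
  while each summand is subadditive; hence \<open>d'\<close> is additive too. So
  \<open>h \<circ> \<gamma>\<close> never turns back and only has to be reparametrized by its
  distance \<open>\<phi>\<close> from \<open>h x\<close>.\<close>

lemma seg_image_of_sum:
  assumes sum: "\<And>x y. x \<in> M \<Longrightarrow> y \<in> M \<Longrightarrow> d x y = d' (h x) (h y) + \<rho> x y"
    and tri: "\<And>x y z. x \<in> M \<Longrightarrow> y \<in> M \<Longrightarrow> z \<in> M \<Longrightarrow> \<rho> x z \<le> \<rho> x y + \<rho> y z"
    and S: "G.seg x y S" "x \<in> M" "y \<in> M"
  shows "Q.seg (h x) (h y) (h ` S)"
proof -
  define L where "L = d x y"
  obtain \<gamma> where g: "G.isometric_path \<gamma> L" "\<gamma> 0 = x" "\<gamma> L = y" "S = \<gamma> ` {0..L}"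
    using G.segE[OF S] unfolding L_def .
  note gD = G.isometric_pathD[OF g(1)]
  have L: "0 \<le> L" by (rule gD(1))
  have hM: "h (\<gamma> s) \<in> M'" if "0 \<le> s" "s \<le> L" for s using h_in gD(2) that by blast
  define \<phi> where "\<phi> s = d' (h x) (h (\<gamma> s))" for s
  have add: "d' (h (\<gamma> s)) (h (\<gamma> t)) = \<phi> t - \<phi> s" if "0 \<le> s" "s \<le> t" "t \<le> L" for s t
  proof -
    have M: "x \<in> M" "\<gamma> s \<in> M" "\<gamma> t \<in> M" using S(2) gD(2) that by simp_all
    have "d x (\<gamma> s) = s" "d x (\<gamma> t) = t" "d (\<gamma> s) (\<gamma> t) = t - s"
      using gD(3)[of 0 s] gD(3)[of 0 t] gD(3)[of s t] that unfolding g(2) by simp_all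
    moreover have "\<phi> t \<le> \<phi> s + d' (h (\<gamma> s)) (h (\<gamma> t))"
      unfolding \<phi>_def using Q.dist_triangle h_in M by simp
    ultimately show ?thesis
      using sum[OF M(1,2)] sum[OF M(1,3)] sum[OF M(2,3)] tri[OF M] unfolding \<phi>_def by linarith
  qed
  have mono: "\<phi> s \<le> \<phi> t" if "0 \<le> s" "s \<le> t" "t \<le> L" for s t
    using add[OF that] Q.dist_nonneg[OF hM hM, of s t] that by simp
  have lip: "\<phi> t - \<phi> s \<le> t - s" if "0 \<le> s" "s \<le> t" "t \<le> L" for s t
    using add[OF that] contr_le[OF gD(2) gD(2), of s t] gD(3)[of s t] that by simp
  have "1-lipschitz_on {0..L} \<phi>"
  proof (rule lipschitz_onI)
    fix s t assume "s \<in> {0..L}" "t \<in> {0..L}"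
    then show "dist (\<phi> s) (\<phi> t) \<le> 1 * dist s t"
      using lip[of s t] lip[of t s] mono[of s t] mono[of t s]
      by (cases "s \<le> t") (auto simp: dist_real_def)
  qed simp
  then have cont: "continuous_on {0..L} \<phi>" by (rule lipschitz_on_continuous_on)
  have \<phi>0: "\<phi> 0 = 0" unfolding \<phi>_def g(2) using Q.dist_self h_in S(2) by simp
  have \<phi>L: "\<phi> L = d' (h x) (h y)" unfolding \<phi>_def g(3) ..
  \<comment> \<open>The function \<open>\<phi>\<close> may be constant on intervals, so a preimage
    is chosen. The choice is harmless: parameters with equal \<open>\<phi>\<close> have images at
    \<open>d'\<close>-distance \<open>0\<close>.\<close>
  define inv where "inv \<tau> = (SOME s. 0 \<le> s \<and> s \<le> L \<and> \<phi> s = \<tau>)" for \<tau>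
  have inv: "0 \<le> inv \<tau> \<and> inv \<tau> \<le> L \<and> \<phi> (inv \<tau>) = \<tau>" if "0 \<le> \<tau>" "\<tau> \<le> \<phi> L" for \<tau>
  proof -
    have "\<exists>s\<ge>0. s \<le> L \<and> \<phi> s = \<tau>" by (rule IVT'[OF _ that(2) L cont]) (use that \<phi>0 in simp)
    then show ?thesis unfolding inv_def by (rule someI_ex)
  qed
  have inv_\<phi>: "h (\<gamma> (inv (\<phi> s))) = h (\<gamma> s)" if s: "0 \<le> s" "s \<le> L" for s
  proof -
    define s' where "s' = inv (\<phi> s)"
    have s': "0 \<le> s'" "s' \<le> L" "\<phi> s' = \<phi> s"
      using inv[of "\<phi> s"] mono[of 0 s] mono[of s L] s \<phi>0 unfolding s'_def by auto
    have "d' (h (\<gamma> s')) (h (\<gamma> s)) = 0"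
      using add[of s s'] add[of s' s] Q.dist_sym[OF hM hM, of s s'] s s' by (cases "s \<le> s'") auto
    then show ?thesis using Q.dist_eq_0 hM s s' unfolding s'_def by blast
  qed
  define \<eta> where "\<eta> \<tau> = h (\<gamma> (inv \<tau>))" for \<tau>
  have "Q.lipschitz_path \<eta> (\<phi> L)"
  proof (rule Q.lipschitz_pathI)
    show "0 \<le> \<phi> L" using mono[of 0 L] L \<phi>0 by simp
    show "\<eta> s \<in> M'" if "0 \<le> s" "s \<le> \<phi> L" for s
      unfolding \<eta>_def using hM inv[OF that] by blast
    show "d' (\<eta> s) (\<eta> t) \<le> t - s" if st: "0 \<le> s" "s \<le> t" "t \<le> \<phi> L" for s t
    proof -
      have i: "0 \<le> inv s \<and> inv s \<le> L \<and> \<phi> (inv s) = s" "0 \<le> inv t \<and> inv t \<le> L \<and> \<phi> (inv t) = t"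
        using inv st by simp_all
      show ?thesis
      proof (cases "inv s \<le> inv t")
        case True then show ?thesis using add[of "inv s" "inv t"] i unfolding \<eta>_def by simp
      next
        case False
        then show ?thesis
          using add[of "inv t" "inv s"] mono[of "inv t" "inv s"] i st Q.dist_sym[OF hM hM, of "inv t" "inv s"]
          unfolding \<eta>_def by simp
      qed
    qed
  qed
  moreover have "\<phi> L \<le> d' (h x) (h y)" using \<phi>L by simp
  moreover have "\<eta> 0 = h x" using inv_\<phi>[of 0] L \<phi>0 g(2) unfolding \<eta>_def by simp
  moreover have "\<eta> (\<phi> L) = h y" using inv_\<phi>[of L] L g(3) unfolding \<eta>_def by simp
  moreover have "h ` S = \<eta> ` {0..\<phi> L}"
  proof (intro equalityI subsetI)
    fix p assume "p \<in> h ` S"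
    then obtain s where s: "0 \<le> s" "s \<le> L" "p = h (\<gamma> s)" unfolding g(4) by auto
    then have "p = \<eta> (\<phi> s)" using inv_\<phi> unfolding \<eta>_def by simp
    moreover have "\<phi> s \<in> {0..\<phi> L}" using mono[of 0 s] mono[of s L] s \<phi>0 by simp
    ultimately show "p \<in> \<eta> ` {0..\<phi> L}" by (rule image_eqI)
  next
    fix p assume "p \<in> \<eta> ` {0..\<phi> L}"
    then obtain \<tau> where "0 \<le> \<tau>" "\<tau> \<le> \<phi> L" "p = \<eta> \<tau>" by auto
    then have "inv \<tau> \<in> {0..L}" "p = h (\<gamma> (inv \<tau>))" using inv[of \<tau>] unfolding \<eta>_def by simp_all
    then show "p \<in> h ` S" unfolding g(4) by blast
  qed
  ultimately show ?thesis by (rule Q.segI)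
qed

lemma rips_hyperbolic_expand_of_sum:
  assumes sum: "\<And>x y. x \<in> M \<Longrightarrow> y \<in> M \<Longrightarrow> d x y = d' (h x) (h y) + \<rho> x y"
    and tri: "\<And>x y z. x \<in> M \<Longrightarrow> y \<in> M \<Longrightarrow> z \<in> M \<Longrightarrow> \<rho> x z \<le> \<rho> x y + \<rho> y z"
    and rips: "rips_hyperbolic M' d' r"
  shows "rips_hyperbolic M d (r + 1)"
  unfolding rips_hyperbolic_def in_nbhd_def
proof (intro ballI allI impI)
  fix x y z A B C p
  assume xyz: "x \<in> M" "y \<in> M" "z \<in> M" and A: "G.seg x y A" and B: "G.seg y z B"
    and C: "G.seg z x C" and p: "p \<in> A"
  note im = seg_image_of_sum[where \<rho> = \<rho>, OF sum tri]
  have "Q.seg (h x) (h y) (h ` A)" "Q.seg (h y) (h z) (h ` B)" "Q.seg (h z) (h x) (h ` C)"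
    using im[OF _ _ _ _ _ A] im[OF _ _ _ _ _ B] im[OF _ _ _ _ _ C] xyz by simp_all
  then have "in_nbhd d' r (h ` A) (h ` B \<union> h ` C)"
    using rips xyz h_in unfolding rips_hyperbolic_def by blast
  then obtain q where q: "q \<in> B \<union> C" "d' (h p) (h q) \<le> r"
    using p unfolding in_nbhd_def by blast
  moreover have "p \<in> M" "q \<in> M" using p q(1) G.seg_subset A B C by blast+
  ultimately have "d p q \<le> r + 1" using contr_ge[of p q] by simp
  with q(1) show "\<exists>q\<in>B \<union> C. d p q \<le> r + 1" by blast
qed

end

text \<open>\<open>\<sigma>\<close> sends \<open>V\<close> to the midpoint \<open>c\<close> of its fibre. That point is equally far from both ends
  \<open>e0\<close>, \<open>e1\<close> of the fibre, so the two halves of every path through the fibre that covers a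
  geodesic through \<open>V\<close> are geodesics.\<close>

locale midpoint_contraction = contraction M d M' d' h V
  for M :: "'p set" and d and M' :: "'q set" and d' and h :: "'p \<Rightarrow> 'q" and V :: 'q +
  fixes \<sigma> :: "'q \<Rightarrow> 'p" and c e0 e1 :: 'p
  assumes \<sigma>_in: "x \<in> M' \<Longrightarrow> \<sigma> x \<in> M"
    and h_\<sigma>: "x \<in> M' \<Longrightarrow> h (\<sigma> x) = x"
    and \<sigma>_V: "\<sigma> V = c"
    and ends_in: "e0 \<in> M" "e1 \<in> M"
    and fibre_exit: "x \<in> M' \<Longrightarrow> x \<noteq> V \<Longrightarrow> d (\<sigma> x) e0 \<le> d' x V \<or> d (\<sigma> x) e1 \<le> d' x V"
    and half_fibre: "\<alpha> \<in> {e0, e1} \<Longrightarrow> \<exists>\<kappa>. G.lipschitz_path \<kappa> (1 / 2) \<and> \<kappa> 0 = \<alpha> \<and> \<kappa> (1 / 2) = c \<and>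
      (\<forall>s\<in>{0..1 / 2}. h (\<kappa> s) = V)"
    and midpoint_far: "x \<in> M' \<Longrightarrow> x \<noteq> V \<Longrightarrow> d' x V + 1 / 2 \<le> d (\<sigma> x) c"
begin

section \<open>Lifting geodesics along the contraction\<close>

lemma c_in: "c \<in> M" and h_c: "h c = V"
  using \<sigma>_in[OF V_in] h_\<sigma>[OF V_in] \<sigma>_V by simp_all

text \<open>The section \<open>\<sigma>\<close> can increase distances, but only between points that
  have a geodesic through \<open>V\<close>. On \<open>[a, b]\<close> the distance to
  \<open>V\<close> has a positive minimum \<open>f m\<close>, and points of \<open>\<gamma>\<close>
  closer than \<open>f m\<close> cannot be joined by a geodesic through \<open>V\<close>. So
  \<open>\<sigma>\<close> preserves the length of short pieces, and these are chained.\<close>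

lemma lift_avoiding_lipschitz:
  assumes g: "Q.isometric_path \<gamma> L" and ab: "0 \<le> a" "a \<le> b" "b \<le> L"
    and avoid: "\<And>s. a \<le> s \<Longrightarrow> s \<le> b \<Longrightarrow> \<gamma> s \<noteq> V"
  shows "d (\<sigma> (\<gamma> a)) (\<sigma> (\<gamma> b)) \<le> b - a"
proof -
  note gD = Q.isometric_pathD[OF g]
  have gM: "\<gamma> s \<in> M'" if "a \<le> s" "s \<le> b" for s using gD(2) ab that by simp
  define f where "f s = d' (\<gamma> s) V" for s
  have f_lip: "f s \<le> f t + \<bar>s - t\<bar>" if "a \<le> s" "s \<le> b" "a \<le> t" "t \<le> b" for s t
    using Q.dist_triangle[OF gM gM V_in, of s t] gD(3)[of s t] ab that unfolding f_def by simp
  have "1-lipschitz_on {a..b} f"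
  proof (rule lipschitz_onI)
    fix s t assume "s \<in> {a..b}" "t \<in> {a..b}"
    then show "dist (f s) (f t) \<le> 1 * dist s t"
      using f_lip[of s t] f_lip[of t s] by (auto simp: dist_real_def)
  qed simp
  then have "continuous_on {a..b} f" by (rule lipschitz_on_continuous_on)
  then obtain m where m: "m \<in> {a..b}" "\<And>s. s \<in> {a..b} \<Longrightarrow> f m \<le> f s"
    using continuous_attains_inf[of "{a..b}" f] ab(2) by auto
  have fm: "0 < f m"
    using Q.dist_nonneg[OF gM V_in, of m] Q.dist_eq_0[OF gM V_in, of m] avoid[of m] m(1)
    unfolding f_def by force
  have short: "d (\<sigma> (\<gamma> s)) (\<sigma> (\<gamma> t)) \<le> t - s" if "a \<le> s" "s \<le> t" "t \<le> b" "t - s < f m" for s t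
  proof (rule ccontr)
    have M: "\<gamma> s \<in> M'" "\<gamma> t \<in> M'" using gM that by simp_all
    have st: "d' (\<gamma> s) (\<gamma> t) = t - s" using gD(3)[of s t] ab that by simp
    assume "\<not> ?thesis"
    then have "d' (\<gamma> s) (\<gamma> t) = f s + f t"
      using contr_through[of "\<sigma> (\<gamma> s)" "\<sigma> (\<gamma> t)"] \<sigma>_in h_\<sigma> M Q.dist_sym[OF V_in M(2)] st
      unfolding f_def by simp
    moreover have "f m \<le> f s" "f m \<le> f t" using m(2) that by simp_all
    ultimately show False using st that(4) fm by simp
  qed
  \<comment> \<open>With \<open>n\<close> equal pieces, each has length less than
    \<open>f m\<close>, as \<open>short\<close> demands.\<close>
  obtain n :: nat where n: "(b - a) / f m < real n" using reals_Archimedean2 by blast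
  then have n0: "0 < real n" using ab(2) fm by (metis divide_nonneg_pos diff_ge_0_iff_ge order_le_less_trans)
  define \<delta> where "\<delta> = (b - a) / n"
  have \<delta>: "0 \<le> \<delta>" "\<delta> < f m" "n * \<delta> = b - a"
    using n n0 fm ab(2) unfolding \<delta>_def by (simp_all add: field_simps)
  have "d (\<sigma> (\<gamma> a)) (\<sigma> (\<gamma> (a + k * \<delta>))) \<le> k * \<delta>" if "k \<le> n" for k :: nat
    using that
  proof (induction k)
    case 0 then show ?case using G.dist_self \<sigma>_in gM[of a] ab by simp
  next
    case (Suc k)
    have "real (Suc k) * \<delta> \<le> n * \<delta>" using Suc.prems \<delta>(1) by (intro mult_right_mono) simp_all
    then have k: "a \<le> a + k * \<delta>" "a + Suc k * \<delta> \<le> b" "a + k * \<delta> \<le> a + Suc k * \<delta>"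
      using \<delta>(1,3) by (simp_all add: algebra_simps)
    have "d (\<sigma> (\<gamma> (a + k * \<delta>))) (\<sigma> (\<gamma> (a + Suc k * \<delta>))) \<le> \<delta>"
      using short[of "a + k * \<delta>" "a + Suc k * \<delta>"] k \<delta>(2) by (simp add: algebra_simps)
    moreover have "d (\<sigma> (\<gamma> a)) (\<sigma> (\<gamma> (a + Suc k * \<delta>)))
        \<le> d (\<sigma> (\<gamma> a)) (\<sigma> (\<gamma> (a + k * \<delta>))) + d (\<sigma> (\<gamma> (a + k * \<delta>))) (\<sigma> (\<gamma> (a + Suc k * \<delta>)))"
      using k ab by (intro G.dist_triangle \<sigma>_in gM) linarith+
    ultimately show ?case using Suc by (simp add: algebra_simps)
  qed
  from this[of n] show ?thesis using \<delta>(3) by simp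
qed

text \<open>Away from \<open>V\<close> the path is lifted by \<open>\<sigma>\<close>; half of the
  fibre is appended, on which \<open>h\<close> stays at \<open>V\<close>, whence
  \<open>min s D\<close>. The length is \<open>D + 1 / 2\<close>, except that the trivial path at
  \<open>V\<close> lifts to the trivial path at \<open>c\<close>.\<close>

lemma lift_to_midpoint:
  assumes g: "Q.isometric_path \<gamma> D" "\<gamma> D = V"
  obtains l \<phi> where "D \<le> l" "G.isometric_path \<phi> l" "\<phi> 0 = \<sigma> (\<gamma> 0)" "\<phi> l = c"
    "\<forall>s\<in>{0..l}. h (\<phi> s) = \<gamma> (min s D)"
proof (cases "D = 0")
  case True
  have V: "\<gamma> 0 = V" using g(2) True by simp
  have iso: "G.isometric_path (\<lambda>_. c) 0"
    using c_in G.dist_self by (simp add: G.isometric_path_def)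
  show thesis
  proof (rule that[OF _ iso])
    show "\<forall>s\<in>{0..0}. h c = \<gamma> (min s D)"
    proof
      fix s :: real assume "s \<in> {0..0}"
      then have "min s D = 0" using True by simp
      then show "h c = \<gamma> (min s D)" by (simp only: V h_c)
    qed
  qed (simp_all only: True V \<sigma>_V order_refl)
next
  case False
  note gD = Q.isometric_pathD[OF g(1)]
  have D: "0 < D" using gD(1) False by simp
  have gM: "\<gamma> s \<in> M'" if "0 \<le> s" "s \<le> D" for s using gD(2) that by simp
  have dV: "d' (\<gamma> s) V = D - s" if "0 \<le> s" "s \<le> D" for s
    using gD(3)[of s D] that D g(2) by simp
  have neV: "\<gamma> s \<noteq> V" if "0 \<le> s" "s < D" for s
    using dV[of s] Q.dist_self[OF V_in] that by auto
  have lip: "d (\<sigma> (\<gamma> s)) (\<sigma> (\<gamma> t)) \<le> t - s" if "0 \<le> s" "s \<le> t" "t < D" for s t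
    by (rule lift_avoiding_lipschitz[OF g(1)]) (use that neV in auto)
  \<comment> \<open>By \<open>fibre_exit\<close> each point of the lift is close enough to one of
    the two ends, but a single end must work for all. If \<open>e0\<close> failed at
    \<open>s\<close> and \<open>e1\<close> at \<open>t\<close>, the end that works at
    \<open>max s t\<close> would also work at both earlier parameters, by the triangle inequality
    along the lift.\<close>
  have "\<exists>\<alpha>\<in>{e0, e1}. \<forall>s. 0 \<le> s \<and> s < D \<longrightarrow> d (\<sigma> (\<gamma> s)) \<alpha> \<le> D - s"
  proof (rule ccontr)
    assume "\<not> ?thesis"
    then obtain s t where s: "0 \<le> s" "s < D" "D - s < d (\<sigma> (\<gamma> s)) e0"
      and t: "0 \<le> t" "t < D" "D - t < d (\<sigma> (\<gamma> t)) e1"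
      by (auto simp: not_le)
    define u where "u = max s t"
    have u: "0 \<le> u" "u < D" "s \<le> u" "t \<le> u" using s t unfolding u_def by auto
    have M: "\<sigma> (\<gamma> s) \<in> M" "\<sigma> (\<gamma> t) \<in> M" "\<sigma> (\<gamma> u) \<in> M" using \<sigma>_in gM s t u by simp_all
    have "d (\<sigma> (\<gamma> u)) e0 \<le> D - u \<or> d (\<sigma> (\<gamma> u)) e1 \<le> D - u"
      using fibre_exit[OF gM neV] dV u by simp
    then show False
      using G.dist_triangle[OF M(1,3) ends_in(1)] G.dist_triangle[OF M(2,3) ends_in(2)]
        lip[of s u] lip[of t u] s t u by linarith
  qed
  then obtain \<alpha> where \<alpha>: "\<alpha> \<in> {e0, e1}" "\<And>s. 0 \<le> s \<Longrightarrow> s < D \<Longrightarrow> d (\<sigma> (\<gamma> s)) \<alpha> \<le> D - s" by blast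
  obtain \<kappa> where \<kappa>: "G.lipschitz_path \<kappa> (1 / 2)" "\<kappa> 0 = \<alpha>" "\<kappa> (1 / 2) = c"
      "\<And>s. 0 \<le> s \<Longrightarrow> s \<le> 1 / 2 \<Longrightarrow> h (\<kappa> s) = V"
    using half_fibre[OF \<alpha>(1)] by auto
  note kD = G.lipschitz_pathD[OF \<kappa>(1)]
  define \<phi> where "\<phi> s = (if s < D then \<sigma> (\<gamma> s) else \<kappa> (s - D))" for s
  have \<phi>M: "\<phi> s \<in> M" if "0 \<le> s" "s \<le> D + 1 / 2" for s
    using that \<sigma>_in gM kD(2)[of "s - D"] unfolding \<phi>_def by simp
  have \<phi>0: "\<phi> 0 = \<sigma> (\<gamma> 0)" "\<phi> (D + 1 / 2) = c" using D \<kappa>(3) unfolding \<phi>_def by simp_all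
  have "G.lipschitz_path \<phi> (D + 1 / 2)"
  proof (rule G.lipschitz_pathI[OF _ \<phi>M])
    fix s t assume st: "0 \<le> s" "s \<le> t" "t \<le> D + 1 / 2"
    consider "t < D" | "s < D" "D \<le> t" | "D \<le> s" by linarith
    then show "d (\<phi> s) (\<phi> t) \<le> t - s"
    proof cases
      case 1 then show ?thesis using lip[of s t] st unfolding \<phi>_def by simp
    next
      case 2
      have "d (\<sigma> (\<gamma> s)) (\<kappa> (t - D)) \<le> d (\<sigma> (\<gamma> s)) \<alpha> + d \<alpha> (\<kappa> (t - D))"
        using \<sigma>_in gM kD(2)[of 0] kD(2)[of "t - D"] st 2 \<kappa>(2) by (intro G.dist_triangle) simp_all
      then show ?thesis
        using \<alpha>(2)[of s] kD(3)[of 0 "t - D"] st 2 \<kappa>(2) unfolding \<phi>_def by simp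
    next
      case 3 then show ?thesis using kD(3)[of "s - D" "t - D"] st unfolding \<phi>_def by simp
    qed
  qed (use D in simp_all)
  \<comment> \<open>Here it matters that the fibre is left in its midpoint: an end of the fibre
    reached from the wrong side would admit a shorter route.\<close>
  moreover have "D + 1 / 2 \<le> d (\<phi> 0) (\<phi> (D + 1 / 2))"
    using midpoint_far[OF gM neV, of 0] dV[of 0] D unfolding \<phi>0 by simp
  ultimately have iso: "G.isometric_path \<phi> (D + 1 / 2)" by (rule G.lipschitz_path_isometric)
  have "\<forall>s\<in>{0..D + 1 / 2}. h (\<phi> s) = \<gamma> (min s D)"
  proof
    fix s assume s: "s \<in> {0..D + 1 / 2}"
    show "h (\<phi> s) = \<gamma> (min s D)"
    proof (cases "s < D")
      case True then show ?thesis using h_\<sigma>[OF gM, of s] s unfolding \<phi>_def by simp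
    next
      case False
      then have "min s D = D" by simp
      then show ?thesis using \<kappa>(4)[of "s - D"] g(2) s False unfolding \<phi>_def by simp
    qed
  qed
  from that[OF _ iso \<phi>0 this] show thesis by simp
qed

lemma lift_seg_to_midpoint:
  assumes "Q.seg x V S" "x \<in> M'"
  obtains T where "G.seg (\<sigma> x) c T" "h ` T = S"
proof -
  define D where "D = d' x V"
  obtain \<gamma> where g: "Q.isometric_path \<gamma> D" "\<gamma> 0 = x" "\<gamma> D = V" "S = \<gamma> ` {0..D}"
    using Q.segE[OF assms V_in] unfolding D_def .
  have D: "0 \<le> D" by (rule Q.isometric_pathD(1)[OF g(1)])
  obtain l \<phi> where p: "D \<le> l" "G.isometric_path \<phi> l" "\<phi> 0 = \<sigma> (\<gamma> 0)" "\<phi> l = c"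
      "\<forall>s\<in>{0..l}. h (\<phi> s) = \<gamma> (min s D)"
    using lift_to_midpoint[OF g(1,3)] .
  have "G.seg (\<sigma> x) c (\<phi> ` {0..l})"
    using G.seg_subpath[OF p(2), of 0 l] p g(2) D by simp
  moreover have "h ` \<phi> ` {0..l} = S"
  proof (intro equalityI subsetI)
    fix q assume "q \<in> h ` \<phi> ` {0..l}"
    then obtain s where s: "0 \<le> s" "s \<le> l" "q = h (\<phi> s)" by auto
    then have "q = \<gamma> (min s D)" using p(5) by simp
    then show "q \<in> S" unfolding g(4) using s(1) D by auto
  next
    fix q assume "q \<in> S"
    then obtain s where s: "0 \<le> s" "s \<le> D" "q = \<gamma> s" unfolding g(4) by auto
    then have "q = h (\<phi> s)" "s \<in> {0..l}" using p(1,5) by simp_all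
    then show "q \<in> h ` \<phi> ` {0..l}" by blast
  qed
  ultimately show thesis by (rule that)
qed

lemma lift_seg_avoiding:
  assumes "Q.seg x y S" "x \<in> M'" "y \<in> M'" "V \<notin> S"
  obtains T where "G.seg (\<sigma> x) (\<sigma> y) T" "h ` T = S"
proof -
  define L where "L = d' x y"
  obtain \<gamma> where g: "Q.isometric_path \<gamma> L" "\<gamma> 0 = x" "\<gamma> L = y" "S = \<gamma> ` {0..L}"
    using Q.segE[OF assms(1-3)] unfolding L_def .
  note gD = Q.isometric_pathD[OF g(1)]
  have avoid: "\<gamma> s \<noteq> V" if "0 \<le> s" "s \<le> L" for s using assms(4) that unfolding g(4) by auto
  have "G.lipschitz_path (\<lambda>s. \<sigma> (\<gamma> s)) L"
    by (rule G.lipschitz_pathI)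
      (use gD(1,2) \<sigma>_in lift_avoiding_lipschitz[OF g(1)] avoid in auto)
  moreover have "L \<le> d (\<sigma> x) (\<sigma> y)"
    using contr_le[OF \<sigma>_in \<sigma>_in, OF assms(2,3)] h_\<sigma> assms(2,3) unfolding L_def by simp
  ultimately have "G.seg (\<sigma> x) (\<sigma> y) ((\<lambda>s. \<sigma> (\<gamma> s)) ` {0..L})"
    by (rule G.segI) (simp_all add: g)
  moreover have "h ` (\<lambda>s. \<sigma> (\<gamma> s)) ` {0..L} = \<gamma> ` {0..L}"
    unfolding image_image by (intro image_cong) (use h_\<sigma> gD(2) in auto)
  ultimately show thesis using that g(4) by simp
qed

section \<open>Thin triangles in the quotient and the lower bound\<close>

lemma rips_thin_image:
  assumes "rips_hyperbolic M d r" "G.seg x y S" "G.seg y z T" "G.seg x z U"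
    "x \<in> M" "y \<in> M" "z \<in> M" "p \<in> h ` S"
  obtains q where "q \<in> h ` T \<union> h ` U" "d' p q \<le> r"
proof -
  obtain p' where p': "p' \<in> S" "p = h p'" using assms(8) by blast
  obtain q where q: "q \<in> T \<union> U" "d p' q \<le> r" using G.rips_thin[OF assms(1-7) p'(1)] .
  have "p' \<in> M" "q \<in> M" using G.seg_subset assms(2-4) p' q by blast+
  then have "d' p (h q) \<le> r" using contr_le[of p' q] q(2) p'(2) by simp
  with q(1) that show thesis by blast
qed

text \<open>The lifted halves of a side through \<open>V\<close> and the geodesic \<open>S\<close>
  form a triangle with third vertex \<open>c\<close>. Thinness alone could lead from the lift of
  \<open>P\<close> to the lift of \<open>R\<close> and not to \<open>S\<close>. Therefore
  \<open>S\<close> is examined where it changes from being near the one lift to being near the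
  other.\<close>

lemma near_lifted_geodesic:
  assumes rips: "rips_hyperbolic M d r" and \<theta>: "0 < \<theta>" and xy: "x \<in> M'" "y \<in> M'"
    and P: "Q.seg x V P" and R: "Q.seg y V R" and sum: "d' x y = d' x V + d' V y"
    and S: "G.seg (\<sigma> x) (\<sigma> y) S" and p: "p \<in> P"
  obtains w where "w \<in> S" "d' p (h w) \<le> 2 * r + \<theta>"
proof -
  have r0: "0 \<le> r" by (rule G.rips_nonneg[OF rips c_in])
  have M: "\<sigma> x \<in> M" "\<sigma> y \<in> M" using xy \<sigma>_in by simp_all
  define D where "D = d' x V"
  obtain \<gamma> where g: "Q.isometric_path \<gamma> D" "\<gamma> 0 = x" "\<gamma> D = V" "P = \<gamma> ` {0..D}"
    using Q.segE[OF P xy(1) V_in] unfolding D_def .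
  note gD = Q.isometric_pathD[OF g(1)]
  obtain l \<phi> where f: "D \<le> l" "G.isometric_path \<phi> l" "\<phi> 0 = \<sigma> (\<gamma> 0)" "\<phi> l = c"
      "\<forall>s\<in>{0..l}. h (\<phi> s) = \<gamma> (min s D)"
    using lift_to_midpoint[OF g(1,3)] .
  note fD = G.isometric_pathD[OF f(2)]
  have \<phi>0: "\<phi> 0 = \<sigma> x" using f(3) g(2) by simp
  have segP: "G.seg (\<sigma> x) c (\<phi> ` {0..l})"
    using G.seg_subpath[OF f(2), of 0 l] fD(1) f(4) \<phi>0 by simp
  obtain T where T: "G.seg (\<sigma> y) c T" "h ` T = R" using lift_seg_to_midpoint[OF R xy(2)] .
  define L where "L = d (\<sigma> x) (\<sigma> y)"
  obtain \<eta> where e: "G.isometric_path \<eta> L" "\<eta> 0 = \<sigma> x" "\<eta> L = \<sigma> y" "S = \<eta> ` {0..L}"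
    using G.segE[OF S M] unfolding L_def .
  note eD = G.isometric_pathD[OF e(1)]
  define near1 where "near1 s \<longleftrightarrow> (\<exists>u\<in>{0..l}. d (\<eta> s) (\<phi> u) \<le> r)" for s
  define near2 where "near2 s \<longleftrightarrow> (\<exists>q\<in>T. d (\<eta> s) q \<le> r)" for s
  have "near1 0" unfolding near1_def using fD(1) \<phi>0 e(2) G.dist_self[OF M(1)] r0
    by (intro bexI[of _ 0]) simp_all
  moreover have "near2 L" unfolding near2_def
    using G.seg_ends[OF T(1) M(2) c_in] e(3) G.dist_self[OF M(2)] r0
    by (intro bexI[of _ "\<sigma> y"]) simp_all
  moreover have "near1 s \<or> near2 s" if "0 \<le> s" "s \<le> L" for s
  proof -
    have "\<eta> s \<in> S" using e(4) that by auto
    then obtain q where "q \<in> T \<union> \<phi> ` {0..l}" "d (\<eta> s) q \<le> r"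
      using G.rips_thin[OF rips S T(1) segP M c_in] by blast
    then show ?thesis unfolding near1_def near2_def by blast
  qed
  \<comment> \<open>At the change, \<open>\<eta> s\<close> is near the lift of \<open>P\<close> and
    \<open>\<eta> t\<close> near that of \<open>R\<close>, up to the gap \<open>\<theta>\<close>.
    The point \<open>\<phi> u\<close> separates the points of \<open>P\<close> treated by thinness
    from those between \<open>h (\<phi> u)\<close> and \<open>V\<close>.\<close>
  ultimately obtain s t where st: "0 \<le> s" "s \<le> L" "0 \<le> t" "t \<le> L" "near1 s" "near2 t" "\<bar>s - t\<bar> \<le> \<theta>"
    using real_interval_cover_switch[OF eD(1) \<theta>, of near1 near2] by metis
  obtain u where u: "0 \<le> u" "u \<le> l" "d (\<eta> s) (\<phi> u) \<le> r" using st(5) unfolding near1_def by auto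
  obtain q where q: "q \<in> T" "d (\<eta> t) q \<le> r" using st(6) unfolding near2_def by blast
  have in_M: "\<eta> s \<in> M" "\<eta> t \<in> M" "\<phi> u \<in> M" "q \<in> M"
    using eD(2) fD(2) st u G.seg_subset[OF T(1) q(1)] by simp_all
  obtain \<omega> where \<omega>: "0 \<le> \<omega>" "\<omega> \<le> D" "p = \<gamma> \<omega>" using p g(4) by auto
  have p_eq: "p = h (\<phi> \<omega>)" using f(5) \<omega> f(1) by simp
  have \<omega>M: "\<phi> \<omega> \<in> M" "p \<in> M'" using fD(2)[of \<omega>] f(1) \<omega> gD(2) by simp_all
  have ends: "\<eta> s \<in> S" "\<eta> t \<in> S" using e(4) st by auto
  show thesis
  proof (cases "\<omega> \<le> u")
    case True
    \<comment> \<open>In the triangle \<open>\<sigma> x\<close>, \<open>\<phi> u\<close>,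
      \<open>\<eta> s\<close> the side \<open>S'\<close> has length at most \<open>r\<close>, so a
      point near \<open>S'\<close> is within \<open>2 * r\<close> of
      \<open>\<eta> s\<close>.\<close>
    obtain S' where S': "G.seg (\<eta> s) (\<phi> u) S'" using G.geodesic_exists in_M by blast
    have "G.seg (\<sigma> x) (\<phi> u) (\<phi> ` {0..u})" using G.seg_subpath[OF f(2), of 0 u] u \<phi>0 by simp
    moreover have "G.seg (\<sigma> x) (\<eta> s) (\<eta> ` {0..s})"
      using G.seg_subpath[OF e(1), of 0 s] st e(2) by simp
    moreover have "\<phi> \<omega> \<in> \<phi> ` {0..u}" using True \<omega> by simp
    ultimately obtain w where w: "w \<in> S' \<union> \<eta> ` {0..s}" "d (\<phi> \<omega>) w \<le> r"
      using G.rips_thin[OF rips _ G.seg_sym[OF S' in_M(1,3)] _ M(1) in_M(3,1)] by metis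
    show thesis
    proof (cases "w \<in> S'")
      case True
      define m where "m = d (\<eta> s) (\<phi> u)"
      obtain \<zeta> where z: "G.isometric_path \<zeta> m" "\<zeta> 0 = \<eta> s" "S' = \<zeta> ` {0..m}"
        using G.segE[OF S' in_M(1,3)] unfolding m_def by metis
      then obtain v where v: "0 \<le> v" "v \<le> m" "w = \<zeta> v" using True by auto
      then have "d w (\<eta> s) \<le> m" using G.isometric_pathD(3)[OF z(1), of v 0] z(2) by simp
      moreover have "w \<in> M" by (rule G.seg_subset[OF S' True])
      ultimately have "d (\<phi> \<omega>) (\<eta> s) \<le> 2 * r"
        using G.dist_triangle[of "\<phi> \<omega>" w "\<eta> s"] w(2) u(3) in_M \<omega>M unfolding m_def by simp
      then have "d' p (h (\<eta> s)) \<le> 2 * r + \<theta>"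
        using contr_le[OF \<omega>M(1) in_M(1)] \<theta> unfolding p_eq by simp
      then show thesis using that ends(1) by blast
    next
      case False
      then obtain v where v: "0 \<le> v" "v \<le> s" "w = \<eta> v" using w(1) by auto
      then have "w \<in> S" "w \<in> M" using e(4) st(2) eD(2) by auto
      moreover have "d' p (h w) \<le> 2 * r + \<theta>"
        using contr_le[OF \<omega>M(1) \<open>w \<in> M\<close>] w(2) \<theta> r0 unfolding p_eq by simp
      ultimately show thesis using that by blast
    qed
  next
    case False
    define a where "a = h (\<phi> u)"
    define b where "b = h q"
    have a: "a = \<gamma> u" "u \<le> D" using f(5) u False \<omega> unfolding a_def by simp_all
    have bR: "b \<in> R" using T(2) q(1) unfolding b_def by blast
    have abM: "a \<in> M'" "b \<in> M'" using h_in in_M unfolding a_def b_def by simp_all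
    have bV: "d' y b + d' b V = d' y V"
    proof -
      obtain \<zeta> where z: "Q.isometric_path \<zeta> (d' y V)" "\<zeta> 0 = y" "\<zeta> (d' y V) = V" "R = \<zeta> ` {0..d' y V}"
        using Q.segE[OF R xy(2) V_in] .
      then obtain v where v: "0 \<le> v" "v \<le> d' y V" "b = \<zeta> v" using bR by auto
      have "d' (\<zeta> 0) (\<zeta> v) = v" "d' (\<zeta> v) (\<zeta> (d' y V)) = d' y V - v"
        using Q.isometric_pathD(3)[OF z(1), of 0 v] Q.isometric_pathD(3)[OF z(1), of v "d' y V"] v
        by simp_all
      then show ?thesis unfolding z(2,3) v(3) by simp
    qed
    have xa: "d' x a = u" "d' a p = \<omega> - u" "d' p V = D - \<omega>"
      using gD(3)[of 0 u] gD(3)[of u \<omega>] gD(3)[of \<omega> D] a \<omega> u False unfolding g(2) g(3) by simp_all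
    \<comment> \<open>The points \<open>x\<close>, \<open>a\<close>, \<open>p\<close>,
      \<open>V\<close>, \<open>b\<close>, \<open>y\<close> follow each other on a geodesic, so
      \<open>d' a b\<close> is at least the sum of the distances from \<open>p\<close> to
      \<open>a\<close> and to \<open>b\<close>. It is also at most \<open>2 * r + \<theta>\<close>,
      so one of \<open>a\<close>, \<open>b\<close> is within \<open>r + \<theta>\<close> of
      \<open>p\<close>; both are within \<open>r\<close> of the image of \<open>S\<close>.\<close>
    have "d' x y \<le> d' x a + d' a b + d' b y"
      using Q.dist_triangle[OF xy(1) abM(1) xy(2)] Q.dist_triangle[OF abM(1,2) xy(2)] by linarith
    then have "(\<omega> - u) + d' p b \<le> d' a b"
      using sum bV xa Q.dist_sym[OF V_in xy(2)] Q.dist_sym[OF xy(2) abM(2)]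
        Q.dist_triangle[OF \<omega>M(2) V_in abM(2)] Q.dist_sym[OF V_in abM(2)] D_def by linarith
    also have "d' a b \<le> d (\<phi> u) q" unfolding a_def b_def by (intro contr_le in_M)
    also have "\<dots> \<le> d (\<phi> u) (\<eta> s) + d (\<eta> s) (\<eta> t) + d (\<eta> t) q"
      using G.dist_triangle[OF in_M(3,1,4)] G.dist_triangle[OF in_M(1,2,4)] by linarith
    also have "\<dots> \<le> 2 * r + \<theta>"
      using u(3) q(2) st(7) eD(3)[of s t] st(1-4) G.dist_sym[OF in_M(1,3)] by simp
    finally have "\<omega> - u \<le> r + \<theta> \<or> d' p b \<le> r + \<theta>" using \<theta> r0 by linarith
    then show thesis
    proof
      assume "\<omega> - u \<le> r + \<theta>"
      then have "d' p a \<le> r + \<theta>" using xa(2) Q.dist_sym[OF abM(1) \<omega>M(2)] by simp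
      moreover have "d' a (h (\<eta> s)) \<le> r"
        using contr_le[OF in_M(3,1)] u(3) G.dist_sym[OF in_M(1,3)] unfolding a_def by simp
      ultimately have "d' p (h (\<eta> s)) \<le> 2 * r + \<theta>"
        using Q.dist_triangle[OF \<omega>M(2) abM(1) h_in[OF in_M(1)]] by simp
      then show thesis using that ends(1) by blast
    next
      assume "d' p b \<le> r + \<theta>"
      moreover have "d' b (h (\<eta> t)) \<le> r"
        using contr_le[OF in_M(4,2)] q(2) G.dist_sym[OF in_M(2,4)] unfolding b_def by simp
      ultimately have "d' p (h (\<eta> t)) \<le> 2 * r + \<theta>"
        using Q.dist_triangle[OF \<omega>M(2) abM(2) h_in[OF in_M(2)]] by simp
      then show thesis using that ends(2) by blast
    qed
  qed
qed

text \<open>If \<open>C\<close> or \<open>B\<close> also meets \<open>V\<close>, the lift of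
  \<open>P\<close> closes up at \<open>c\<close> to a bigon or a triangle of genuine geodesics, and
  \<open>r\<close> suffices. Otherwise the broken lift is exchanged for a geodesic, at cost
  \<open>2 * r + \<theta>\<close>, before thinness applies.\<close>

lemma thin_through_V:
  assumes rips: "rips_hyperbolic M d r" and \<theta>: "0 < \<theta>" and xyz: "x \<in> M'" "y \<in> M'" "z \<in> M'"
    and P: "Q.seg x V P" and R: "Q.seg y V R" and sum: "d' x y = d' x V + d' V y"
    and B: "Q.seg y z B" and C: "Q.seg x z C" and p: "p \<in> P"
  shows "\<exists>q\<in>B \<union> C. d' p q \<le> 3 * r + \<theta>"
proof -
  have r0: "0 \<le> r" by (rule G.rips_nonneg[OF rips c_in])
  have M: "\<sigma> x \<in> M" "\<sigma> y \<in> M" "\<sigma> z \<in> M" using xyz \<sigma>_in by simp_all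
  obtain T where T: "G.seg (\<sigma> x) c T" "h ` T = P" using lift_seg_to_midpoint[OF P xyz(1)] .
  have pT: "p \<in> h ` T" using p T(2) by simp
  have one_step: ?thesis if "q \<in> B \<union> C" "d' p q \<le> r" for q
    using that r0 \<theta> by (intro bexI[of _ q]) simp_all
  show ?thesis
  proof (cases "V \<in> C")
    case True
    obtain C1 C2 where C12: "Q.seg x V C1" "Q.seg V z C2" "C = C1 \<union> C2"
      using Q.seg_split[OF C xyz(1,3) True] .
    obtain U where U: "G.seg (\<sigma> x) c U" "h ` U = C1" using lift_seg_to_midpoint[OF C12(1) xyz(1)] .
    obtain q where q: "q \<in> h ` {c} \<union> h ` U" "d' p q \<le> r"
      using rips_thin_image[OF rips T(1) G.seg_trivial[OF c_in] U(1) M(1) c_in c_in pT] .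
    moreover have "h c \<in> h ` U" using G.seg_ends[OF U(1) M(1) c_in] by blast
    ultimately have "q \<in> C" using U(2) C12(3) by auto
    then show ?thesis using one_step q(2) by blast
  next
    case False
    then obtain U where U: "G.seg (\<sigma> x) (\<sigma> z) U" "h ` U = C"
      using lift_seg_avoiding[OF C xyz(1,3)] by blast
    show ?thesis
    proof (cases "V \<in> B")
      case True
      obtain B1 B2 where B12: "Q.seg y V B1" "Q.seg V z B2" "B = B1 \<union> B2"
        using Q.seg_split[OF B xyz(2,3) True] .
      obtain W where W: "G.seg (\<sigma> z) c W" "h ` W = B2"
        using lift_seg_to_midpoint[OF Q.seg_sym[OF B12(2) V_in xyz(3)] xyz(3)] .
      obtain q where "q \<in> h ` W \<union> h ` U" "d' p q \<le> r"
        using rips_thin_image[OF rips T(1) G.seg_sym[OF W(1) M(3) c_in] U(1) M(1) c_in M(3) pT] .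
      then show ?thesis using one_step W(2) U(2) B12(3) by blast
    next
      case False
      then obtain W where W: "G.seg (\<sigma> y) (\<sigma> z) W" "h ` W = B"
        using lift_seg_avoiding[OF B xyz(2,3)] by blast
      obtain S where S: "G.seg (\<sigma> x) (\<sigma> y) S" using G.geodesic_exists M by blast
      obtain w where w: "w \<in> S" "d' p (h w) \<le> 2 * r + \<theta>"
        using near_lifted_geodesic[OF rips \<theta> xyz(1,2) P R sum S p] .
      have hw: "h w \<in> h ` S" using w(1) by blast
      obtain q where q: "q \<in> h ` W \<union> h ` U" "d' (h w) q \<le> r"
        using rips_thin_image[OF rips S W(1) U(1) M hw] .
      have "p \<in> M'" "h w \<in> M'" "q \<in> M'"
        using Q.seg_subset[OF P p] h_in[OF G.seg_subset[OF S w(1)]] q(1) W(2) U(2)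
          Q.seg_subset[OF B] Q.seg_subset[OF C] by blast+
      from dist_triangle_le[OF w(2) q(2) this, of "3 * r + \<theta>"] have "d' p q \<le> 3 * r + \<theta>" by simp
      then show ?thesis using q(1) W(2) U(2) by blast
    qed
  qed
qed

text \<open>The side \<open>B\<close> lifts to two geodesics that meet in \<open>c\<close>, so the
  triangle becomes a geodesic quadrilateral \<open>\<sigma> x\<close>, \<open>\<sigma> y\<close>,
  \<open>c\<close>, \<open>\<sigma> z\<close>. The diagonal \<open>T\<close> cuts it into two
  triangles.\<close>

lemma thin_one_other_through_V:
  assumes rips: "rips_hyperbolic M d r" and xyz: "x \<in> M'" "y \<in> M'" "z \<in> M'"
    and S: "G.seg (\<sigma> x) (\<sigma> y) S" and B: "Q.seg y z B" "V \<in> B" and C: "Q.seg x z C" "V \<notin> C"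
    and p: "p \<in> h ` S"
  shows "\<exists>q\<in>B \<union> C. d' p q \<le> 2 * r"
proof -
  have r0: "0 \<le> r" by (rule G.rips_nonneg[OF rips c_in])
  have M: "\<sigma> x \<in> M" "\<sigma> y \<in> M" "\<sigma> z \<in> M" using xyz \<sigma>_in by simp_all
  obtain B1 B2 where B12: "Q.seg y V B1" "Q.seg V z B2" "B = B1 \<union> B2"
    using Q.seg_split[OF B(1) xyz(2,3) B(2)] .
  obtain U where U: "G.seg (\<sigma> x) (\<sigma> z) U" "h ` U = C" using lift_seg_avoiding[OF C(1) xyz(1,3) C(2)] .
  obtain W where W: "G.seg (\<sigma> y) c W" "h ` W = B1" using lift_seg_to_midpoint[OF B12(1) xyz(2)] .
  obtain X where X: "G.seg (\<sigma> z) c X" "h ` X = B2"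
    using lift_seg_to_midpoint[OF Q.seg_sym[OF B12(2) V_in xyz(3)] xyz(3)] .
  obtain T where T: "G.seg (\<sigma> y) (\<sigma> z) T" using G.geodesic_exists M by blast
  obtain q where q: "q \<in> h ` T \<union> h ` U" "d' p q \<le> r"
    using rips_thin_image[OF rips S T U(1) M p] .
  show ?thesis
  proof (cases "q \<in> h ` T")
    case True
    obtain q' where q': "q' \<in> h ` X \<union> h ` W" "d' q q' \<le> r"
      using rips_thin_image[OF rips T X(1) W(1) M(2,3) c_in True] .
    have "p \<in> M'" "q \<in> M'" "q' \<in> M'"
      using p True q'(1) W(2) X(2) B12(3) h_in G.seg_subset[OF S] G.seg_subset[OF T]
        Q.seg_subset[OF B(1)] by blast+
    from dist_triangle_le[OF q(2) q'(2) this, of "2 * r"] have "d' p q' \<le> 2 * r" by simp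
    then show ?thesis using q'(1) W(2) X(2) B12(3) by blast
  next
    case False
    then show ?thesis using q U(2) r0 by (intro bexI[of _ q]) auto
  qed
qed

lemma rips_hyperbolic_contract:
  assumes rips: "rips_hyperbolic M d r" and \<theta>: "0 < \<theta>"
  shows "rips_hyperbolic M' d' (3 * r + \<theta>)"
  unfolding rips_hyperbolic_def in_nbhd_def
proof (intro ballI allI impI)
  fix x y z A B C p
  assume xyz: "x \<in> M'" "y \<in> M'" "z \<in> M'" and A: "Q.seg x y A" and B: "Q.seg y z B"
    and C': "Q.seg z x C" and p: "p \<in> A"
  have C: "Q.seg x z C" by (rule Q.seg_sym[OF C' xyz(3,1)])
  have r0: "0 \<le> r" by (rule G.rips_nonneg[OF rips c_in])
  have M: "\<sigma> x \<in> M" "\<sigma> y \<in> M" "\<sigma> z \<in> M" using xyz \<sigma>_in by simp_all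
  show "\<exists>q\<in>B \<union> C. d' p q \<le> 3 * r + \<theta>"
  proof (cases "V \<in> A")
    case True
    obtain P R where PR: "Q.seg x V P" "Q.seg V y R" "A = P \<union> R"
      using Q.seg_split[OF A xyz(1,2) True] .
    have R: "Q.seg y V R" by (rule Q.seg_sym[OF PR(2) V_in xyz(2)])
    have sum: "d' x y = d' x V + d' V y"
    proof -
      obtain \<gamma> where g: "Q.isometric_path \<gamma> (d' x y)" "\<gamma> 0 = x" "\<gamma> (d' x y) = y" "A = \<gamma> ` {0..d' x y}"
        using Q.segE[OF A xyz(1,2)] .
      then obtain s where s: "0 \<le> s" "s \<le> d' x y" "V = \<gamma> s" using True by auto
      have "d' (\<gamma> 0) (\<gamma> s) = s" "d' (\<gamma> s) (\<gamma> (d' x y)) = d' x y - s"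
        using Q.isometric_pathD(3)[OF g(1), of 0 s] Q.isometric_pathD(3)[OF g(1), of s "d' x y"] s
        by simp_all
      then show ?thesis unfolding g(2,3) s(3) by simp
    qed
    have sum': "d' y x = d' y V + d' V x"
      using sum Q.dist_sym xyz V_in by simp
    show ?thesis
    proof (cases "p \<in> P")
      case True
      then show ?thesis using thin_through_V[OF rips \<theta> xyz PR(1) R sum B C] by blast
    next
      case False
      then have "p \<in> R" using p PR(3) by blast
      from thin_through_V[OF rips \<theta> xyz(2,1,3) R PR(1) sum' C B this] show ?thesis by blast
    qed
  next
    case False
    obtain S where S: "G.seg (\<sigma> x) (\<sigma> y) S" "h ` S = A"
      using lift_seg_avoiding[OF A xyz(1,2) False] .
    have hp: "p \<in> h ` S" using p S(2) by simp
    have "\<exists>q\<in>B \<union> C. d' p q \<le> 2 * r"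
    \<comment> \<open>If both sides meet \<open>V\<close>, only the parts of \<open>B\<close> and
      \<open>C\<close> up to \<open>V\<close> are used: they and \<open>A\<close> lift to a triangle
      with vertices \<open>\<sigma> x\<close>, \<open>\<sigma> y\<close>, \<open>c\<close>.\<close>
    proof (cases "V \<in> B"; cases "V \<in> C")
      assume V: "V \<in> B" "V \<in> C"
      obtain B1 B2 where B12: "Q.seg y V B1" "Q.seg V z B2" "B = B1 \<union> B2"
        using Q.seg_split[OF B xyz(2,3) V(1)] .
      obtain C1 C2 where C12: "Q.seg x V C1" "Q.seg V z C2" "C = C1 \<union> C2"
        using Q.seg_split[OF C xyz(1,3) V(2)] .
      obtain W where W: "G.seg (\<sigma> y) c W" "h ` W = B1" using lift_seg_to_midpoint[OF B12(1) xyz(2)] .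
      obtain U where U: "G.seg (\<sigma> x) c U" "h ` U = C1" using lift_seg_to_midpoint[OF C12(1) xyz(1)] .
      obtain q where "q \<in> h ` W \<union> h ` U" "d' p q \<le> r"
        using rips_thin_image[OF rips S(1) W(1) U(1) M(1,2) c_in hp] .
      then show ?thesis using W(2) U(2) B12(3) C12(3) r0 by (intro bexI[of _ q]) auto
    next
      assume "V \<in> B" "V \<notin> C"
      then show ?thesis using thin_one_other_through_V[OF rips xyz S(1) B _ C _ hp] by simp
    next
      assume "V \<notin> B" "V \<in> C"
      then show ?thesis
        using thin_one_other_through_V[OF rips xyz(2,1,3) G.seg_sym[OF S(1) M(1,2)] C _ B _ hp]
        by (simp add: Un_commute)
    next
      assume V: "V \<notin> B" "V \<notin> C"
      obtain W where W: "G.seg (\<sigma> y) (\<sigma> z) W" "h ` W = B" using lift_seg_avoiding[OF B xyz(2,3) V(1)] .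
      obtain U where U: "G.seg (\<sigma> x) (\<sigma> z) U" "h ` U = C" using lift_seg_avoiding[OF C xyz(1,3) V(2)] .
      obtain q where "q \<in> h ` W \<union> h ` U" "d' p q \<le> r"
        using rips_thin_image[OF rips S(1) W(1) U(1) M hp] .
      then show ?thesis using W(2) U(2) r0 by (intro bexI[of _ q]) auto
    qed
    then obtain q where "q \<in> B \<union> C" "d' p q \<le> 2 * r" by blast
    then show ?thesis using r0 \<theta> by (intro bexI[of _ q]) simp_all
  qed
qed

end

section \<open>Paths in graphs\<close>

lemma edge_point_in_points:
  "wf_digraph G \<Longrightarrow> e \<in> arcs G \<Longrightarrow> t \<in> {0..1} \<Longrightarrow> edge_point G e t \<in> graph_points G"
  unfolding edge_point_def graph_points_def by (auto simp: wf_digraph.tail_in_verts wf_digraph.head_in_verts)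

lemma path_in_points:
  assumes "wf_digraph G" "path_of_length G p q L"
  shows "p \<in> graph_points G" "q \<in> graph_points G"
  using assms(2) by (induction) (use edge_point_in_points[OF assms(1)] in auto)

lemma path_nonneg: "path_of_length G p q L \<Longrightarrow> 0 \<le> L"
  by (induction rule: path_of_length.induct) auto

lemma path_trans:
  assumes "path_of_length G q r L'" "path_of_length G p q L"
  shows "path_of_length G p r (L + L')"
  using assms
proof (induction rule: path_of_length.induct)
  case (extend q e s L' t)
  from path_of_length.extend[OF extend.IH[OF extend.prems] extend.hyps(2-4)]
  show ?case by (simp add: add.assoc)
qed simp

lemma path_edge:
  assumes "wf_digraph G" "e \<in> arcs G" "s \<in> {0..1}" "t \<in> {0..1}"
  shows "path_of_length G (edge_point G e s) (edge_point G e t) \<bar>s - t\<bar>"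
  using path_of_length.extend[OF path_of_length.trivial[OF edge_point_in_points[OF assms(1-3)]] assms(2-4)]
  by simp

lemma path_sym:
  assumes "wf_digraph G" "path_of_length G p q L"
  shows "path_of_length G q p L"
  using assms(2)
proof (induction rule: path_of_length.induct)
  case (extend p e s L t)
  have "path_of_length G (edge_point G e t) (edge_point G e s) \<bar>t - s\<bar>"
    using path_edge[OF assms(1)] extend by blast
  from path_trans[OF extend.IH this] show ?case by (simp add: abs_minus_commute add.commute)
qed (rule path_of_length.trivial)

lemma path_zero: "path_of_length G p q L \<Longrightarrow> L = 0 \<Longrightarrow> p = q"
proof (induction rule: path_of_length.induct)
  case (extend p e s L t)
  then have "L = 0" "s = t" using path_nonneg[OF extend(1)] by auto
  then show ?case using extend by simp
qed simp

text \<open>The source of lower bounds for graph distances: a potential only has to be tested on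
  single edges.\<close>

lemma path_lipschitz_bound:
  assumes "path_of_length G p q L"
    "\<And>e s t. e \<in> arcs G \<Longrightarrow> s \<in> {0..1} \<Longrightarrow> t \<in> {0..1} \<Longrightarrow>
      F (edge_point G e t) \<le> F (edge_point G e s) + \<bar>s - t\<bar>"
  shows "F q \<le> F p + L"
  using assms(1)
proof (induction rule: path_of_length.induct)
  case (extend p e s L t)
  then show ?case using assms(2)[of e s t] by simp
qed simp

text \<open>Subpaths are provided as paths of the same graph, not merely as distance bounds. This
  keeps the result usable in the graph without \<open>e\<close>, which may be disconnected.\<close>

lemma path_parametrization:
  assumes wf: "wf_digraph G" and "path_of_length G p q L"
  shows "\<exists>\<gamma>. \<gamma> 0 = p \<and> \<gamma> L = q \<and>
    (\<forall>u v. 0 \<le> u \<and> u \<le> v \<and> v \<le> L \<longrightarrow> path_of_length G (\<gamma> u) (\<gamma> v) (v - u))"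
  using assms(2)
proof (induction rule: path_of_length.induct)
  case (trivial p)
  have "path_of_length G p p (v - u)" if "0 \<le> u" "u \<le> v" "v \<le> 0" for u v
  proof -
    have "v - u = 0" using that by simp
    then show ?thesis using path_of_length.trivial[OF trivial] by simp
  qed
  then show ?case by (intro exI[of _ "\<lambda>_. p"]) blast
next
  case (extend p e s L t)
  then obtain \<gamma> where g: "\<gamma> 0 = p" "\<gamma> L = edge_point G e s"
      "\<And>u v. 0 \<le> u \<Longrightarrow> u \<le> v \<Longrightarrow> v \<le> L \<Longrightarrow> path_of_length G (\<gamma> u) (\<gamma> v) (v - u)"
    by blast
  have L: "0 \<le> L" by (rule path_nonneg[OF extend(1)])
  \<comment> \<open>The coordinate moves from \<open>s\<close> towards \<open>t\<close> at unit
    speed, starting at time \<open>L\<close>.\<close>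
  define c where "c u = s + (u - L) * sgn (t - s)" for u
  have c: "c u \<in> {0..1}" "\<bar>s - c u\<bar> = u - L" if "L \<le> u" "u \<le> L + \<bar>s - t\<bar>" for u
    using that extend(3,4) unfolding c_def by (auto simp: sgn_if split: if_splits)
  define \<phi> where "\<phi> u = (if u \<le> L then \<gamma> u else edge_point G e (c u))" for u
  have "path_of_length G (\<phi> u) (\<phi> v) (v - u)" if "0 \<le> u" "u \<le> v" "v \<le> L + \<bar>s - t\<bar>" for u v
  proof -
    consider "v \<le> L" | "u \<le> L" "L < v" | "L < u" by linarith
    then show ?thesis
    proof cases
      case 1 then show ?thesis using g(3)[of u v] that by (simp add: \<phi>_def)
    next
      case 2
      have "path_of_length G (\<gamma> u) (edge_point G e s) (L - u)" using g(3)[of u L] g(2) that 2 by simp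
      from path_of_length.extend[OF this extend(2,3) c(1), of v]
      show ?thesis using c(2)[of v] 2 that by (simp add: \<phi>_def)
    next
      case 3
      have "\<bar>c u - c v\<bar> = v - u"
        using that 3 unfolding c_def by (auto simp: sgn_if split: if_splits)
      then show ?thesis using path_edge[OF wf extend(2) c(1) c(1), of u v] 3 that by (simp add: \<phi>_def)
    qed
  qed
  moreover have "\<phi> 0 = p" using g(1) L by (simp add: \<phi>_def)
  moreover have "\<phi> (L + \<bar>s - t\<bar>) = edge_point G e t"
  proof (cases "s = t")
    case True then show ?thesis using g(2) by (simp add: \<phi>_def)
  next
    case False
    then have "c (L + \<bar>s - t\<bar>) = t" unfolding c_def by (auto simp: sgn_if)
    then show ?thesis using False by (simp add: \<phi>_def)
  qed
  ultimately show ?case by blast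
qed

text \<open>The infimum of path lengths is attained because a path not contained in one edge can be
  shortened so that it consists of an integer number of full edges and of two partial ones, each
  running from an end point to a vertex of its edge.\<close>

definition vertex_exit :: "('v, 'e) pre_digraph \<Rightarrow> ('v, 'e) gpoint \<Rightarrow> 'v \<Rightarrow> real \<Rightarrow> bool" where
  "vertex_exit G p v a \<longleftrightarrow> p = Vertex v \<and> v \<in> verts G \<and> a = 0 \<or>
     (\<exists>e t. p = Inner e t \<and> e \<in> arcs G \<and> 0 < t \<and> t < 1 \<and>
       (v = tail G e \<and> a = t \<or> v = head G e \<and> a = 1 - t))"

lemma vertex_exit_edge_point:
  assumes "wf_digraph G" "e \<in> arcs G" "t \<in> {0..1}"
  shows "t < 1 \<Longrightarrow> vertex_exit G (edge_point G e t) (tail G e) t"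
    and "0 < t \<Longrightarrow> vertex_exit G (edge_point G e t) (head G e) (1 - t)"
  using assms wf_digraph.tail_in_verts[OF assms(1,2)] wf_digraph.head_in_verts[OF assms(1,2)]
  unfolding vertex_exit_def edge_point_def by auto

lemma vertex_exit_edge_pointD:
  assumes "vertex_exit G (edge_point G e t) v a" "t \<in> {0..1}"
  shows "v = tail G e \<and> a = t \<or> v = head G e \<and> a = 1 - t"
  using assms unfolding vertex_exit_def edge_point_def by (auto split: if_splits)

lemma vertex_exit_path:
  assumes wf: "wf_digraph G" and "vertex_exit G p v a"
  shows "path_of_length G p (Vertex v) a"
  using assms(2) unfolding vertex_exit_def
proof (elim disjE exE conjE)
  assume "p = Vertex v" "v \<in> verts G" "a = 0"
  then show ?thesis by (auto simp: graph_points_def intro: path_of_length.trivial)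
next
  fix e t assume *: "p = Inner e t" "e \<in> arcs G" "0 < t" "t < 1" "v = tail G e" "a = t"
  then show ?thesis using path_edge[OF wf *(2), of t 0] by (simp add: edge_point_def)
next
  fix e t assume *: "p = Inner e t" "e \<in> arcs G" "0 < t" "t < 1" "v = head G e" "a = 1 - t"
  then show ?thesis using path_edge[OF wf *(2), of t 1] by (simp add: edge_point_def)
qed

text \<open>While the point moves within an edge it keeps its exit vertex. The exception is arrival
  at the opposite vertex, where the old partial edge is completed to a full one,
  \<open>m = 1\<close>, and the new partial edge is empty.\<close>

lemma vertex_exit_along_edge:
  fixes s t b :: real
  assumes wf: "wf_digraph G" and e: "e \<in> arcs G" and st: "s \<in> {0..1}" "t \<in> {0..1}"
    and x: "vertex_exit G (edge_point G e s) v b"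
  obtains v' and b' :: real and m :: nat where "vertex_exit G (edge_point G e t) v' b'"
    "path_of_length G (Vertex v) (Vertex v') m" "m + b' \<le> b + \<bar>s - t\<bar>"
proof -
  have tv: "path_of_length G (Vertex v) (Vertex v) (real 0)" if "v \<in> verts G" for v
    using that path_of_length.trivial[of "Vertex v" G] by (simp add: graph_points_def)
  have th: "path_of_length G (Vertex (tail G e)) (Vertex (head G e)) (real 1)"
    using path_edge[OF wf e, of 0 1] by (simp add: edge_point_def)
  note vt = wf_digraph.tail_in_verts[OF wf e] and vh = wf_digraph.head_in_verts[OF wf e]
  consider "v = tail G e" "b = s" "t < 1" | "v = tail G e" "b = s" "t = 1"
    | "v = head G e" "b = 1 - s" "0 < t" | "v = head G e" "b = 1 - s" "t = 0"
    using vertex_exit_edge_pointD[OF x st(1)] st by fastforce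
  then show thesis
  proof cases
    case 1
    show thesis
      by (rule that[OF vertex_exit_edge_point(1)[OF wf e st(2) 1(3)], of 0])
        (use 1 tv[OF vt] in simp_all)
  next
    case 2
    have "vertex_exit G (edge_point G e t) (head G e) 0"
      using vertex_exit_edge_point(2)[OF wf e st(2)] 2 by simp
    then show thesis by (rule that[of _ _ 1]) (use 2 th st in simp_all)
  next
    case 3
    show thesis
      by (rule that[OF vertex_exit_edge_point(2)[OF wf e st(2) 3(3)], of 0])
        (use 3 tv[OF vh] in simp_all)
  next
    case 4
    have "vertex_exit G (edge_point G e t) (tail G e) 0"
      using vertex_exit_edge_point(1)[OF wf e st(2)] 4 by simp
    then show thesis by (rule that[of _ _ 1]) (use 4 path_sym[OF wf th] st in simp_all)
  qed
qed

text \<open>The induction keeps the form \<open>?same\<close> until a vertex is reached and the form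
  \<open>?far\<close> from then on; \<open>vertex_exit_along_edge\<close> performs both the
  transition and the later steps.\<close>

lemma path_reduce:
  assumes wf: "wf_digraph G" and "path_of_length G p q L"
  shows "(\<exists>e\<in>arcs G. \<exists>s\<in>{0..1}. \<exists>t\<in>{0..1}. p = edge_point G e s \<and> q = edge_point G e t \<and> \<bar>s - t\<bar> \<le> L) \<or>
    (\<exists>u a v b. \<exists>n::nat. vertex_exit G p u a \<and> vertex_exit G q v b \<and>
      path_of_length G (Vertex u) (Vertex v) n \<and> a + n + b \<le> L)"
    (is "?same p q L \<or> ?far p q L")
  using assms(2)
proof (induction rule: path_of_length.induct)
  case (trivial p)
  show ?case
  proof (cases p)
    case (Vertex v)
    then have "v \<in> verts G" using trivial by (auto simp: graph_points_def)
    then have "?far p p 0"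
      using Vertex path_of_length.trivial[OF trivial]
      by (intro exI[of _ v] exI[of _ 0] conjI) (simp_all add: vertex_exit_def)
    then show ?thesis ..
  next
    case (Inner e t)
    then have "e \<in> arcs G" "0 < t" "t < 1" using trivial by (auto simp: graph_points_def)
    then have "?same p p 0" using Inner
      by (intro bexI[of _ e] bexI[of _ t]) (simp_all add: edge_point_def)
    then show ?thesis ..
  qed
next
  case (extend p e s L t)
  have step: "?far p (edge_point G e t) (L + \<bar>s - t\<bar>)" if "?far p (edge_point G e s) L"
  proof -
    from that obtain u a v b and n :: nat where *: "vertex_exit G p u a"
        "vertex_exit G (edge_point G e s) v b" "path_of_length G (Vertex u) (Vertex v) n" "a + n + b \<le> L"
      by blast
    obtain v' and b' :: real and m :: nat where **: "vertex_exit G (edge_point G e t) v' b'"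
        "path_of_length G (Vertex v) (Vertex v') m" "m + b' \<le> b + \<bar>s - t\<bar>"
      using vertex_exit_along_edge[OF wf extend(2-4) *(2)] .
    have "path_of_length G (Vertex u) (Vertex v') (real (n + m))"
      using path_trans[OF **(2) *(3)] by simp
    moreover have "a + real (n + m) + b' \<le> L + \<bar>s - t\<bar>" using *(4) **(3) by simp
    ultimately show ?thesis using *(1) **(1) by blast
  qed
  from extend.IH show ?case
  proof
    assume "?far p (edge_point G e s) L"
    then show ?case using step by blast
  next
    assume "?same p (edge_point G e s) L"
    then obtain e0 s0 t0 where *: "e0 \<in> arcs G" "s0 \<in> {0..1}" "t0 \<in> {0..1}" "p = edge_point G e0 s0"
        "edge_point G e s = edge_point G e0 t0" "\<bar>s0 - t0\<bar> \<le> L"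
      by blast
    show ?case
    \<comment> \<open>An inner point determines its edge, so the path has not left it. At a vertex
      the next edge may be a different one.\<close>
    proof (cases "edge_point G e s")
      case (Inner e1 s1)
      then have "e0 = e" "t0 = s" using *(5) unfolding edge_point_def by (auto split: if_splits)
      then have "?same p (edge_point G e t) (L + \<bar>s - t\<bar>)"
        using * extend by (intro bexI[of _ e] bexI[of _ s0] bexI[of _ t]) auto
      then show ?thesis ..
    next
      case (Vertex v)
      have "edge_point G e s \<in> graph_points G" by (rule edge_point_in_points[OF wf extend(2,3)])
      then have x: "vertex_exit G (edge_point G e s) v 0"
        using Vertex by (auto simp: vertex_exit_def graph_points_def)
      then have "vertex_exit G (edge_point G e0 t0) v 0" using *(5) by simp
      then obtain u and a :: real and m :: nat where **: "vertex_exit G p u a"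
          "path_of_length G (Vertex v) (Vertex u) m" "m + a \<le> 0 + \<bar>t0 - s0\<bar>"
        using vertex_exit_along_edge[OF wf *(1,3,2), of v 0] *(4) by metis
      then have "?far p (edge_point G e s) L"
        using x path_sym[OF wf **(2)] *(6)
        by (intro exI[of _ u] exI[of _ a] exI[of _ v] exI[of _ 0] exI[of _ m]) auto
      then show ?thesis using step by blast
    qed
  qed
qed

lemma minimal_path_exists:
  assumes wf: "wf_digraph G" and p: "path_of_length G p q L"
  obtains L0 where "path_of_length G p q L0" "\<And>L'. path_of_length G p q L' \<Longrightarrow> L0 \<le> L'"
proof -
  define C where "C p = (case p of Vertex _ \<Rightarrow> {0, 1} | Inner _ t \<Rightarrow> {t, 1 - t})"
    for p :: "('a, 'b) gpoint"
  have finC: "finite (C p)" for p by (cases p) (auto simp: C_def)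
  have C_edge: "s \<in> C (edge_point G e s)" for e s by (auto simp: C_def edge_point_def)
  have C_exit: "a \<in> C p" if "vertex_exit G p v a" for p v a
    using that by (auto simp: C_def vertex_exit_def)
  have exit_nonneg: "0 \<le> a" if "vertex_exit G p v a" for p v a
    using that by (auto simp: vertex_exit_def)
  define N where "N = nat \<lfloor>L\<rfloor>"
  \<comment> \<open>Lengths of reduced paths are \<open>\<bar>a - b\<bar>\<close> within one edge or
    \<open>a + n + b\<close> otherwise. The partial lengths take finitely many values, and
    \<open>n \<le> N\<close> because only paths no longer than \<open>L\<close> compete.\<close>
  define K where "K = {l. path_of_length G p q l} \<inter>
    ((\<lambda>(a, b). \<bar>a - b\<bar>) ` (C p \<times> C q) \<union> (\<lambda>(a, n, b). a + real n + b) ` (C p \<times> {..N} \<times> C q))"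
  have finK: "finite K" unfolding K_def using finC by blast
  have red: "\<exists>l\<in>K. l \<le> L'" if L': "path_of_length G p q L'" "L' \<le> L" for L'
    using path_reduce[OF wf L'(1)]
  proof
    assume "\<exists>e\<in>arcs G. \<exists>s\<in>{0..1}. \<exists>t\<in>{0..1}. p = edge_point G e s \<and> q = edge_point G e t \<and> \<bar>s - t\<bar> \<le> L'"
    then obtain e s t where *: "e \<in> arcs G" "s \<in> {0..1}" "t \<in> {0..1}" "p = edge_point G e s"
        "q = edge_point G e t" "\<bar>s - t\<bar> \<le> L'" by blast
    have "\<bar>s - t\<bar> \<in> K"
      unfolding K_def using path_edge[OF wf *(1-3)] C_edge[of s e] C_edge[of t e] *(4,5) by force
    then show ?thesis using *(6) by blast
  next
    assume "\<exists>u a v b. \<exists>n::nat. vertex_exit G p u a \<and> vertex_exit G q v b \<and>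
      path_of_length G (Vertex u) (Vertex v) n \<and> a + n + b \<le> L'"
    then obtain u a v b and n :: nat where *: "vertex_exit G p u a" "vertex_exit G q v b"
        "path_of_length G (Vertex u) (Vertex v) n" "a + n + b \<le> L'" by blast
    have "real n \<le> L" using *(4) L'(2) exit_nonneg[OF *(1)] exit_nonneg[OF *(2)] by linarith
    then have "n \<le> N" unfolding N_def by (simp add: le_nat_floor)
    moreover have "path_of_length G p q (a + n + b)"
      using path_trans[OF path_trans[OF path_sym[OF wf vertex_exit_path[OF wf *(2)]] *(3)]
          vertex_exit_path[OF wf *(1)]] by (simp add: add.assoc)
    ultimately have "a + n + b \<in> K"
      unfolding K_def using C_exit[OF *(1)] C_exit[OF *(2)]
      by (intro IntI UnI2 image_eqI[of _ _ "(a, n, b)"]) simp_all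
    then show ?thesis using *(4) by blast
  qed
  have ne: "K \<noteq> {}" using red[OF p] by blast
  have le: "Min K \<le> L'" if "path_of_length G p q L'" for L'
  proof (cases "L' \<le> L")
    case True then show ?thesis using red[OF that True] Min_le[OF finK] by (meson order_trans)
  next
    case False
    have "Min K \<le> L" using red[OF p] Min_le[OF finK] by (meson order_refl order_trans)
    then show ?thesis using False by simp
  qed
  have "path_of_length G p q (Min K)" using Min_in[OF finK ne] by (simp add: K_def)
  then show thesis using le by (rule that)
qed

section \<open>Graphs as geodesic metric spaces\<close>

lemma graph_dist_le:
  assumes "path_of_length G p q L" shows "graph_dist G p q \<le> L"
  unfolding graph_dist_def
  using assms by (intro cInf_lower) (auto intro!: bdd_belowI[of _ 0] dest: path_nonneg)

lemma path_graph_dist: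
  assumes "wf_digraph G" "path_of_length G p q L"
  shows "path_of_length G p q (graph_dist G p q)"
proof -
  obtain L0 where L0: "path_of_length G p q L0" "\<And>L'. path_of_length G p q L' \<Longrightarrow> L0 \<le> L'"
    using minimal_path_exists[OF assms] by blast
  then have "graph_dist G p q = L0" unfolding graph_dist_def by (intro cInf_eq_minimum) auto
  with L0(1) show ?thesis by simp
qed

text \<open>This form of connectedness passes to the contracted graph simply by projecting
  paths.\<close>

definition path_connected_graph :: "('v, 'e) pre_digraph \<Rightarrow> bool" where
  "path_connected_graph G \<longleftrightarrow> wf_digraph G \<and>
     (\<forall>p\<in>graph_points G. \<forall>q\<in>graph_points G. \<exists>L. path_of_length G p q L)"

lemma path_graph_dist':
  "path_connected_graph G \<Longrightarrow> p \<in> graph_points G \<Longrightarrow> q \<in> graph_points G \<Longrightarrow>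
    path_of_length G p q (graph_dist G p q)"
  unfolding path_connected_graph_def using path_graph_dist by blast

lemma graph_dist_edge_le:
  assumes "wf_digraph G" "e \<in> arcs G" "s \<in> {0..1}" "t \<in> {0..1}"
  shows "graph_dist G (edge_point G e s) (edge_point G e t) \<le> \<bar>s - t\<bar>"
  by (rule graph_dist_le[OF path_edge[OF assms]])

text \<open>As the infimum is attained, the metric axioms follow from operations on paths, and a
  minimal path parametrized by arc length is a geodesic.\<close>

lemma geodesic_metric_graph:
  assumes "path_connected_graph G"
  shows "geodesic_metric (graph_points G) (graph_dist G)"
proof -
  have wf: "wf_digraph G" using assms by (simp add: path_connected_graph_def)
  note pd = path_graph_dist'[OF assms]
  interpret metric_on "graph_points G" "graph_dist G"
  proof
    fix x y z assume x: "x \<in> graph_points G"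
    show "graph_dist G x x = 0"
      using graph_dist_le[OF path_of_length.trivial[OF x]] path_nonneg[OF pd[OF x x]] by simp
    assume y: "y \<in> graph_points G"
    show "graph_dist G x y = graph_dist G y x"
      using graph_dist_le[OF path_sym[OF wf pd[OF x y]]] graph_dist_le[OF path_sym[OF wf pd[OF y x]]]
      by simp
    show "x = y" if "graph_dist G x y = 0" using path_zero[OF pd[OF x y] that] .
    assume z: "z \<in> graph_points G"
    show "graph_dist G x z \<le> graph_dist G x y + graph_dist G y z"
      by (rule graph_dist_le[OF path_trans[OF pd[OF y z] pd[OF x y]]])
  qed
  show ?thesis
  proof
    fix x y assume xy: "x \<in> graph_points G" "y \<in> graph_points G"
    define L where "L = graph_dist G x y"
    obtain \<gamma> where g: "\<gamma> 0 = x" "\<gamma> L = y"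
        "\<forall>u v. 0 \<le> u \<and> u \<le> v \<and> v \<le> L \<longrightarrow> path_of_length G (\<gamma> u) (\<gamma> v) (v - u)"
      using path_parametrization[OF wf pd[OF xy]] unfolding L_def by blast
    have "lipschitz_path \<gamma> L"
    proof (rule lipschitz_pathI)
      show "0 \<le> L" unfolding L_def by (rule dist_nonneg[OF xy])
      show "\<gamma> s \<in> graph_points G" if "0 \<le> s" "s \<le> L" for s
        using path_in_points(1)[OF wf, of "\<gamma> s" "\<gamma> s"] g(3) that by blast
      show "graph_dist G (\<gamma> s) (\<gamma> t) \<le> t - s" if "0 \<le> s" "s \<le> t" "t \<le> L" for s t
        using graph_dist_le g(3) that by blast
    qed
    then have "seg x y (\<gamma> ` {0..L})" by (rule segI) (use g in \<open>simp_all add: L_def[symmetric]\<close>)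
    then show "\<exists>S. seg x y S" by blast
  qed
qed

lemma nonsimple_graph_path_connected:
  assumes "nonsimple_graph G" shows "path_connected_graph G"
proof -
  have wf: "wf_digraph G" and con: "Digraph_Component.connected G"
    using assms by (auto simp: nonsimple_graph_def)
  have vv: "\<exists>L. path_of_length G (Vertex u) (Vertex v) L" if uv: "u \<in> verts G" "v \<in> verts G" for u v
  proof -
    have "u \<rightarrow>\<^sup>*\<^bsub>mk_symmetric G\<^esub> v" using con uv unfolding connected_def strongly_connected_def by simp
    then have "(u, v) \<in> rtrancl_on (verts G) (parcs (mk_symmetric G))"
      unfolding reachable_def by simp
    then show ?thesis
    proof (induction rule: rtrancl_on_induct)
      case base
      then show ?case using path_of_length.trivial[of "Vertex u" G] uv by (auto simp: graph_points_def)
    next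
      case (step v w)
      then obtain L where L: "path_of_length G (Vertex u) (Vertex v) L" by blast
      obtain e where e: "e \<in> arcs G" "v = tail G e \<and> w = head G e \<or> v = head G e \<and> w = tail G e"
        using step(2) by (auto simp: parcs_mk_symmetric)
      have *: "path_of_length G (Vertex (tail G e)) (Vertex (head G e)) 1"
        using path_edge[OF wf e(1), of 0 1] by (simp add: edge_point_def)
      have "path_of_length G (Vertex v) (Vertex w) 1" using e(2) * path_sym[OF wf *] by auto
      then show ?case using path_trans[OF _ L] by blast
    qed
  qed
  have exit: "\<exists>v\<in>verts G. \<exists>L. path_of_length G p (Vertex v) L" if "p \<in> graph_points G" for p
  proof (cases p)
    case (Vertex v)
    then show ?thesis using vv that by (auto simp: graph_points_def)
  next
    case (Inner e t)
    then have *: "e \<in> arcs G" "0 < t" "t < 1" using that by (auto simp: graph_points_def)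
    then have "path_of_length G p (Vertex (tail G e)) \<bar>t - 0\<bar>"
      using path_edge[OF wf *(1), of t 0] Inner by (simp add: edge_point_def)
    then show ?thesis using wf_digraph.tail_in_verts[OF wf *(1)] by blast
  qed
  have "\<exists>L. path_of_length G p q L" if pq: "p \<in> graph_points G" "q \<in> graph_points G" for p q
  proof -
    obtain u K where u: "u \<in> verts G" "path_of_length G p (Vertex u) K" using exit[OF pq(1)] by blast
    obtain v L where v: "v \<in> verts G" "path_of_length G q (Vertex v) L" using exit[OF pq(2)] by blast
    obtain N where "path_of_length G (Vertex u) (Vertex v) N" using vv[OF u(1) v(1)] by blast
    then show ?thesis using path_trans[OF path_trans[OF path_sym[OF wf v(2)]] u(2)] by blast
  qed
  then show ?thesis using wf by (simp add: path_connected_graph_def)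
qed

section \<open>Edge contraction\<close>

definition contract_point :: "('v, 'e) pre_digraph \<Rightarrow> 'e \<Rightarrow> ('v, 'e) gpoint \<Rightarrow> ('v, 'e) gpoint" where
  "contract_point G e p = (case p of Vertex v \<Rightarrow> Vertex (merge_ends G e v)
     | Inner e' t \<Rightarrow> if e' = e then Vertex (tail G e) else Inner e' t)"

locale edge_contraction =
  fixes G :: "('v, 'e) pre_digraph" and e :: 'e
  assumes graph: "path_connected_graph G" and e: "e \<in> arcs G"
begin

abbreviation "G' \<equiv> contract_edge G e"
abbreviation "G0 \<equiv> pre_digraph.del_arc G e"
abbreviation "h \<equiv> contract_point G e"
abbreviation "d \<equiv> graph_dist G"
abbreviation "d' \<equiv> graph_dist G'"

definition V :: "('v, 'e) gpoint" where "V = Vertex (tail G e)"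

lemma wf: "wf_digraph G"
  using graph by (simp add: path_connected_graph_def)

lemma arcs_contract [simp]: "arcs G' = arcs G - {e}"
  by (simp add: contract_edge_def)

lemma wf_contract: "wf_digraph G'"
  using wf by (auto simp: contract_edge_def wf_digraph_def)

lemma wf_delete: "wf_digraph G0"
  using wf by (auto simp: wf_digraph_def pre_digraph.del_arc_def)

lemma arcs_delete [simp]: "arcs G0 = arcs G - {e}"
  by (simp add: pre_digraph.del_arc_def)

lemma edge_point_delete [simp]: "edge_point G0 = edge_point G"
  by (intro ext) (simp add: edge_point_def pre_digraph.del_arc_def)

lemma graph_points_delete: "graph_points G0 = graph_points G - {Inner e t | t. True}"
  by (auto simp: graph_points_def pre_digraph.del_arc_def)

lemma merge_ends_tail [simp]: "merge_ends G e (tail G e) = tail G e"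
  by (simp add: merge_ends_def)

lemma merge_ends_head [simp]: "merge_ends G e (head G e) = tail G e"
  by (simp add: merge_ends_def)

lemma h_edge [simp]: "h (edge_point G e t) = V"
  by (simp add: contract_point_def edge_point_def V_def)

lemma h_ends [simp]: "h (Vertex (tail G e)) = V" "h (Vertex (head G e)) = V"
  by (simp_all add: contract_point_def V_def)

lemma h_other_edge: "e' \<noteq> e \<Longrightarrow> h (edge_point G e' t) = edge_point G' e' t"
  by (simp add: contract_point_def edge_point_def contract_edge_def)

lemma h_in: "x \<in> graph_points G \<Longrightarrow> h x \<in> graph_points G'"
proof (cases x)
  case (Inner e' t)
  assume "x \<in> graph_points G"
  moreover have "Vertex (tail G e) \<in> graph_points G'"
    using wf_digraph.tail_in_verts[OF wf e]
    by (auto simp: graph_points_def contract_edge_def intro!: image_eqI[of _ _ "tail G e"])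
  ultimately show ?thesis
    using Inner by (cases "e' = e") (auto simp: graph_points_def contract_point_def)
qed (auto simp: graph_points_def contract_point_def contract_edge_def)

lemma V_in: "V \<in> graph_points G'"
  using h_in[of "Vertex (tail G e)"] wf_digraph.tail_in_verts[OF wf e] by (simp add: graph_points_def)

lemma h_inj: "h x = h y \<Longrightarrow> x = y \<or> h x = V"
  by (cases x; cases y)
    (auto simp: contract_point_def V_def merge_ends_def split: if_splits)

lemma fibre_V:
  assumes "h x = V" "x \<in> graph_points G"
  obtains t where "t \<in> {0..1}" "x = edge_point G e t"
proof (cases x)
  case (Vertex v)
  then have "v = tail G e \<or> v = head G e"
    using assms by (auto simp: contract_point_def V_def merge_ends_def split: if_splits)
  then show thesis using that[of 0] that[of 1] Vertex by (auto simp: edge_point_def)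
next
  case (Inner e' t)
  then have "e' = e" "0 < t" "t < 1"
    using assms by (auto simp: contract_point_def V_def graph_points_def split: if_splits)
  then show thesis using that[of t] Inner by (simp add: edge_point_def)
qed

lemma fibre_V_delete: "h x = V \<Longrightarrow> x \<in> graph_points G0 \<Longrightarrow> x \<in> {Vertex (tail G e), Vertex (head G e)}"
  by (cases x)
    (auto simp: graph_points_delete contract_point_def V_def merge_ends_def split: if_splits)

text \<open>The merged vertex reuses the name \<open>tail G e\<close>, so the other points of
  \<open>G'\<close> are literally points of \<open>G\<close>, and \<open>\<sigma>\<close> can be the
  identity there.\<close>

lemma other_points:
  assumes "x \<in> graph_points G'" "x \<noteq> V"
  shows "x \<in> graph_points G0" "x \<in> graph_points G" "h x = x"
proof -
  have "x \<in> graph_points G0 \<and> h x = x"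
  proof (cases x)
    case (Vertex v)
    then obtain w where w: "w \<in> verts G" "v = merge_ends G e w"
      using assms by (auto simp: graph_points_def contract_edge_def)
    moreover have "w \<noteq> head G e" using w Vertex assms(2) by (auto simp: V_def)
    ultimately show ?thesis
      using Vertex by (auto simp: graph_points_def contract_point_def merge_ends_def pre_digraph.del_arc_def)
  next
    case (Inner e' t)
    then show ?thesis
      using assms by (auto simp: graph_points_def contract_point_def pre_digraph.del_arc_def)
  qed
  then show "x \<in> graph_points G0" "x \<in> graph_points G" "h x = x"
    by (simp_all add: graph_points_delete)
qed

section \<open>Projecting and lifting paths\<close>

lemma path_delete_imp: "path_of_length G0 x y L \<Longrightarrow> path_of_length G x y L"
proof (induction rule: path_of_length.induct)
  case (trivial p)
  then show ?case by (intro path_of_length.trivial) (simp add: graph_points_delete)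
next
  case (extend p e' s L t)
  then show ?case using path_of_length.extend[of G p e' s L t] by simp
qed

lemma path_project: "path_of_length G x y L \<Longrightarrow> \<exists>L'\<le>L. path_of_length G' (h x) (h y) L'"
proof (induction rule: path_of_length.induct)
  case (trivial p)
  then show ?case using path_of_length.trivial[OF h_in] by blast
next
  case (extend p e' s L t)
  then obtain L' where L': "L' \<le> L" "path_of_length G' (h p) (h (edge_point G e' s)) L'" by blast
  show ?case
  proof (cases "e' = e")
    case True
    then have "path_of_length G' (h p) (h (edge_point G e' t)) L'" using L'(2) by simp
    moreover have "L' \<le> L + \<bar>s - t\<bar>" using L'(1) by simp
    ultimately show ?thesis by blast
  next
    case False
    then have "path_of_length G' (h p) (h (edge_point G e' t)) (L' + \<bar>s - t\<bar>)"
      using path_of_length.extend[of G' "h p" e' s L' t] L'(2) extend by (simp add: h_other_edge)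
    moreover have "L' + \<bar>s - t\<bar> \<le> L + \<bar>s - t\<bar>" using L'(1) by simp
    ultimately show ?thesis by blast
  qed
qed

definition \<sigma> :: "('v, 'e) gpoint \<Rightarrow> ('v, 'e) gpoint" where
  "\<sigma> x = (if x = V then edge_point G e (1 / 2) else x)"

lemma edge_points_in: "t \<in> {0..1} \<Longrightarrow> edge_point G e t \<in> graph_points G"
  by (rule edge_point_in_points[OF wf e])

lemma \<sigma>_in: "x \<in> graph_points G' \<Longrightarrow> \<sigma> x \<in> graph_points G"
  using other_points(2) edge_points_in[of "1 / 2"] by (simp add: \<sigma>_def)

lemma h_\<sigma>: "x \<in> graph_points G' \<Longrightarrow> h (\<sigma> x) = x"
  using other_points(3) by (simp add: \<sigma>_def)

lemma contract_path_connected: "path_connected_graph G'"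
proof -
  have "\<exists>L. path_of_length G' x y L" if "x \<in> graph_points G'" "y \<in> graph_points G'" for x y
  proof -
    have "path_of_length G (\<sigma> x) (\<sigma> y) (graph_dist G (\<sigma> x) (\<sigma> y))"
      by (rule path_graph_dist'[OF graph \<sigma>_in \<sigma>_in, OF that])
    from path_project[OF this] show ?thesis unfolding h_\<sigma>[OF that(1)] h_\<sigma>[OF that(2)] by blast
  qed
  then show ?thesis using wf_contract by (simp add: path_connected_graph_def)
qed

text \<open>The first alternative admits the trivial path at an inner point of \<open>e\<close>,
  which is not a point of \<open>G0\<close>.\<close>

definition joined :: "('v, 'e) gpoint \<Rightarrow> ('v, 'e) gpoint \<Rightarrow> real \<Rightarrow> bool" where
  "joined x y L \<longleftrightarrow> x = y \<and> L = 0 \<or> path_of_length G0 x y L"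

lemma joined_nonneg: "joined x y L \<Longrightarrow> 0 \<le> L"
  using path_nonneg by (auto simp: joined_def)

lemma joined_extend:
  assumes "joined x (edge_point G e' s) L" "e' \<in> arcs G - {e}" "s \<in> {0..1}" "t \<in> {0..1}"
  shows "joined x (edge_point G e' t) (L + \<bar>s - t\<bar>)"
  using assms(1) unfolding joined_def
proof
  assume "x = edge_point G e' s \<and> L = 0"
  then show "x = edge_point G e' t \<and> L + \<bar>s - t\<bar> = 0 \<or> path_of_length G0 x (edge_point G e' t) (L + \<bar>s - t\<bar>)"
    using path_edge[OF wf_delete, of e' s t] assms by simp
next
  assume "path_of_length G0 x (edge_point G e' s) L"
  then show "x = edge_point G e' t \<and> L + \<bar>s - t\<bar> = 0 \<or> path_of_length G0 x (edge_point G e' t) (L + \<bar>s - t\<bar>)"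
    using path_of_length.extend[of G0 x e' s L t] assms by simp
qed

definition joined_off_V :: "('v, 'e) gpoint \<Rightarrow> ('v, 'e) gpoint \<Rightarrow> real \<Rightarrow> bool" where
  "joined_off_V x y L \<longleftrightarrow> (\<exists>K\<le>L. joined x y K)"

text \<open>Whatever happens between the arrival \<open>\<alpha>\<close> in the fibre of
  \<open>V\<close> and the departure \<open>\<beta>\<close> is dropped; passing from
  \<open>\<alpha>\<close> to \<open>\<beta>\<close> within \<open>G\<close> is accounted for
  separately, by \<open>d \<alpha> \<beta>\<close>.\<close>

definition joined_through_V :: "('v, 'e) gpoint \<Rightarrow> ('v, 'e) gpoint \<Rightarrow> real \<Rightarrow> bool" where
  "joined_through_V x y L \<longleftrightarrow> (\<exists>\<alpha>\<in>graph_points G. \<exists>\<beta>\<in>graph_points G. \<exists>L1 L2.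
     h \<alpha> = V \<and> h \<beta> = V \<and> joined x \<alpha> L1 \<and> joined \<beta> y L2 \<and> L1 + L2 \<le> L)"

lemma joined_through_VI:
  assumes "\<alpha> \<in> graph_points G" "\<beta> \<in> graph_points G" "h \<alpha> = V" "h \<beta> = V"
    "joined x \<alpha> L1" "joined \<beta> y L2" "L1 + L2 \<le> L"
  shows "joined_through_V x y L"
  using assms unfolding joined_through_V_def by blast

lemma joined_refl: "joined x x 0"
  by (simp add: joined_def)

text \<open>Edges lift uniquely, and consecutive lifts can fail to match only in the fibre of
  \<open>V\<close>. The lift \<open>y\<close> of the end is left arbitrary because \<open>h\<close>
  does not determine it there.\<close>

lemma path_lift:
  assumes "path_of_length G' p q L" "h x = p" "h y = q" "x \<in> graph_points G" "y \<in> graph_points G"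
  shows "joined_off_V x y L \<or> joined_through_V x y L"
  using assms
proof (induction arbitrary: y rule: path_of_length.induct)
  case (trivial p)
  show ?case
  proof (cases "x = y")
    case True
    then have "joined_off_V x y 0" unfolding joined_off_V_def using joined_refl by blast
    then show ?thesis ..
  next
    case False
    then have "h x = V" "h y = V" using h_inj[of x y] trivial by simp_all
    then have "joined_through_V x y 0"
      using joined_through_VI[OF trivial(4,5) _ _ joined_refl joined_refl] by simp
    then show ?thesis ..
  qed
next
  case (extend p e' s L t)
  define w where "w = edge_point G e' s"
  define z where "z = edge_point G e' t"
  have e': "e' \<in> arcs G" "e' \<noteq> e" and st: "s \<in> {0..1}" "t \<in> {0..1}" using extend by simp_all
  have wz: "w \<in> graph_points G" "z \<in> graph_points G"
    using edge_point_in_points[OF wf e'(1)] st by (simp_all add: w_def z_def)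
  have hw: "h w = edge_point G' e' s" and hz: "h z = edge_point G' e' t"
    using h_other_edge[OF e'(2)] by (simp_all add: w_def z_def)
  have to_z: "joined u z (K + \<bar>s - t\<bar>)" if "joined u w K" for u K
    using joined_extend[of u e' s K t] that e' st unfolding w_def z_def by simp
  have x: "h x = p" "x \<in> graph_points G" and y: "h y = h z" "y \<in> graph_points G"
    using extend.prems hz by simp_all
  have y_ne: "h y = V" "h z = V" if "y \<noteq> z" using h_inj[of y z] y that by simp_all
  from extend.IH[OF x(1) hw x(2) wz(1)] show ?case
  proof
    assume "joined_off_V x w L"
    then obtain K where K: "K \<le> L" "joined x w K" unfolding joined_off_V_def by blast
    have xz: "joined x z (K + \<bar>s - t\<bar>)" "K + \<bar>s - t\<bar> \<le> L + \<bar>s - t\<bar>"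
      using to_z[OF K(2)] K(1) by simp_all
    show ?thesis
    proof (cases "y = z")
      case True
      then have "joined_off_V x y (L + \<bar>s - t\<bar>)" unfolding joined_off_V_def using xz by blast
      then show ?thesis ..
    next
      case False
      have "joined_through_V x y (L + \<bar>s - t\<bar>)"
        using joined_through_VI[OF wz(2) y(2) y_ne(2,1)[OF False] xz(1) joined_refl] xz(2) by simp
      then show ?thesis ..
    qed
  next
    assume "joined_through_V x w L"
    then obtain \<alpha> \<beta> L1 L2 where *: "\<alpha> \<in> graph_points G" "\<beta> \<in> graph_points G" "h \<alpha> = V" "h \<beta> = V"
        "joined x \<alpha> L1" "joined \<beta> w L2" "L1 + L2 \<le> L"
      unfolding joined_through_V_def by blast
    have "joined_through_V x y (L + \<bar>s - t\<bar>)"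
    proof (cases "y = z")
      case True
      then show ?thesis using joined_through_VI[OF *(1-5) to_z[OF *(6)]] *(7) by simp
    next
      case False
      then show ?thesis
        using joined_through_VI[OF *(1) y(2) *(3) y_ne(1)[OF False] *(5) joined_refl]
          joined_nonneg[OF *(6)] *(7) by simp
    qed
    then show ?thesis ..
  qed
qed

sublocale Gm: geodesic_metric "graph_points G" d
  by (rule geodesic_metric_graph[OF graph])

sublocale Qm: geodesic_metric "graph_points G'" d'
  by (rule geodesic_metric_graph[OF contract_path_connected])

lemma joined_dist_le: "joined x y L \<Longrightarrow> x \<in> graph_points G \<Longrightarrow> d x y \<le> L"
  using graph_dist_le[OF path_delete_imp] Gm.dist_self by (auto simp: joined_def)

lemma joined_in: "joined x y L \<Longrightarrow> x \<in> graph_points G0 \<Longrightarrow> y \<in> graph_points G0"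
  using path_in_points(2)[OF wf_delete] by (auto simp: joined_def)

lemma dist_contract_le:
  assumes "x \<in> graph_points G" "y \<in> graph_points G"
  shows "d' (h x) (h y) \<le> d x y"
proof -
  obtain L' where "L' \<le> d x y" "path_of_length G' (h x) (h y) L'"
    using path_project[OF path_graph_dist'[OF graph assms]] by blast
  then show ?thesis using graph_dist_le by (meson order_trans)
qed

lemma dist_fibre_le:
  assumes "h x = V" "h y = V" "x \<in> graph_points G" "y \<in> graph_points G"
  shows "d x y \<le> 1"
proof -
  obtain s where s: "s \<in> {0..1}" "x = edge_point G e s" using fibre_V assms(1,3) .
  obtain t where t: "t \<in> {0..1}" "y = edge_point G e t" using fibre_V assms(2,4) .
  have "\<bar>s - t\<bar> \<le> 1" using s t by auto
  then show ?thesis using graph_dist_edge_le[OF wf e s(1) t(1)] s t by simp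
qed

text \<open>This is \<open>path_lift\<close> applied to a minimal path of \<open>G'\<close>. In the
  second case \<open>L1 + L2\<close> is squeezed between \<open>d' (h x) V + d' V (h y)\<close> and
  \<open>d' (h x) (h y)\<close>, which puts \<open>V\<close> on a geodesic.\<close>

lemma dist_contract_cases:
  assumes x: "x \<in> graph_points G" and y: "y \<in> graph_points G"
  obtains "d x y \<le> d' (h x) (h y)" "\<exists>L. joined x y L \<and> L \<le> d' (h x) (h y)"
  | \<alpha> \<beta> L1 L2 where "\<alpha> \<in> graph_points G" "\<beta> \<in> graph_points G" "h \<alpha> = V" "h \<beta> = V"
    "joined x \<alpha> L1" "joined \<beta> y L2" "L1 + L2 \<le> d' (h x) (h y)"
    "d' (h x) V \<le> L1" "d' V (h y) \<le> L2" "d x y \<le> L1 + d \<alpha> \<beta> + L2"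
proof -
  have "path_of_length G' (h x) (h y) (d' (h x) (h y))"
    by (rule path_graph_dist'[OF contract_path_connected h_in[OF x] h_in[OF y]])
  from path_lift[OF this refl refl x y] show thesis
  proof
    assume "joined_off_V x y (d' (h x) (h y))"
    then obtain L where *: "L \<le> d' (h x) (h y)" "joined x y L" unfolding joined_off_V_def by blast
    have "d x y \<le> d' (h x) (h y)" using joined_dist_le[OF *(2) x] *(1) by simp
    then show thesis by (rule that(1)) (use * in blast)
  next
    assume "joined_through_V x y (d' (h x) (h y))"
    then obtain \<alpha> \<beta> L1 L2 where *: "\<alpha> \<in> graph_points G" "\<beta> \<in> graph_points G" "h \<alpha> = V" "h \<beta> = V"
        "joined x \<alpha> L1" "joined \<beta> y L2" "L1 + L2 \<le> d' (h x) (h y)"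
      unfolding joined_through_V_def by blast
    have **: "d x \<alpha> \<le> L1" "d \<beta> y \<le> L2" using joined_dist_le * x by blast+
    have D: "d' (h x) V \<le> L1" "d' V (h y) \<le> L2"
      using dist_contract_le[OF x *(1)] dist_contract_le[OF *(2) y] * ** by simp_all
    have "d x y \<le> L1 + d \<alpha> \<beta> + L2"
      using Gm.dist_triangle[OF x *(1) y] Gm.dist_triangle[OF *(1,2) y] ** by linarith
    then show thesis by (rule that(2)[OF * D])
  qed
qed

sublocale contraction "graph_points G" d "graph_points G'" d' h V
proof
  fix x assume x: "x \<in> graph_points G"
  show "h x \<in> graph_points G'" by (rule h_in[OF x])
  fix y assume y: "y \<in> graph_points G"
  show "d' (h x) (h y) \<le> d x y" by (rule dist_contract_le[OF x y])
  show "d x y \<le> d' (h x) (h y) + 1"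
  proof (rule dist_contract_cases[OF x y])
    fix \<alpha> \<beta> L1 L2
    assume "\<alpha> \<in> graph_points G" "\<beta> \<in> graph_points G" "h \<alpha> = V" "h \<beta> = V"
      "L1 + L2 \<le> d' (h x) (h y)" "d x y \<le> L1 + d \<alpha> \<beta> + L2"
    then show ?thesis using dist_fibre_le[of \<alpha> \<beta>] by simp
  qed simp
  show "d' (h x) (h y) = d' (h x) V + d' V (h y)" if "d' (h x) (h y) < d x y"
  proof (rule dist_contract_cases[OF x y])
    fix L1 L2
    assume "L1 + L2 \<le> d' (h x) (h y)" "d' (h x) V \<le> L1" "d' V (h y) \<le> L2"
    then show ?thesis using Qm.dist_triangle[OF h_in[OF x] V_in h_in[OF y]] by simp
  qed (use that in simp)
qed (rule V_in)

definition depth :: "('v, 'e) gpoint \<Rightarrow> real" where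
  "depth x = (case x of Vertex _ \<Rightarrow> 0 | Inner e' t \<Rightarrow> if e' = e then min t (1 - t) else 0)"

text \<open>The potential \<open>F\<close>, distance to \<open>V\<close> minus depth inside
  \<open>e\<close>, changes by at most the distance travelled along any edge. It equals
  \<open>- 1 / 2\<close> at the midpoint and \<open>d' x V\<close> at \<open>x\<close>.\<close>

lemma dist_midpoint_ge:
  assumes "x \<in> graph_points G'" "x \<noteq> V"
  shows "d' x V + 1 / 2 \<le> d x (edge_point G e (1 / 2))"
proof -
  define F where "F y = d' (h y) V - depth y" for y
  have step: "F (edge_point G e' t) \<le> F (edge_point G e' s) + \<bar>s - t\<bar>"
    if e': "e' \<in> arcs G" and st: "s \<in> {0..1}" "t \<in> {0..1}" for e' s t
  proof (cases "e' = e")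
    case True
    have "depth (edge_point G e u) = min u (1 - u)" for u
      by (simp add: depth_def edge_point_def)
    then show ?thesis using True by (simp add: F_def)
  next
    case False
    have "depth (edge_point G e' u) = 0" for u using False by (simp add: depth_def edge_point_def)
    moreover have *: "edge_point G e' t \<in> graph_points G" "edge_point G e' s \<in> graph_points G"
      using edge_point_in_points[OF wf e'] st by simp_all
    have "d' (h (edge_point G e' t)) (h (edge_point G e' s)) \<le> \<bar>s - t\<bar>"
      using dist_contract_le[OF *] graph_dist_edge_le[OF wf e' st(2,1)] by simp
    moreover have "d' (h (edge_point G e' t)) V \<le>
        d' (h (edge_point G e' t)) (h (edge_point G e' s)) + d' (h (edge_point G e' s)) V"
      by (intro Qm.dist_triangle h_in * V_in)
    ultimately show ?thesis by (simp add: F_def)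
  qed
  define c where "c = edge_point G e (1 / 2)"
  have c: "c \<in> graph_points G" unfolding c_def by (rule edge_points_in) simp
  note x = other_points[OF assms]
  have "F x \<le> F c + d c x"
    by (rule path_lipschitz_bound[OF path_graph_dist'[OF graph c x(2)]]) (rule step)
  moreover have "F c = - (1 / 2)"
    using Qm.dist_self[OF V_in] by (simp add: F_def c_def depth_def) (simp add: edge_point_def)
  moreover have "depth x = 0" using x(1) by (auto simp: depth_def graph_points_delete split: gpoint.splits)
  ultimately show ?thesis using x(3) Gm.dist_sym[OF c x(2)] by (simp add: F_def c_def)
qed

text \<open>A minimal path to \<open>V\<close> lifts, up to its arrival in the fibre, to a path that
  does not use \<open>e\<close> and so can arrive only at an end of \<open>e\<close>.\<close>

lemma exit_fibre_dist_le:
  assumes "x \<in> graph_points G'" "x \<noteq> V"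
  shows "d x (Vertex (tail G e)) \<le> d' x V \<or> d x (Vertex (head G e)) \<le> d' x V"
proof -
  note x = other_points[OF assms]
  have t: "Vertex (tail G e) \<in> graph_points G"
    using wf_digraph.tail_in_verts[OF wf e] by (simp add: graph_points_def)
  show ?thesis
  proof (rule dist_contract_cases[OF x(2) t])
    assume "d x (Vertex (tail G e)) \<le> d' (h x) (h (Vertex (tail G e)))"
    then show ?thesis using x(3) by simp
  next
    fix \<alpha> \<beta> L1 L2
    assume *: "h \<alpha> = V" "joined x \<alpha> L1" "joined \<beta> (Vertex (tail G e)) L2"
      "L1 + L2 \<le> d' (h x) (h (Vertex (tail G e)))"
    have "\<alpha> \<in> {Vertex (tail G e), Vertex (head G e)}"
      by (rule fibre_V_delete[OF *(1) joined_in[OF *(2) x(1)]])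
    moreover have "d x \<alpha> \<le> d' x V"
      using joined_dist_le[OF *(2) x(2)] joined_nonneg[OF *(3)] *(4) x(3) by simp
    ultimately show ?thesis by auto
  qed
qed

sublocale midpoint_contraction "graph_points G" d "graph_points G'" d' h V
  \<sigma> "edge_point G e (1 / 2)" "Vertex (tail G e)" "Vertex (head G e)"
proof
  fix x assume x: "x \<in> graph_points G'"
  show "\<sigma> x \<in> graph_points G" by (rule \<sigma>_in[OF x])
  show "h (\<sigma> x) = x" by (rule h_\<sigma>[OF x])
  assume ne: "x \<noteq> V"
  then have "\<sigma> x = x" by (simp add: \<sigma>_def)
  then show "d (\<sigma> x) (Vertex (tail G e)) \<le> d' x V \<or> d (\<sigma> x) (Vertex (head G e)) \<le> d' x V"
    "d' x V + 1 / 2 \<le> d (\<sigma> x) (edge_point G e (1 / 2))"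
    using exit_fibre_dist_le[OF x ne] dist_midpoint_ge[OF x ne] by simp_all
next
  fix \<alpha> :: "('v, 'e) gpoint" assume \<alpha>: "\<alpha> \<in> {Vertex (tail G e), Vertex (head G e)}"
  show "\<exists>\<kappa>. Gm.lipschitz_path \<kappa> (1 / 2) \<and> \<kappa> 0 = \<alpha> \<and> \<kappa> (1 / 2) = edge_point G e (1 / 2) \<and>
      (\<forall>s\<in>{0..1 / 2}. h (\<kappa> s) = V)"
  proof (cases "\<alpha> = Vertex (tail G e)")
    case True
    have "Gm.lipschitz_path (edge_point G e) (1 / 2)"
    proof (rule Gm.lipschitz_pathI)
      fix s t :: real assume "0 \<le> s" "s \<le> t" "t \<le> 1 / 2"
      then show "d (edge_point G e s) (edge_point G e t) \<le> t - s"
        using graph_dist_edge_le[OF wf e, of s t] by simp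
    qed (use edge_points_in in simp_all)
    then show ?thesis using True by (intro exI[of _ "edge_point G e"]) (simp add: edge_point_def[of _ _ 0])
  next
    case False
    have "Gm.lipschitz_path (\<lambda>s. edge_point G e (1 - s)) (1 / 2)"
    proof (rule Gm.lipschitz_pathI)
      fix s t :: real assume "0 \<le> s" "s \<le> t" "t \<le> 1 / 2"
      then show "d (edge_point G e (1 - s)) (edge_point G e (1 - t)) \<le> t - s"
        using graph_dist_edge_le[OF wf e, of "1 - s" "1 - t"] by simp
    qed (use edge_points_in in simp_all)
    then show ?thesis using False \<alpha>
      by (intro exI[of _ "\<lambda>s. edge_point G e (1 - s)"]) (simp add: edge_point_def[of _ _ 1])
  qed
qed (use wf_digraph.tail_in_verts[OF wf e] wf_digraph.head_in_verts[OF wf e]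
    in \<open>simp_all add: graph_points_def \<sigma>_def\<close>)

text \<open>Think of \<open>\<rho>\<close> as the travel along \<open>e\<close> that is forced. For
  one inequality, \<open>d' (h x) (h z) + \<rho> x z\<close> is a potential in \<open>z\<close>. For
  the other, a path avoiding \<open>e\<close> does not change \<open>\<rho>\<close>, so crossing the
  fibre from \<open>\<alpha>\<close> to \<open>\<beta>\<close> costs no more than
  \<open>\<rho> x y\<close>.\<close>

lemma dist_eq_sum:
  assumes nonneg: "\<And>x y. 0 \<le> \<rho> x y" and refl: "\<And>x. \<rho> x x = 0" and sym: "\<And>x y. \<rho> x y = \<rho> y x"
    and tri: "\<And>x y z. x \<in> graph_points G \<Longrightarrow> y \<in> graph_points G \<Longrightarrow> z \<in> graph_points G \<Longrightarrow>
      \<rho> x z \<le> \<rho> x y + \<rho> y z"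
    and other: "\<And>e' s t. e' \<in> arcs G \<Longrightarrow> e' \<noteq> e \<Longrightarrow> s \<in> {0..1} \<Longrightarrow> t \<in> {0..1} \<Longrightarrow>
      \<rho> (edge_point G e' s) (edge_point G e' t) = 0"
    and edge: "\<And>s t. s \<in> {0..1} \<Longrightarrow> t \<in> {0..1} \<Longrightarrow> \<rho> (edge_point G e s) (edge_point G e t) \<le> \<bar>s - t\<bar>"
    and fibre: "\<And>s t. s \<in> {0..1} \<Longrightarrow> t \<in> {0..1} \<Longrightarrow>
      d (edge_point G e s) (edge_point G e t) \<le> \<rho> (edge_point G e s) (edge_point G e t)"
    and x: "x \<in> graph_points G" and y: "y \<in> graph_points G"
  shows "d x y = d' (h x) (h y) + \<rho> x y"
proof (rule antisym)
  define F where "F z = d' (h x) (h z) + \<rho> x z" for z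
  have step: "F (edge_point G e' t) \<le> F (edge_point G e' s) + \<bar>s - t\<bar>"
    if e': "e' \<in> arcs G" and st: "s \<in> {0..1}" "t \<in> {0..1}" for e' s t
  proof -
    have *: "edge_point G e' s \<in> graph_points G" "edge_point G e' t \<in> graph_points G"
      using edge_point_in_points[OF wf e'] st by simp_all
    have **: "\<rho> x (edge_point G e' t) \<le> \<rho> x (edge_point G e' s) + \<rho> (edge_point G e' s) (edge_point G e' t)"
      by (rule tri[OF x *])
    show ?thesis
    proof (cases "e' = e")
      case True
      then show ?thesis using ** edge[OF st] by (simp add: F_def)
    next
      case False
      have "d' (h (edge_point G e' s)) (h (edge_point G e' t)) \<le> \<bar>s - t\<bar>"
        using dist_contract_le[OF *] graph_dist_edge_le[OF wf e' st] by simp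
      moreover have "d' (h x) (h (edge_point G e' t)) \<le>
          d' (h x) (h (edge_point G e' s)) + d' (h (edge_point G e' s)) (h (edge_point G e' t))"
        by (intro Qm.dist_triangle h_in * x)
      ultimately show ?thesis using ** other[OF e' False st] by (simp add: F_def)
    qed
  qed
  have "F y \<le> F x + d x y"
    by (rule path_lipschitz_bound[OF path_graph_dist'[OF graph x y]]) (rule step)
  then show "d' (h x) (h y) + \<rho> x y \<le> d x y"
    using Qm.dist_self[OF h_in[OF x]] refl by (simp add: F_def)
  have joined_0: "\<rho> u v \<le> 0" if uv: "joined u v L" "u \<in> graph_points G" for u v L
    using uv(1) unfolding joined_def
  proof
    assume "path_of_length G0 u v L"
    then show ?thesis using uv(2)
    proof (induction rule: path_of_length.induct)
      case (extend p e' s L t)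
      have "edge_point G e' s \<in> graph_points G" "edge_point G e' t \<in> graph_points G"
        using edge_point_in_points[OF wf, of e'] extend by simp_all
      then show ?case
        using tri[OF extend(6), of "edge_point G e' s" "edge_point G e' t"] other[of e' s t] extend
        by simp
    qed (simp add: refl)
  qed (simp add: refl)
  show "d x y \<le> d' (h x) (h y) + \<rho> x y"
  proof (rule dist_contract_cases[OF x y])
    assume "d x y \<le> d' (h x) (h y)" then show ?thesis using nonneg[of x y] by simp
  next
    fix \<alpha> \<beta> L1 L2
    assume *: "\<alpha> \<in> graph_points G" "\<beta> \<in> graph_points G" "h \<alpha> = V" "h \<beta> = V"
      "joined x \<alpha> L1" "joined \<beta> y L2" "L1 + L2 \<le> d' (h x) (h y)" "d x y \<le> L1 + d \<alpha> \<beta> + L2"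
    obtain s where s: "s \<in> {0..1}" "\<alpha> = edge_point G e s" using fibre_V *(3,1) .
    obtain t where t: "t \<in> {0..1}" "\<beta> = edge_point G e t" using fibre_V *(4,2) .
    have "d \<alpha> \<beta> \<le> \<rho> \<alpha> \<beta>" using fibre s t by simp
    also have "\<dots> \<le> \<rho> \<alpha> x + \<rho> x y + \<rho> y \<beta>"
      using tri[OF *(1) x *(2)] tri[OF x y *(2)] by simp
    also have "\<dots> \<le> \<rho> x y"
      using joined_0[OF *(5) x] joined_0[OF *(6,2)] sym[of \<alpha> x] sym[of y \<beta>] by simp
    finally show ?thesis using *(7,8) by simp
  qed
qed

text \<open>Without \<open>e\<close> its two ends are separated. The coordinate on \<open>e\<close>
  therefore extends to \<open>\<kappa>\<close>, equal to \<open>1\<close> on everything still joined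
  to the head and to \<open>0\<close> on the rest, and constant along every other edge.\<close>

lemma expand_bridge:
  assumes bridge: "\<And>L. \<not> path_of_length G0 (Vertex (tail G e)) (Vertex (head G e)) L"
    and rips: "rips_hyperbolic (graph_points G') d' r"
  shows "rips_hyperbolic (graph_points G) d (r + 1)"
proof -
  define side :: "('v, 'e) gpoint \<Rightarrow> real" where
    "side x = (if \<exists>L. path_of_length G0 x (Vertex (head G e)) L then 1 else 0)" for x
  define \<kappa> where "\<kappa> x = (case x of Vertex v \<Rightarrow> side x | Inner e' t \<Rightarrow> if e' = e then t else side x)" for x
  have head: "Vertex (head G e) \<in> graph_points G0"
    using wf_digraph.head_in_verts[OF wf e] by (simp add: graph_points_def pre_digraph.del_arc_def)
  have \<kappa>_edge: "\<kappa> (edge_point G e t) = t" for t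
    using bridge path_of_length.trivial[OF head] by (auto simp: \<kappa>_def edge_point_def side_def)
  have \<kappa>_other: "\<kappa> (edge_point G e' s) = \<kappa> (edge_point G e' t)"
    if "e' \<in> arcs G" "e' \<noteq> e" "s \<in> {0..1}" "t \<in> {0..1}" for e' s t
  proof -
    have "\<kappa> (edge_point G e' u) = side (edge_point G e' u)" for u
      using that by (simp add: \<kappa>_def edge_point_def)
    moreover have "path_of_length G0 (edge_point G e' s) (edge_point G e' t) \<bar>s - t\<bar>"
      using path_edge[OF wf_delete, of e' s t] that by simp
    note st = this path_sym[OF wf_delete this]
    have "(\<exists>L. path_of_length G0 (edge_point G e' s) (Vertex (head G e)) L) \<longleftrightarrow>
        (\<exists>L. path_of_length G0 (edge_point G e' t) (Vertex (head G e)) L)"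
      using path_trans[OF _ st(1)] path_trans[OF _ st(2)] by blast
    then have "side (edge_point G e' s) = side (edge_point G e' t)" unfolding side_def by simp
    ultimately show ?thesis by simp
  qed
  have sum: "d x y = d' (h x) (h y) + \<bar>\<kappa> x - \<kappa> y\<bar>"
    if "x \<in> graph_points G" "y \<in> graph_points G" for x y
  proof (rule dist_eq_sum[where \<rho> = "\<lambda>x y. \<bar>\<kappa> x - \<kappa> y\<bar>"])
    show "\<bar>\<kappa> (edge_point G e' s) - \<kappa> (edge_point G e' t)\<bar> = 0"
      if "e' \<in> arcs G" "e' \<noteq> e" "s \<in> {0..1}" "t \<in> {0..1}" for e' s t
      using \<kappa>_other[OF that] by simp
    show "d (edge_point G e s) (edge_point G e t) \<le> \<bar>\<kappa> (edge_point G e s) - \<kappa> (edge_point G e t)\<bar>"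
      if "s \<in> {0..1}" "t \<in> {0..1}" for s t
      using graph_dist_edge_le[OF wf e that] by (simp add: \<kappa>_edge)
  qed (use that \<kappa>_edge in simp_all)
  show ?thesis
    by (rule rips_hyperbolic_expand_of_sum[where \<rho> = "\<lambda>x y. \<bar>\<kappa> x - \<kappa> y\<bar>", OF sum _ rips]) simp_all
qed

text \<open>Here \<open>e\<close> is a circle of length \<open>1\<close> attached at one vertex.
  \<open>\<kappa>\<close> is the coordinate on the circle, with everything else placed at
  \<open>0\<close>, and \<open>\<rho>\<close> is the distance on the circle.\<close>

lemma expand_loop:
  assumes loop: "tail G e = head G e" and rips: "rips_hyperbolic (graph_points G') d' r"
  shows "rips_hyperbolic (graph_points G) d (r + 1)"
proof -
  define \<kappa> :: "('v, 'e) gpoint \<Rightarrow> real" where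
    "\<kappa> x = (case x of Vertex v \<Rightarrow> 0 | Inner e' t \<Rightarrow> if e' = e \<and> 0 < t \<and> t < 1 then t else 0)" for x
  define \<rho> where "\<rho> x y = min \<bar>\<kappa> x - \<kappa> y\<bar> (1 - \<bar>\<kappa> x - \<kappa> y\<bar>)" for x y
  have \<kappa>_range: "0 \<le> \<kappa> x \<and> \<kappa> x < 1" for x by (cases x) (auto simp: \<kappa>_def)
  have \<kappa>_edge: "\<kappa> (edge_point G e t) = (if t = 1 then 0 else t)" if "t \<in> {0..1}" for t
    using that by (auto simp: \<kappa>_def edge_point_def)
  have \<kappa>_other: "\<kappa> (edge_point G e' s) = 0" if "e' \<noteq> e" for e' s
    using that by (simp add: \<kappa>_def edge_point_def)
  have tri: "\<rho> x z \<le> \<rho> x y + \<rho> y z" for x y z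
    using \<kappa>_range[of x] \<kappa>_range[of y] \<kappa>_range[of z] unfolding \<rho>_def by linarith
  have ends: "edge_point G e 0 = edge_point G e 1" using loop by (simp add: edge_point_def)
  have around: "d (edge_point G e s) (edge_point G e t) \<le> s + (1 - t)"
    if st: "s \<in> {0..1}" "t \<in> {0..1}" for s t
  proof -
    have "d (edge_point G e s) (edge_point G e t) \<le>
        d (edge_point G e s) (edge_point G e 0) + d (edge_point G e 1) (edge_point G e t)"
      using Gm.dist_triangle[of "edge_point G e s" "edge_point G e 0" "edge_point G e t"]
        edge_points_in st ends by simp
    also have "\<dots> \<le> s + (1 - t)"
      using graph_dist_edge_le[OF wf e, of s 0] graph_dist_edge_le[OF wf e, of 1 t] st by simp
    finally show ?thesis .
  qed
  have fibre: "d (edge_point G e s) (edge_point G e t) \<le> \<rho> (edge_point G e s) (edge_point G e t)"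
    if st: "s \<in> {0..1}" "t \<in> {0..1}" for s t
  proof -
    \<comment> \<open>Coordinate \<open>1\<close> is the same point as \<open>0\<close>, where
      \<open>\<kappa>\<close> takes the value \<open>0\<close>.\<close>
    define s' t' where "s' = (if s = 1 then 0 else s)" and "t' = (if t = 1 then 0 else t)"
    have eq: "edge_point G e s = edge_point G e s'" "edge_point G e t = edge_point G e t'"
      using ends unfolding s'_def t'_def by simp_all
    have st': "s' \<in> {0..1}" "t' \<in> {0..1}" using st unfolding s'_def t'_def by auto
    have "\<rho> (edge_point G e s) (edge_point G e t) = min \<bar>s' - t'\<bar> (1 - \<bar>s' - t'\<bar>)"
      unfolding \<rho>_def \<kappa>_edge[OF st(1)] \<kappa>_edge[OF st(2)] s'_def t'_def ..
    moreover have "d (edge_point G e s') (edge_point G e t') \<le> 1 - \<bar>s' - t'\<bar>"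
      using around[OF st'] around[OF st'(2,1)] Gm.dist_sym[OF edge_points_in edge_points_in, OF st'] by linarith
    ultimately show ?thesis using graph_dist_edge_le[OF wf e st'] unfolding eq by simp
  qed
  have sum: "d x y = d' (h x) (h y) + \<rho> x y" if "x \<in> graph_points G" "y \<in> graph_points G" for x y
  proof (rule dist_eq_sum[where \<rho> = \<rho>])
    show "0 \<le> \<rho> x y" for x y using \<kappa>_range[of x] \<kappa>_range[of y] unfolding \<rho>_def by linarith
    show "\<rho> x y = \<rho> y x" for x y unfolding \<rho>_def by (simp add: abs_minus_commute)
    show "\<rho> (edge_point G e s) (edge_point G e t) \<le> \<bar>s - t\<bar>" if "s \<in> {0..1}" "t \<in> {0..1}" for s t
      using that unfolding \<rho>_def by (auto simp: \<kappa>_edge)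
  qed (use that tri fibre in \<open>simp_all add: \<rho>_def \<kappa>_other\<close>)
  show ?thesis by (rule rips_hyperbolic_expand_of_sum[where \<rho> = \<rho>, OF sum tri rips])
qed

text \<open>A shortest path joining the ends of \<open>e\<close> without using \<open>e\<close> becomes an isometrically embedded
  cycle.\<close>

lemma rips_hyperbolic_cycle:
  assumes ne: "tail G e \<noteq> head G e"
    and p: "path_of_length G0 (Vertex (tail G e)) (Vertex (head G e)) K"
    and rips: "rips_hyperbolic (graph_points G') d' r"
  shows "1 / 4 \<le> r"
proof -
  let ?A = "Vertex (tail G e) :: ('v, 'e) gpoint" and ?B = "Vertex (head G e) :: ('v, 'e) gpoint"
  obtain c where c: "path_of_length G0 ?A ?B c" "\<And>L. path_of_length G0 ?A ?B L \<Longrightarrow> c \<le> L"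
    using minimal_path_exists[OF wf_delete p] by blast
  \<comment> \<open>A path between two distinct vertices contains at least one full edge once it is
    reduced.\<close>
  have c1: "1 \<le> c"
    using path_reduce[OF wf_delete c(1)]
  proof (elim disjE)
    assume "\<exists>e'\<in>arcs G0. \<exists>s\<in>{0..1}. \<exists>t\<in>{0..1}. ?A = edge_point G0 e' s \<and> ?B = edge_point G0 e' t \<and> \<bar>s - t\<bar> \<le> c"
    then obtain e' s t where *: "?A = edge_point G e' s" "?B = edge_point G e' t" "\<bar>s - t\<bar> \<le> c" by auto
    have "s = 0 \<or> s = 1" "t = 0 \<or> t = 1" using *(1,2) by (auto simp: edge_point_def split: if_splits)
    moreover have "s \<noteq> t" using *(1,2) ne by (metis gpoint.inject(1))
    ultimately show ?thesis using *(3) by auto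
  next
    assume "\<exists>u a v b. \<exists>n::nat. vertex_exit G0 ?A u a \<and> vertex_exit G0 ?B v b \<and>
      path_of_length G0 (Vertex u) (Vertex v) n \<and> a + n + b \<le> c"
    then obtain n :: nat where n: "path_of_length G0 ?A ?B n" "n \<le> c"
      by (auto simp: vertex_exit_def)
    then have "n \<noteq> 0" using path_zero[OF n(1)] ne by auto
    then show ?thesis using n(2) by linarith
  qed
  obtain \<gamma> where \<gamma>: "\<gamma> 0 = ?A" "\<gamma> c = ?B"
      "\<And>u v. 0 \<le> u \<Longrightarrow> u \<le> v \<Longrightarrow> v \<le> c \<Longrightarrow> path_of_length G0 (\<gamma> u) (\<gamma> v) (v - u)"
    using path_parametrization[OF wf_delete c(1)] by blast
  have in0: "\<gamma> s \<in> graph_points G0" if "0 \<le> s" "s \<le> c" for s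
    using path_in_points(1)[OF wf_delete \<gamma>(3)[of s s]] that by simp
  have inG: "\<gamma> s \<in> graph_points G" if "0 \<le> s" "s \<le> c" for s
    using in0[OF that] by (simp add: graph_points_delete)
  have from_A: "path_of_length G0 ?A (\<gamma> s) s" and to_B: "path_of_length G0 (\<gamma> s) ?B (c - s)"
    if "0 \<le> s" "s \<le> c" for s
    using \<gamma>(3)[of 0 s] \<gamma>(3)[of s c] \<gamma>(1,2) that by simp_all
  have joined_path: "path_of_length G0 (\<gamma> s) y L" if "joined (\<gamma> s) y L" "0 \<le> s" "s \<le> c" for s y L
    using that path_of_length.trivial[OF in0[OF that(2,3)]] by (auto simp: joined_def)
  have between: "t - s \<le> L" if "joined (\<gamma> s) (\<gamma> t) L" "0 \<le> s" "s \<le> t" "t \<le> c" for s t L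
  proof -
    have "path_of_length G0 (\<gamma> s) (\<gamma> t) L" using joined_path that by simp
    then have "path_of_length G0 ?A ?B (s + L + (c - t))"
      using path_trans[OF to_B[of t] path_trans[OF _ from_A[of s]]] that by simp
    from c(2)[OF this] show ?thesis by simp
  qed
  have joined_sym: "joined y x L" if "joined x y L" for x y L
    using that path_sym[OF wf_delete] by (auto simp: joined_def)
  have exit: "min s (c - s) \<le> L" if j: "joined (\<gamma> s) \<alpha> L" "h \<alpha> = V" and s: "0 \<le> s" "s \<le> c" for s \<alpha> L
  proof -
    have p: "path_of_length G0 (\<gamma> s) \<alpha> L" by (rule joined_path[OF j(1) s])
    consider "\<alpha> = ?A" | "\<alpha> = ?B" using fibre_V_delete[OF j(2) joined_in[OF j(1) in0[OF s]]] by blast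
    then show ?thesis
    proof cases
      case 1
      have "path_of_length G0 ?A ?B (L + (c - s))"
        using path_trans[OF to_B[OF s] path_sym[OF wf_delete p]] 1 by simp
      from c(2)[OF this] show ?thesis by simp
    next
      case 2
      have "path_of_length G0 ?A ?B (s + L)"
        using path_trans[OF p from_A[OF s]] 2 by simp
      from c(2)[OF this] show ?thesis by simp
    qed
  qed
  define \<eta> where "\<eta> s = h (\<gamma> s)" for s
  \<comment> \<open>By minimality of \<open>c\<close> no path avoiding \<open>e\<close> shortens the
    arc from \<open>\<gamma> s\<close> to \<open>\<gamma> t\<close> or the way from either point to
    the ends of \<open>e\<close>. The right choice in the two inner minima gives the complementary
    arc \<open>c - (t - s)\<close>; the other choices exceed neither less than \<open>t - s\<close>,
    so the bound is the distance on a circle of length \<open>c\<close>.\<close>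
  have cycle: "min (t - s) (min s (c - s) + min t (c - t)) \<le> d' (\<eta> s) (\<eta> t)"
    if st: "0 \<le> s" "s \<le> t" "t \<le> c" for s t
  proof -
    have st': "0 \<le> t" "s \<le> c" using st by simp_all
    show ?thesis unfolding \<eta>_def
    proof (rule dist_contract_cases[OF inG[OF st(1) st'(2)] inG[OF st'(1) st(3)]])
      assume "\<exists>L. joined (\<gamma> s) (\<gamma> t) L \<and> L \<le> d' (h (\<gamma> s)) (h (\<gamma> t))"
      then show "min (t - s) (min s (c - s) + min t (c - t)) \<le> d' (h (\<gamma> s)) (h (\<gamma> t))"
        using between st by fastforce
    next
      fix \<alpha> \<beta> L1 L2
      assume *: "h \<alpha> = V" "h \<beta> = V" "joined (\<gamma> s) \<alpha> L1" "joined \<beta> (\<gamma> t) L2"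
        "L1 + L2 \<le> d' (h (\<gamma> s)) (h (\<gamma> t))"
      show "min (t - s) (min s (c - s) + min t (c - t)) \<le> d' (h (\<gamma> s)) (h (\<gamma> t))"
        using exit[OF *(3,1) st(1) st'(2)] exit[OF joined_sym[OF *(4)] *(2) st'(1) st(3)] *(5)
        by linarith
    qed
  qed
  have "Gm.lipschitz_path \<gamma> c"
    by (rule Gm.lipschitz_pathI) (use c1 inG graph_dist_le[OF path_delete_imp[OF \<gamma>(3)]] in simp_all)
  then have lip: "Qm.lipschitz_path \<eta> c" unfolding \<eta>_def by (rule lipschitz_path_image)
  have \<eta>V: "\<eta> 0 = V" "\<eta> c = V" unfolding \<eta>_def by (simp_all add: \<gamma>)
  have \<eta>M: "\<eta> s \<in> graph_points G'" if "0 \<le> s" "s \<le> c" for s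
    unfolding \<eta>_def by (rule h_in[OF inG[OF that]])
  have lip1: "Qm.lipschitz_path (\<lambda>s. \<eta> (0 + s)) (c / 2 - 0)"
    by (rule Qm.lipschitz_path_subpath[OF lip]) (use c1 in simp_all)
  have lip2: "Qm.lipschitz_path (\<lambda>s. \<eta> (c / 2 + s)) (c - c / 2)"
    by (rule Qm.lipschitz_path_subpath[OF lip]) (use c1 in simp_all)
  \<comment> \<open>The two halves of the cycle are geodesics between \<open>V\<close> and the
    antipodal point \<open>\<eta> (c / 2)\<close>. With the side \<open>{V}\<close> they form a
    triangle in which the middle of one half is \<open>c / 4\<close> away from the other.\<close>
  have S1: "Qm.seg V (\<eta> (c / 2)) ((\<lambda>s. \<eta> (0 + s)) ` {0..c / 2 - 0})"
    by (rule Qm.segI[OF lip1]) (use cycle[of 0 "c / 2"] c1 \<eta>V in simp_all)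
  have S2: "Qm.seg (\<eta> (c / 2)) V ((\<lambda>s. \<eta> (c / 2 + s)) ` {0..c - c / 2})"
    by (rule Qm.segI[OF lip2]) (use cycle[of "c / 2" c] c1 \<eta>V in simp_all)
  have mid: "\<eta> (c / 4) \<in> (\<lambda>s. \<eta> (0 + s)) ` {0..c / 2 - 0}"
    by (rule image_eqI[of _ _ "c / 4"]) (use c1 in simp_all)
  have M: "\<eta> (c / 2) \<in> graph_points G'" by (rule \<eta>M) (use c1 in simp_all)
  obtain q where q: "q \<in> (\<lambda>s. \<eta> (c / 2 + s)) ` {0..c - c / 2} \<union> {V}" "d' (\<eta> (c / 4)) q \<le> r"
    using Qm.rips_thin[OF rips S1 S2 Qm.seg_trivial[OF V_in] V_in M V_in mid] .
  obtain t where t: "c / 2 \<le> t" "t \<le> c" "q = \<eta> t"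
  proof (cases "q = V")
    case True
    then show thesis using that[of c] \<eta>V c1 by simp
  next
    case False
    then obtain s where "0 \<le> s" "s \<le> c - c / 2" "q = \<eta> (c / 2 + s)" using q(1) by auto
    then show thesis using that[of "c / 2 + s"] by simp
  qed
  have "c / 4 \<le> d' (\<eta> (c / 4)) (\<eta> t)" using cycle[of "c / 4" t] t(1,2) c1 by linarith
  then show ?thesis using q(2) t(3) c1 by simp
qed

end

lemma ennreal_le_of_less:
  fixes x :: ennreal and D a b :: real
  assumes "\<And>\<epsilon>. 0 < \<epsilon> \<Longrightarrow> x \<le> ennreal (D + b * \<epsilon>)" "0 \<le> D" "0 < b"
  shows "x \<le> ennreal D"
proof (rule ennreal_le_epsilon)
  fix \<epsilon> :: real assume "0 < \<epsilon>"
  then have "x \<le> ennreal (D + b * (\<epsilon> / b))" using assms(1)[of "\<epsilon> / b"] assms(3) by simp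
  then show "x \<le> ennreal D + ennreal \<epsilon>" using assms(2,3) \<open>0 < \<epsilon>\<close> by (simp add: ennreal_plus)
qed

theorem theorem4p5:
  fixes G :: "('v, 'e) pre_digraph" and e :: 'e
  assumes "nonsimple_graph G" and "e \<in> arcs G"
  shows "1 / 3 * graph_delta (contract_edge G e) \<le> graph_delta G \<and>
         graph_delta G \<le> 16 / 3 * graph_delta (contract_edge G e) + 1"
proof
  interpret edge_contraction G e
    by unfold_locales (use assms nonsimple_graph_path_connected in auto)
  have delta_le: "graph_delta H \<le> ennreal r"
    if "rips_hyperbolic (graph_points H) (graph_dist H) r" "0 \<le> r" for H :: "('v, 'e) pre_digraph" and r
    unfolding graph_delta_def by (rule hyperbolicity_constant_le[OF that])
  have delta_rips: "rips_hyperbolic (graph_points H) (graph_dist H) (D + \<epsilon>)"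
    if "graph_delta H = ennreal D" "0 \<le> D" "0 < \<epsilon>" for H :: "('v, 'e) pre_digraph" and D \<epsilon>
    by (rule rips_hyperbolicI_hyperbolicity_constant)
      (use that in \<open>simp add: graph_delta_def ennreal_less_iff\<close>)
  show "1 / 3 * graph_delta G' \<le> graph_delta G"
  proof (cases "graph_delta G")
    case (real D)
    have "graph_delta G' \<le> ennreal (3 * D + 4 * \<epsilon>)" if \<epsilon>: "0 < \<epsilon>" for \<epsilon>
    proof -
      have "rips_hyperbolic (graph_points G') d' (3 * (D + \<epsilon>) + \<epsilon>)"
        by (rule rips_hyperbolic_contract[OF delta_rips \<epsilon>]) (use real \<epsilon> in simp_all)
      from delta_le[OF this] show ?thesis using real \<epsilon> by (simp add: algebra_simps)
    qed
    from ennreal_le_of_less[OF this] have "graph_delta G' \<le> ennreal (3 * D)" using real by simp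
    then have "1 / 3 * graph_delta G' \<le> 1 / 3 * ennreal (3 * D)" by (intro mult_left_mono) simp_all
    also have "\<dots> = ennreal (1 / 3) * ennreal (3 * D)"
      using divide_ennreal[of 1 3] by simp
    also have "\<dots> = ennreal D" using real by (subst ennreal_mult[symmetric]) simp_all
    finally show ?thesis using real by simp
  qed simp
  show "graph_delta G \<le> 16 / 3 * graph_delta G' + 1"
  proof (cases "graph_delta G'")
    case (real D)
    note rips' = delta_rips[OF real(2,1)]
    have "graph_delta G \<le> ennreal (16 / 3 * D + 1)"
    proof (cases "tail G e \<noteq> head G e \<and> (\<exists>L. path_of_length G0 (Vertex (tail G e)) (Vertex (head G e)) L)")
      case True
      then obtain L where L: "path_of_length G0 (Vertex (tail G e)) (Vertex (head G e)) L" by blast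
      have "1 / 4 \<le> D"
        by (rule field_le_epsilon) (use rips_hyperbolic_cycle[OF _ L rips'] True in blast)
      \<comment> \<open>Equivalent to \<open>3 / 14 \<le> D\<close>.\<close>
      then have D: "3 * D + 3 / 2 \<le> 16 / 3 * D + 1" by simp
      have "graph_delta G \<le> ennreal ((3 * D + 3 / 2) + 3 * \<epsilon>)" if "0 < \<epsilon>" for \<epsilon>
        using delta_le[OF rips_hyperbolic_expand[OF rips'[OF that]]] real(1) that by (simp add: algebra_simps)
      from ennreal_le_of_less[OF this] have "graph_delta G \<le> ennreal (3 * D + 3 / 2)" using real by simp
      also have "\<dots> \<le> ennreal (16 / 3 * D + 1)" using D by (intro ennreal_leI)
      finally show ?thesis .
    next
      case False
      then have expand: "rips_hyperbolic (graph_points G) d (r + 1)"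
        if "rips_hyperbolic (graph_points G') d' r" for r
        using that expand_loop expand_bridge by metis
      have "graph_delta G \<le> ennreal ((D + 1) + 1 * \<epsilon>)" if "0 < \<epsilon>" for \<epsilon>
        using delta_le[OF expand[OF rips'[OF that]]] real(1) that by (simp add: algebra_simps)
      from ennreal_le_of_less[OF this] have "graph_delta G \<le> ennreal (D + 1)" using real by simp
      also have "\<dots> \<le> ennreal (16 / 3 * D + 1)" using real(1) by (intro ennreal_leI) simp
      finally show ?thesis .
    qed
    also have "\<dots> = ennreal (16 / 3) * ennreal D + 1"
      using real(1) by (subst ennreal_mult[symmetric]) (simp_all add: ennreal_plus)
    also have "ennreal (16 / 3) = 16 / 3" using divide_ennreal[of 16 3] by simp
    finally show ?thesis using real(2) by simp
  qed (simp add: ennreal_mult_top)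
qed

end
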